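(* Let $m\ge 1$ be an integer and, for real $H>1$, let $\mathcal S_m(H)$ be the set of Salem numbers $\alpha$ of degree $2(m+1)$ with $\alpha\le H$. Then \[ \#\mathcal S_m(H)=\omega_m\,H^{m+1}+O\!\left(H^{m}\right),\qquad H\to\infty, \] where \[ \omega_m:=\frac{2^{m(m+1)}}{m+1}\,\prod_{k=0}^{m-1}\frac{(k!)^2}{(2k+1)!}. \] The implied constant in $O(\cdot)$ may depend on $m$.
   Context: A Salem number is a real algebraic integer $\alpha>1$ all of whose Galois conjugates (other than $\alpha$) have absolute value at most $1$, with at least one of them of absolute value exactly $1$. Its minimal polynomial is monic, self-reciprocal, of even degree $2(m+1)$, and its roots are $\alpha,\alpha^{-1}$ and $m$ pairs of complex conjugate numbers on the unit circle. *)

theory Defs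
  imports "HOL-Computational_Algebra.Computational_Algebra" "HOL-Analysis.Analysis"
begin

definition min_poly_rat :: "complex \<Rightarrow> rat poly" where
  "min_poly_rat z = (THE p. lead_coeff p = 1 \<and> irreducible p \<and>
       poly (map_poly of_rat p) z = 0)"

definition conjugates :: "complex \<Rightarrow> complex set" where
  "conjugates z = {w. poly (map_poly of_rat (min_poly_rat z)) w = 0}"

definition salem :: "real \<Rightarrow> bool" where
  "salem \<alpha> \<longleftrightarrow> \<alpha> > 1 \<and> algebraic_int \<alpha> \<and>
     (\<forall>w\<in>conjugates (complex_of_real \<alpha>). w \<noteq> complex_of_real \<alpha> \<longrightarrow> cmod w \<le> 1) \<and>
     (\<exists>w\<in>conjugates (complex_of_real \<alpha>). cmod w = 1)"

definition alg_degree :: "real \<Rightarrow> nat" where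
  "alg_degree \<alpha> = degree (min_poly_rat (complex_of_real \<alpha>))"

definition salem_set :: "nat \<Rightarrow> real \<Rightarrow> real set" where
  "salem_set m H = {\<alpha>. salem \<alpha> \<and> alg_degree \<alpha> = 2 * (m + 1) \<and> \<alpha> \<le> H}"

definition omega :: "nat \<Rightarrow> real" where
  "omega m = 2 ^ (m * (m + 1)) / real (m + 1) *
     (\<Prod>k<m. (fact k)^2 / fact (2 * k + 1))"

end

theory Submission
  imports Defs "HOL-Probability.Probability"
begin

text \<open>
  If \<open>\<alpha>\<close> is a Salem number of degree \<open>2(m+1)\<close>, the conjugates of \<open>\<alpha> + 1/\<alpha> + 2\<close> are this number and
  \<open>m\<close> reals in \<open>(0,4)\<close>, so counting \<open>\<alpha> \<le> H\<close> amounts to counting irreducible monic integer polynomials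
  of degree \<open>m+1\<close> with \<open>m\<close> simple roots in \<open>(0,4)\<close> and one root in \<open>(4,T)\<close>, where \<open>T = H + 1/H + 2\<close>.
  The reducible ones are \<open>O(T\<^sup>m)\<close>: the factor carrying the large root has degree at most \<open>m\<close> and
  coefficients \<open>O(T)\<close>, the other one has bounded coefficients.

  The number of lattice points differs from the volume of the region by at most the number of unit cubes
  meeting both the region and its complement. By continuity of roots along a segment, such a cube
  contains a polynomial with a double root or a root at an endpoint, and a grid of mesh \<open>1/T\<close> for the small roots
  and mesh \<open>1\<close> for the large one shows that there are \<open>O(T\<^sup>m)\<close> such cubes.

  Splitting off the large root gives the volume \<open>\<integral> h(x)\<close> over \<open>4 < x < T\<close> and over the monic \<open>h\<close> of degree \<open>m\<close>
  with roots in \<open>(0,4)\<close>; as \<open>(x-4)\<^sup>m \<le> h(x) \<le> x\<^sup>m\<close>, the main term is \<open>T\<^sup>m\<^sup>+\<^sup>1/(m+1)\<close> times the volume of the set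
  of these \<open>h\<close>. Splitting off further roots turns the latter into \<open>1/m!\<close> times the integral of
  the absolute value of the Vandermonde determinant over \<open>[0,4]\<^sup>m\<close>, which Aomoto's integration by parts evaluates.
\<close>

section \<open>The Selberg integral at exponent one half\<close>

text \<open>Adding 2 to z + 1/z moves the small roots to (0,4), where their products are positive,
  and turns the map into (z + 1)^2 / z. The error term is a count of dimensions: a degenerate root
  vector satisfies an equation in its m + 1 coordinates, each with O(T) grid values. The mesh of the
  small roots has to be 1/T because the coefficients contain products of small roots with the large
  one, which may be as large as T; with this mesh the coefficients move by a bounded amount, hence
  over boundedly many cubes. No Jacobian determinant in several variables is computed. One root is
  removed at a time: a one-dimensional substitution replaces the constant term by a root, and a
  unimodular shear passes to the quotient. The derivative leaves the value of the quotient at that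
  root, and these values accumulate to the Vandermonde product. Roots never enter as functions of
  the coefficients. Having the required roots is expressed by sign changes at rational points, an
  open condition and a countable union, which yields openness and measurability at once.\<close>

definition unif :: "real measure" where
  "unif = uniform_measure lborel {0..4}"

text \<open>Normalising each factor to mass 1 makes every cube a probability space, so bounded
  measurable functions are integrable; the lost factor 4 per coordinate is restored in
  \<open>nn_integral_unif\<close>.\<close>

definition cube :: "nat \<Rightarrow> (nat \<Rightarrow> real) measure" where
  "cube n = PiM {..<n} (\<lambda>_. unif)"

definition vdm :: "nat \<Rightarrow> (nat \<Rightarrow> real) \<Rightarrow> real" where
  "vdm n x = (\<Prod>i<n. \<Prod>j<i. \<bar>x i - x j\<bar>)"

lemma prob_space_unif: "prob_space unif"
  unfolding unif_def by (rule prob_space_uniform_measure) auto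

lemma sets_unif [measurable_cong, simp]: "sets unif = sets borel"
  by (simp add: unif_def)

lemma space_unif [simp]: "space unif = UNIV"
  by (simp add: unif_def)

interpretation unif: product_prob_space "\<lambda>_::nat. unif" I for I
  by (intro product_prob_spaceI prob_space_unif)

lemma prob_space_cube: "prob_space (cube n)"
  unfolding cube_def by (intro prob_space_PiM prob_space_unif)

lemma measurable_cube_coord [measurable]: "i < n \<Longrightarrow> (\<lambda>x. x i) \<in> borel_measurable (cube n)"
  unfolding cube_def by (intro measurable_component_singleton[THEN measurable_compose]) auto

lemma AE_cube: "AE x in cube n. \<forall>i<n. x i \<in> {0..4}"
proof -
  have "AE x in cube n. x i \<in> {0..4}" if "i < n" for i
    unfolding cube_def
  proof (rule AE_PiM_component)
    show "AE u in unif. u \<in> {0..4}"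
      unfolding unif_def by (rule AE_uniform_measureI) auto
  qed (use that prob_space_unif in auto)
  then have "AE x in cube n. \<forall>i\<in>{..<n}. x i \<in> {0..4}"
    by (subst AE_finite_all) auto
  then show ?thesis by (rule AE_mp) auto
qed

text \<open>Boundedness is asked on the cube only, where coordinates are bounded. The cube has full
  measure, so this suffices for integrability, and the class is closed under all operations that
  build the integrands below.\<close>

definition bdd_meas :: "nat \<Rightarrow> ((nat \<Rightarrow> real) \<Rightarrow> real) \<Rightarrow> bool" where
  "bdd_meas n f \<longleftrightarrow> f \<in> borel_measurable (cube n) \<and> (\<exists>B. \<forall>x. (\<forall>i<n. x i \<in> {0..4}) \<longrightarrow> \<bar>f x\<bar> \<le> B)"

lemma bdd_meas_integrable: "bdd_meas n f \<Longrightarrow> integrable (cube n) f"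
proof -
  assume "bdd_meas n f"
  then obtain B where f: "f \<in> borel_measurable (cube n)"
    and B: "\<And>x. (\<forall>i<n. x i \<in> {0..4}) \<Longrightarrow> \<bar>f x\<bar> \<le> B"
    unfolding bdd_meas_def by blast
  interpret prob_space "cube n" by (rule prob_space_cube)
  show ?thesis
    by (rule integrable_const_bound[where B = B])
       (use AE_cube[of n] B in \<open>auto intro: f elim!: AE_mp\<close>)
qed

lemma bdd_meas_const [intro, simp]: "bdd_meas n (\<lambda>_. c)"
  by (auto simp: bdd_meas_def)

lemma bdd_meas_coord [intro]: "i < n \<Longrightarrow> bdd_meas n (\<lambda>x. x i)"
  unfolding bdd_meas_def by (auto intro!: exI[of _ 4])

lemma bdd_meas_add [intro]: "bdd_meas n f \<Longrightarrow> bdd_meas n g \<Longrightarrow> bdd_meas n (\<lambda>x. f x + g x)"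
proof (clarsimp simp: bdd_meas_def)
  fix B C assume "\<forall>x. (\<forall>i<n. 0 \<le> x i \<and> x i \<le> 4) \<longrightarrow> \<bar>f x\<bar> \<le> B"
    "\<forall>x. (\<forall>i<n. 0 \<le> x i \<and> x i \<le> 4) \<longrightarrow> \<bar>g x\<bar> \<le> C"
  then show "\<exists>B. \<forall>x. (\<forall>i<n. 0 \<le> x i \<and> x i \<le> 4) \<longrightarrow> \<bar>f x + g x\<bar> \<le> B"
    by (intro exI[of _ "B + C"]) (smt (verit))
qed

lemma bdd_meas_mult [intro]: "bdd_meas n f \<Longrightarrow> bdd_meas n g \<Longrightarrow> bdd_meas n (\<lambda>x. f x * g x)"
proof (clarsimp simp: bdd_meas_def)
  fix B C assume B: "\<forall>x. (\<forall>i<n. 0 \<le> x i \<and> x i \<le> 4) \<longrightarrow> \<bar>f x\<bar> \<le> B"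
    and C: "\<forall>x. (\<forall>i<n. 0 \<le> x i \<and> x i \<le> 4) \<longrightarrow> \<bar>g x\<bar> \<le> C"
  show "\<exists>B. \<forall>x. (\<forall>i<n. 0 \<le> x i \<and> x i \<le> 4) \<longrightarrow> \<bar>f x * g x\<bar> \<le> B"
  proof (intro exI[of _ "B * C"] allI impI)
    fix x :: "nat \<Rightarrow> real" assume "\<forall>i<n. 0 \<le> x i \<and> x i \<le> 4"
    then have "\<bar>f x\<bar> \<le> B" "\<bar>g x\<bar> \<le> C" using B C by auto
    then show "\<bar>f x * g x\<bar> \<le> B * C"
      unfolding abs_mult by (intro mult_mono) auto
  qed
qed

lemma bdd_meas_uminus [intro]: "bdd_meas n f \<Longrightarrow> bdd_meas n (\<lambda>x. - f x)"
  using bdd_meas_mult[OF bdd_meas_const[of n "-1"], of f] by simp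

lemma bdd_meas_diff [intro]: "bdd_meas n f \<Longrightarrow> bdd_meas n g \<Longrightarrow> bdd_meas n (\<lambda>x. f x - g x)"
  using bdd_meas_add[OF _ bdd_meas_uminus] by fastforce

lemma bdd_meas_abs [intro]: "bdd_meas n f \<Longrightarrow> bdd_meas n (\<lambda>x. \<bar>f x\<bar>)"
  by (auto simp: bdd_meas_def)

lemma bdd_meas_sgn [intro]: "bdd_meas n f \<Longrightarrow> bdd_meas n (\<lambda>x. sgn (f x))"
proof -
  assume "bdd_meas n f"
  moreover have "\<bar>sgn (f x)\<bar> \<le> 1" for x by (simp add: sgn_if)
  ultimately show ?thesis unfolding bdd_meas_def by auto
qed

lemma bdd_meas_sum [intro]: "(\<And>i. i \<in> A \<Longrightarrow> bdd_meas n (f i)) \<Longrightarrow> bdd_meas n (\<lambda>x. \<Sum>i\<in>A. f i x)"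
  by (induction A rule: infinite_finite_induct) auto

lemma bdd_meas_prod [intro]: "(\<And>i. i \<in> A \<Longrightarrow> bdd_meas n (f i)) \<Longrightarrow> bdd_meas n (\<lambda>x. \<Prod>i\<in>A. f i x)"
  by (induction A rule: infinite_finite_induct) auto

lemma bdd_meas_vdm [intro]: "k \<le> n \<Longrightarrow> bdd_meas n (vdm k)"
  unfolding vdm_def[abs_def] by (intro bdd_meas_prod bdd_meas_abs bdd_meas_diff bdd_meas_coord) auto

lemma vdm_Suc: "vdm (Suc n) x = vdm n x * (\<Prod>j<n. \<bar>x n - x j\<bar>)"
  by (simp add: vdm_def)

lemma vdm_nonneg: "vdm n x \<ge> 0"
  by (auto simp: vdm_def intro!: prod_nonneg)

lemma vdm_cong: "(\<And>i. i < n \<Longrightarrow> x i = y i) \<Longrightarrow> vdm n x = vdm n y"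
  unfolding vdm_def by (intro prod.cong refl) auto

text \<open>Squaring removes the ordering of the indices: every unordered pair now occurs twice. In
  this form the invariance under permutations is visible, and nonnegativity carries it back to
  \<open>vdm\<close>.\<close>

lemma vdm_square: "(vdm n x)\<^sup>2 = (\<Prod>i<n. \<Prod>j\<in>{..<n} - {i}. \<bar>x i - x j\<bar>)"
proof (induction n)
  case (Suc n)
  have "(\<Prod>i<Suc n. \<Prod>j\<in>{..<Suc n} - {i}. \<bar>x i - x j\<bar>) =
     (\<Prod>i<n. \<Prod>j\<in>{..<Suc n} - {i}. \<bar>x i - x j\<bar>) * (\<Prod>j<n. \<bar>x n - x j\<bar>)"
    by (simp add: lessThan_Suc)
  also have "(\<Prod>i<n. \<Prod>j\<in>{..<Suc n} - {i}. \<bar>x i - x j\<bar>) =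
     (\<Prod>i<n. \<bar>x i - x n\<bar> * (\<Prod>j\<in>{..<n} - {i}. \<bar>x i - x j\<bar>))"
  proof (intro prod.cong refl)
    fix i assume "i \<in> {..<n}"
    then have "{..<Suc n} - {i} = insert n ({..<n} - {i})" by auto
    then show "(\<Prod>j\<in>{..<Suc n} - {i}. \<bar>x i - x j\<bar>) = \<bar>x i - x n\<bar> * (\<Prod>j\<in>{..<n} - {i}. \<bar>x i - x j\<bar>)"
      by simp
  qed
  also have "\<dots> = (\<Prod>j<n. \<bar>x n - x j\<bar>) * (vdm n x)\<^sup>2"
    by (simp add: prod.distrib Suc abs_minus_commute)
  finally show ?case
    by (simp add: vdm_Suc power_mult_distrib power2_eq_square mult_ac)
qed (simp add: vdm_def)

lemma vdm_transpose:
  assumes "a < n" "b < n"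
  shows "vdm n (x \<circ> Transposition.transpose a b) = vdm n x"
proof -
  let ?t = "Transposition.transpose a b"
  have bij: "bij_betw ?t {..<n} {..<n}"
    using assms by (intro bij_betwI[where g = ?t]) (auto simp: Transposition.transpose_def)
  have "(vdm n (x \<circ> ?t))\<^sup>2 = (\<Prod>i<n. \<Prod>j\<in>{..<n} - {i}. \<bar>x (?t i) - x (?t j)\<bar>)"
    by (simp add: vdm_square)
  also have "\<dots> = (\<Prod>i<n. \<Prod>j\<in>{..<n} - {?t i}. \<bar>x (?t i) - x j\<bar>)"
  proof (rule prod.cong[OF refl])
    fix i assume i: "i \<in> {..<n}"
    have "bij_betw ?t ({..<n} - {i}) ({..<n} - {?t i})"
      using assms i by (intro bij_betwI[where g = ?t]) (auto simp: Transposition.transpose_def split: if_splits)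
    then show "(\<Prod>j\<in>{..<n} - {i}. \<bar>x (?t i) - x (?t j)\<bar>) = (\<Prod>j\<in>{..<n} - {?t i}. \<bar>x (?t i) - x j\<bar>)"
      by (rule prod.reindex_bij_betw[where g = "\<lambda>j. \<bar>x (?t i) - x j\<bar>"])
  qed
  also have "\<dots> = (vdm n x)\<^sup>2"
    unfolding vdm_square by (rule prod.reindex_bij_betw[OF bij, where g = "\<lambda>i. \<Prod>j\<in>{..<n} - {i}. \<bar>x i - x j\<bar>"])
  finally show ?thesis
    using vdm_nonneg by (simp add: power2_eq_iff_nonneg)
qed

lemma integral_cube_transpose:
  fixes f :: "(nat \<Rightarrow> real) \<Rightarrow> real"
  assumes "a < n" "b < n" and f [measurable]: "f \<in> borel_measurable (cube n)"
  shows "(\<integral>x. f (x \<circ> Transposition.transpose a b) \<partial>cube n) = (\<integral>x. f x \<partial>cube n)"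
proof -
  let ?t = "Transposition.transpose a b"
  have t: "inj_on ?t {..<n}" "?t \<in> {..<n} \<rightarrow> {..<n}"
    using assms by (auto simp: Transposition.transpose_def inj_on_def split: if_splits)
  have d: "distr (cube n) (cube n) (\<lambda>\<omega>. \<lambda>i\<in>{..<n}. \<omega> (?t i)) = cube n"
    using distr_PiM_reindex[of "{..<n}" "\<lambda>_. unif" ?t "{..<n}"] t prob_space_unif
    by (simp add: cube_def)
  have m: "(\<lambda>\<omega>. \<lambda>i\<in>{..<n}. \<omega> (?t i)) \<in> measurable (cube n) (cube n)"
    unfolding cube_def using t by (intro measurable_restrict measurable_component_singleton) auto
  have "(\<integral>x. f x \<partial>cube n) = (\<integral>x. f (\<lambda>i\<in>{..<n}. x (?t i)) \<partial>cube n)"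
    by (subst d[symmetric], subst integral_distr[OF m]) (auto simp: f)
  also have "\<dots> = (\<integral>x. f (x \<circ> ?t) \<partial>cube n)"
  proof (intro Bochner_Integration.integral_cong refl arg_cong[where f = f])
    fix x assume "x \<in> space (cube n)"
    \<comment> \<open>Points of the product space are \<open>undefined\<close> outside
      \<open>{..<n}\<close>, and the transposition fixes those indices, so the restriction produced
      by the reindexing theorem changes nothing.\<close>
    then have "x i = undefined" if "i \<ge> n" for i
      using that by (auto simp: cube_def space_PiM PiE_def extensional_def)
    then show "(\<lambda>i\<in>{..<n}. x (?t i)) = x \<circ> ?t"
      using assms by (auto simp: fun_eq_iff Transposition.transpose_def restrict_def)
  qed
  finally show ?thesis ..
qed

section \<open>Integration by parts in one coordinate\<close>

lemma integral_unif_derivative: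
  assumes der: "\<And>u. u \<in> {0<..<4} - S \<Longrightarrow> (F has_real_derivative f u) (at u)"
    and "finite S" "continuous_on {0..4} F"
    and f: "f \<in> borel_measurable borel" "\<And>u. u \<in> {0..4} \<Longrightarrow> \<bar>f u\<bar> \<le> B"
  shows "(\<integral>u. f u \<partial>unif) = (F 4 - F 0) / 4"
proof -
  have 1: "(f has_integral (F 4 - F 0)) {0..4}"
    by (rule fundamental_theorem_of_calculus_interior_strong[of S])
       (use assms in \<open>auto simp: has_real_derivative_iff_has_vector_derivative\<close>)
  have "set_integrable lborel {0..4} f"
    unfolding set_integrable_def
    by (rule integrableI_bounded_set[where A = "{0..4}" and B = B])
       (use f in \<open>auto simp: indicator_def\<close>)
  then have "(LINT u:{0..4}|lborel. f u) = integral {0..4} f"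
    by (rule set_borel_integral_eq_integral(2))
  also have "\<dots> = F 4 - F 0" using 1 by (rule integral_unique)
  finally have 2: "(LINT u:{0..4}|lborel. f u) = F 4 - F 0" .
  have "indicator {0..4} u / emeasure lborel {0..4::real} = ennreal (indicator {0..4} u / 4)" for u :: real
    using divide_ennreal[of 1 4] by (simp add: indicator_def)
  then have "unif = density lborel (\<lambda>u. ennreal (indicator {0..4} u / 4))"
    by (simp add: unif_def uniform_measure_def)
  then have "(\<integral>u. f u \<partial>unif) = (\<integral>u. (indicator {0..4} u / 4) * f u \<partial>lborel)"
    using f by (simp only: \<open>unif = _\<close>, subst integral_real_density) auto
  also have "\<dots> = (\<integral>u. (indicator {0..4} u * f u) / 4 \<partial>lborel)" by simp
  also have "\<dots> = (LINT u:{0..4}|lborel. f u) / 4"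
    unfolding set_lebesgue_integral_def by (subst integral_divide_zero) simp
  finally show ?thesis using 2 by simp
qed

lemma DERIV_abs_diff:
  fixes u a :: real
  assumes "u \<noteq> a"
  shows "((\<lambda>v. \<bar>v - a\<bar>) has_real_derivative sgn (u - a)) (at u)"
proof (cases "u > a")
  case True
  have "((\<lambda>v. v - a) has_real_derivative 1) (at u)"
    by (auto intro!: derivative_eq_intros)
  then have "((\<lambda>v. \<bar>v - a\<bar>) has_real_derivative 1) (at u)"
    by (rule has_field_derivative_transform_within_open[where S = "{a<..}"]) (use True in auto)
  then show ?thesis using True by simp
next
  case False
  have "((\<lambda>v. a - v) has_real_derivative -1) (at u)"
    by (auto intro!: derivative_eq_intros)
  then have "((\<lambda>v. \<bar>v - a\<bar>) has_real_derivative -1) (at u)"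
    by (rule has_field_derivative_transform_within_open[where S = "{..<a}"]) (use False assms in auto)
  then show ?thesis using False assms by simp
qed

text \<open>The integrand is the derivative in \<open>u\<close> of the quadratic times the product,
  away from the finitely many corners \<open>u = x j\<close>. The right-hand side consists of the
  boundary terms at 4 and 0, divided by the length 4 of the interval.\<close>

lemma integral_unif_prod_abs:
  fixes \<alpha> \<beta> \<gamma> :: real and n :: nat
  shows "(\<integral>u. (\<beta> + 2 * \<gamma> * u) * (\<Prod>j<n. \<bar>u - x j\<bar>) + (\<alpha> + \<beta> * u + \<gamma> * u\<^sup>2) *
        (\<Sum>j<n. sgn (u - x j) * (\<Prod>k\<in>{..<n} - {j}. \<bar>u - x k\<bar>)) \<partial>unif)
     = ((\<alpha> + 4 * \<beta> + 16 * \<gamma>) * (\<Prod>j<n. \<bar>4 - x j\<bar>) - \<alpha> * (\<Prod>j<n. \<bar>x j\<bar>)) / 4"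
    (is "integral\<^sup>L _ ?f = _")
proof -
  let ?F = "\<lambda>u. (\<alpha> + \<beta> * u + \<gamma> * u\<^sup>2) * (\<Prod>j<n. \<bar>u - x j\<bar>)"
  \<comment> \<open>The signs make the integrand discontinuous; dropping them gives this continuous
    majorant, which is bounded by compactness.\<close>
  let ?g = "\<lambda>u. \<bar>\<beta> + 2 * \<gamma> * u\<bar> * (\<Prod>j<n. \<bar>u - x j\<bar>) + \<bar>\<alpha> + \<beta> * u + \<gamma> * u\<^sup>2\<bar> *
        (\<Sum>j<n. (\<Prod>k\<in>{..<n} - {j}. \<bar>u - x k\<bar>))"
  have "compact (?g ` {0..4})"
    by (intro compact_continuous_image continuous_intros) auto
  then have "bounded (?g ` {0..4})" by (rule compact_imp_bounded)
  then obtain B where B': "\<forall>y\<in>?g ` {0..4}. norm y \<le> B" unfolding bounded_iff by blast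
  have B: "\<bar>?g u\<bar> \<le> B" if "u \<in> {0..4}" for u
    using bspec[OF B' imageI[OF that]] by (simp only: real_norm_def)
  have "(\<integral>u. ?f u \<partial>unif) = (?F 4 - ?F 0) / 4"
  proof (rule integral_unif_derivative[where S = "x ` {..<n}" and B = B])
    fix u assume u: "u \<in> {0<..<4} - x ` {..<n}"
    have "((\<lambda>u. \<Prod>j<n. \<bar>u - x j\<bar>) has_real_derivative
      (\<Sum>j<n. sgn (u - x j) * (\<Prod>k\<in>{..<n} - {j}. \<bar>u - x k\<bar>))) (at u)"
      using u by (intro has_field_derivative_prod DERIV_abs_diff) auto
    moreover have "((\<lambda>u. \<alpha> + \<beta> * u + \<gamma> * u\<^sup>2) has_real_derivative \<beta> + 2 * \<gamma> * u) (at u)"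
      by (auto intro!: derivative_eq_intros)
    ultimately show "(?F has_real_derivative ?f u) (at u)"
      by (auto dest: DERIV_mult simp: algebra_simps)
  next
    show "continuous_on {0..4} ?F" by (intro continuous_intros)
    show "?f \<in> borel_measurable borel" by measurable
    fix u :: real assume u: "u \<in> {0..4}"
    have "\<bar>\<Sum>j<n. sgn (u - x j) * (\<Prod>k\<in>{..<n} - {j}. \<bar>u - x k\<bar>)\<bar>
        \<le> (\<Sum>j<n. (\<Prod>k\<in>{..<n} - {j}. \<bar>u - x k\<bar>))"
    proof (rule order_trans[OF sum_abs], rule sum_mono)
      fix j
      have "0 \<le> (\<Prod>k\<in>{..<n} - {j}. \<bar>u - x k\<bar>)" by (intro prod_nonneg) auto
      then show "\<bar>sgn (u - x j) * (\<Prod>k\<in>{..<n} - {j}. \<bar>u - x k\<bar>)\<bar> \<le> (\<Prod>k\<in>{..<n} - {j}. \<bar>u - x k\<bar>)"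
        by (auto simp: sgn_if abs_mult)
    qed
    then have "\<bar>?f u\<bar> \<le> ?g u"
      by (intro order_trans[OF abs_triangle_ineq] add_mono)
         (auto simp: abs_mult abs_prod intro!: mult_left_mono)
    then show "\<bar>?f u\<bar> \<le> B" using B[OF u] by linarith
  qed auto
  then show ?thesis by simp
qed

text \<open>The contribution of the factor \<open>\<bar>x n - x j\<bar>\<close> to the derivative of \<open>vdm (Suc n)\<close> in \<open>x n\<close>, written
  without division to make its boundedness evident.\<close>

definition vdm_partial :: "nat \<Rightarrow> nat \<Rightarrow> (nat \<Rightarrow> real) \<Rightarrow> real" where
  "vdm_partial n j x = sgn (x n - x j) * (vdm n x * (\<Prod>k\<in>{..<n} - {j}. \<bar>x n - x k\<bar>))"

text \<open>For \<open>x n = x j\<close> both sides are 0, since \<open>sgn 0 = 0\<close> and a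
  quotient by 0 is 0; hence no side condition.\<close>

lemma vdm_partial_eq: "j < n \<Longrightarrow> vdm_partial n j x = vdm (Suc n) x / (x n - x j)"
proof -
  assume "j < n"
  then have "(\<Prod>k<n. \<bar>x n - x k\<bar>) = \<bar>x n - x j\<bar> * (\<Prod>k\<in>{..<n} - {j}. \<bar>x n - x k\<bar>)"
    by (subst prod.remove[of _ j]) auto
  then show ?thesis
    by (simp add: vdm_partial_def vdm_Suc sgn_if field_simps)
qed

lemma bdd_meas_vdm_partial [intro]: "j < n \<Longrightarrow> bdd_meas (Suc n) (vdm_partial n j)"
  unfolding vdm_partial_def[abs_def] by (intro bdd_meas_mult bdd_meas_sgn bdd_meas_diff bdd_meas_coord bdd_meas_prod bdd_meas_abs bdd_meas_vdm) auto

text \<open>By Fubini the last variable is integrated first, and a weight \<open>q\<close> free of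
  it passes through. The quadratic is left open because two choices are needed:
  \<open>4 * u - u\<^sup>2\<close> kills both boundary terms, while \<open>u - 4\<close> keeps the
  one at 0, which leads to one dimension less.\<close>

lemma integration_by_parts_vdm:
  fixes \<alpha> \<beta> \<gamma> :: real
  assumes q: "bdd_meas (Suc n) q" "\<And>x u. q (x(n := u)) = q x"
  shows "(\<integral>x. q x * ((\<beta> + 2 * \<gamma> * x n) * vdm (Suc n) x + (\<alpha> + \<beta> * x n + \<gamma> * (x n)\<^sup>2) *
            (\<Sum>j<n. vdm_partial n j x)) \<partial>cube (Suc n))
    = (\<integral>x. q x * (vdm n x * (((\<alpha> + 4 * \<beta> + 16 * \<gamma>) * (\<Prod>j<n. \<bar>4 - x j\<bar>) - \<alpha> * (\<Prod>j<n. \<bar>x j\<bar>)) / 4)) \<partial>cube n)"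
    (is "integral\<^sup>L _ ?f = _")
proof -
  have "bdd_meas (Suc n) ?f"
    by (intro bdd_meas_mult bdd_meas_add bdd_meas_const bdd_meas_coord bdd_meas_sum bdd_meas_vdm_partial bdd_meas_vdm q) (auto simp: power2_eq_square)
  then have "integrable (PiM (insert n {..<n}) (\<lambda>_. unif)) ?f"
    using bdd_meas_integrable[of "Suc n" ?f] by (simp add: cube_def lessThan_Suc)
  then have "(\<integral>x. ?f x \<partial>cube (Suc n)) = (\<integral>x. (\<integral>u. ?f (x(n := u)) \<partial>unif) \<partial>cube n)"
    unfolding cube_def lessThan_Suc by (subst unif.product_integral_insert) auto
  also have "\<dots> = (\<integral>x. q x * (vdm n x * (((\<alpha> + 4 * \<beta> + 16 * \<gamma>) * (\<Prod>j<n. \<bar>4 - x j\<bar>) - \<alpha> * (\<Prod>j<n. \<bar>x j\<bar>)) / 4)) \<partial>cube n)"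
  proof (intro Bochner_Integration.integral_cong refl)
    fix x :: "nat \<Rightarrow> real"
    have v: "vdm n (x(n := u)) = vdm n x" for u by (rule vdm_cong) auto
    have "?f (x(n := u)) = q x * (vdm n x * ((\<beta> + 2 * \<gamma> * u) * (\<Prod>j<n. \<bar>u - x j\<bar>) + (\<alpha> + \<beta> * u + \<gamma> * u\<^sup>2) *
        (\<Sum>j<n. sgn (u - x j) * (\<Prod>k\<in>{..<n} - {j}. \<bar>u - x k\<bar>))))" for u
    proof -
      have "(\<Prod>j<n. \<bar>u - (x(n := u)) j\<bar>) = (\<Prod>j<n. \<bar>u - x j\<bar>)" by (intro prod.cong) auto
      moreover have "(\<Sum>j<n. vdm_partial n j (x(n := u))) =
        vdm n x * (\<Sum>j<n. sgn (u - x j) * (\<Prod>k\<in>{..<n} - {j}. \<bar>u - x k\<bar>))"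
        unfolding sum_distrib_left vdm_partial_def v
        by (intro sum.cong) (auto intro!: prod.cong)
      ultimately show ?thesis
        using q(2) by (simp add: vdm_Suc v algebra_simps)
    qed
    then show "(\<integral>u. ?f (x(n := u)) \<partial>unif) = q x * (vdm n x * (((\<alpha> + 4 * \<beta> + 16 * \<gamma>) * (\<Prod>j<n. \<bar>4 - x j\<bar>) - \<alpha> * (\<Prod>j<n. \<bar>x j\<bar>)) / 4))"
      by (simp only: integral_mult_right_zero integral_unif_prod_abs)
  qed
  finally show ?thesis .
qed

lemma integral_cube_symmetrize:
  assumes "a < n" "b < n" "bdd_meas n f"
  shows "(\<integral>x. f x \<partial>cube n) = (\<integral>x. f x + f (x \<circ> Transposition.transpose a b) \<partial>cube n) / 2"
proof -
  let ?t = "Transposition.transpose a b"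
  have "bdd_meas n (\<lambda>x. f (x \<circ> ?t))"
  proof -
    have m: "f \<in> borel_measurable (cube n)" using assms by (simp add: bdd_meas_def)
    have "(\<lambda>x. f (x \<circ> ?t)) \<in> borel_measurable (cube n)"
    proof (rule measurable_compose[OF _ m])
      have "(\<lambda>x. \<lambda>i\<in>{..<n}. x (?t i)) \<in> measurable (cube n) (cube n)"
        unfolding cube_def using assms
        by (intro measurable_restrict measurable_component_singleton) (auto simp: Transposition.transpose_def)
      also have "?this \<longleftrightarrow> (\<lambda>x. x \<circ> ?t) \<in> measurable (cube n) (cube n)"
      proof (rule measurable_cong)
        fix x assume "x \<in> space (cube n)"
        then have "x i = undefined" if "i \<ge> n" for i
          using that by (auto simp: cube_def space_PiM PiE_def extensional_def)
        then show "(\<lambda>i\<in>{..<n}. x (?t i)) = x \<circ> ?t"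
          using assms by (auto simp: fun_eq_iff Transposition.transpose_def restrict_def)
      qed
      finally show "(\<lambda>x. x \<circ> ?t) \<in> measurable (cube n) (cube n)" .
    qed
    moreover obtain B where B: "\<And>x. (\<forall>i<n. x i \<in> {0..4}) \<Longrightarrow> \<bar>f x\<bar> \<le> B"
      using assms unfolding bdd_meas_def by blast
    have "\<bar>f (x \<circ> ?t)\<bar> \<le> B" if "\<forall>i<n. x i \<in> {0..4}" for x
      using that assms by (intro B) (auto simp: Transposition.transpose_def)
    ultimately show ?thesis unfolding bdd_meas_def by blast
  qed
  from bdd_meas_integrable[OF this] bdd_meas_integrable[OF assms(3)] show ?thesis
    using assms integral_cube_transpose[of a n b f]
    by (subst Bochner_Integration.integral_add) (auto simp: bdd_meas_def)
qed

section \<open>Aomoto's averages and the value of the integral\<close>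

definition moment :: "nat \<Rightarrow> nat \<Rightarrow> real" where
  "moment n k = (\<integral>x. (\<Prod>i<k. x i) * vdm n x \<partial>cube n)"

text \<open>Exchanging \<open>a\<close> and \<open>j\<close> fixes the first \<open>a\<close>
  coordinates and leaves \<open>vdm\<close> unchanged, so any coordinate not yet in the product may
  play the part of the next one.\<close>

lemma moment_marked:
  assumes "a \<le> j" "j < n"
  shows "(\<integral>x. x j * ((\<Prod>i<a. x i) * vdm n x) \<partial>cube n) = moment n (Suc a)"
proof -
  have b: "bdd_meas n (\<lambda>x. x j * ((\<Prod>i<a. x i) * vdm n x))"
    using assms by (intro bdd_meas_mult bdd_meas_coord bdd_meas_prod bdd_meas_vdm) auto
  have "(\<integral>x. x j * ((\<Prod>i<a. x i) * vdm n x) \<partial>cube n) =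
    (\<integral>x. (x \<circ> Transposition.transpose a j) j * ((\<Prod>i<a. (x \<circ> Transposition.transpose a j) i) * vdm n (x \<circ> Transposition.transpose a j)) \<partial>cube n)"
    using assms b by (subst integral_cube_transpose[of a n j, symmetric]) (auto simp: bdd_meas_def)
  also have "\<dots> = (\<integral>x. (\<Prod>i<Suc a. x i) * vdm n x \<partial>cube n)"
  proof (intro Bochner_Integration.integral_cong refl)
    fix x :: "nat \<Rightarrow> real"
    have "(\<Prod>i<a. (x \<circ> Transposition.transpose a j) i) = (\<Prod>i<a. x i)"
      using assms by (intro prod.cong) (auto simp: Transposition.transpose_def)
    then show "(x \<circ> Transposition.transpose a j) j * ((\<Prod>i<a. (x \<circ> Transposition.transpose a j) i) * vdm n (x \<circ> Transposition.transpose a j)) = (\<Prod>i<Suc a. x i) * vdm n x"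
      using assms by (simp add: vdm_transpose)
  qed
  finally show ?thesis by (simp add: moment_def)
qed

text \<open>Aomoto's recursion; the integrand of each interaction term becomes polynomial after
  symmetrising in the two variables involved.\<close>

lemma moment_Suc:
  assumes "a \<le> n"
  shows "moment (Suc n) (Suc a) * (4 + 2 * real n - real a) = moment (Suc n) a * (4 * (2 + real n - real a))"
proof -
  let ?q = "\<lambda>x :: nat \<Rightarrow> real. \<Prod>i<a. x i"
  let ?W = "vdm (Suc n)"
  let ?I = "\<lambda>f. \<integral>x. f x \<partial>cube (Suc n)"
  let ?J = "moment (Suc n) a" and ?J' = "moment (Suc n) (Suc a)"
  have bmq: "bdd_meas (Suc n) ?q" using assms by (intro bdd_meas_prod bdd_meas_coord) auto
  \<comment> \<open>The value of an interaction term depends only on whether its partner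
    \<open>x j\<close> is one of the \<open>a\<close> coordinates in the weight: the exchange of
    \<open>x j\<close> and \<open>x n\<close> alters the weight in the first case and fixes it in
    the second.\<close>
  have tm: "?I (\<lambda>x. ?q x * ((4 * x n - (x n)\<^sup>2) * vdm_partial n j x)) = (if j < a then - ?J' / 2 else 2 * ?J - ?J')"
    (is "integral\<^sup>L _ ?g = _") if j: "j < n" for j
  proof -
    let ?t = "Transposition.transpose j n"
    have bg: "bdd_meas (Suc n) ?g"
      unfolding power2_eq_square using bmq j by (intro bdd_meas_mult bdd_meas_diff bdd_meas_const bdd_meas_coord bdd_meas_vdm_partial) auto
    have sw: "?I ?g = ?I (\<lambda>x. ?g x + ?g (x \<circ> ?t)) / 2"
      using j bg by (intro integral_cube_symmetrize) auto
    have nz: "?W x = 0" if "x n = x j" for x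
      unfolding vdm_Suc using that j by (auto intro!: prod_zero)
    show ?thesis
    proof (cases "j < a")
      case True
      have "?g x + ?g (x \<circ> ?t) = - (x n * (?q x * ?W x))" for x
      proof -
        let ?r = "\<Prod>i\<in>{..<a} - {j}. x i"
        have 1: "?q x = x j * ?r" using True by (subst prod.remove[of _ j]) auto
        have "?q (x \<circ> ?t) = (x \<circ> ?t) j * (\<Prod>i\<in>{..<a} - {j}. (x \<circ> ?t) i)"
          using True by (subst prod.remove[of _ j]) auto
        also have "(\<Prod>i\<in>{..<a} - {j}. (x \<circ> ?t) i) = ?r"
          using assms True by (intro prod.cong) (auto simp: Transposition.transpose_def)
        finally have 2: "?q (x \<circ> ?t) = x n * ?r" by simp
        show ?thesis
        proof (cases "x n = x j")
          case True
          then show ?thesis using j nz[of x] by (simp add: vdm_partial_eq vdm_transpose)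
        next
          case False
          then have nz': "x n - x j \<noteq> 0" "x j - x n \<noteq> 0" by auto
          have "?g x + ?g (x \<circ> ?t) = ?r * ?W x * (x j * (4 * x n - (x n)\<^sup>2) / (x n - x j) + x n * (4 * x j - (x j)\<^sup>2) / (x j - x n))"
            unfolding 2 using 1 j by (simp add: vdm_partial_eq vdm_transpose field_simps)
          \<comment> \<open>The numerator over the common denominator \<open>x n - x j\<close> is
            antisymmetric in the two variables, so the pole cancels.\<close>
          also have "x j * (4 * x n - (x n)\<^sup>2) / (x n - x j) + x n * (4 * x j - (x j)\<^sup>2) / (x j - x n) = - (x n * x j)"
            using nz' by (simp add: divide_simps) (simp add: algebra_simps power2_eq_square)
          finally show ?thesis using 1 by (simp add: comp_def)
        qed
      qed
      then have "?I ?g = ?I (\<lambda>x. - (x n * (?q x * ?W x))) / 2" using sw by simp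
      also have "\<dots> = - ?J' / 2" using moment_marked[of a n "Suc n"] assms by simp
      finally show ?thesis using True by simp
    next
      case False
      have "?g x + ?g (x \<circ> ?t) = 4 * (?q x * ?W x) - x n * (?q x * ?W x) - x j * (?q x * ?W x)" for x
      proof -
        have 2: "?q (x \<circ> ?t) = ?q x"
          using assms False by (intro prod.cong) (auto simp: Transposition.transpose_def)
        show ?thesis
        proof (cases "x n = x j")
          case True
          then show ?thesis using j nz[of x] by (simp add: vdm_partial_eq vdm_transpose)
        next
          case False
          then have nz': "x n - x j \<noteq> 0" "x j - x n \<noteq> 0" by auto
          have "?g x + ?g (x \<circ> ?t) = ?q x * ?W x * ((4 * x n - (x n)\<^sup>2) / (x n - x j) + (4 * x j - (x j)\<^sup>2) / (x j - x n))"
            unfolding 2 using j by (simp add: vdm_partial_eq vdm_transpose field_simps)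
          also have "(4 * x n - (x n)\<^sup>2) / (x n - x j) + (4 * x j - (x j)\<^sup>2) / (x j - x n) = 4 - x n - x j"
            using nz' by (simp add: divide_simps) (simp add: algebra_simps power2_eq_square)
          finally show ?thesis by (simp add: algebra_simps comp_def)
        qed
      qed
      then have "?I ?g = ?I (\<lambda>x. 4 * (?q x * ?W x) - x n * (?q x * ?W x) - x j * (?q x * ?W x)) / 2" using sw by simp
      also have "\<dots> = (4 * ?J - ?J' - ?J') / 2"
      proof -
        have "integrable (cube (Suc n)) (\<lambda>x. ?q x * ?W x)"
          "integrable (cube (Suc n)) (\<lambda>x. x n * (?q x * ?W x))"
          "integrable (cube (Suc n)) (\<lambda>x. x j * (?q x * ?W x))"
          using bmq j by (auto intro!: bdd_meas_integrable bdd_meas_mult bdd_meas_vdm bdd_meas_coord)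
        then show ?thesis
          using moment_marked[of a n "Suc n"] moment_marked[of a j "Suc n"] assms j False
          by (simp add: moment_def)
      qed
      finally show ?thesis using False by simp
    qed
  qed
  have q: "?q (x(n := u)) = ?q x" for x u using assms by (intro prod.cong) auto
  \<comment> \<open>The factor \<open>4 * u - u\<^sup>2\<close> vanishes at both ends of the
    interval, so integration by parts leaves no boundary term.\<close>
  have "0 = ?I (\<lambda>x. ?q x * ((4 + 2 * (-1) * x n) * ?W x + (0 + 4 * x n + (-1) * (x n)\<^sup>2) * (\<Sum>j<n. vdm_partial n j x)))"
    using integration_by_parts_vdm[of n ?q 4 "-1" 0, OF bmq q] by simp
  also have "\<dots> = ?I (\<lambda>x. 4 * (?q x * ?W x) - 2 * (x n * (?q x * ?W x)) + (\<Sum>j<n. ?q x * ((4 * x n - (x n)\<^sup>2) * vdm_partial n j x)))"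
    by (intro Bochner_Integration.integral_cong refl) (simp add: sum_distrib_left sum_subtractf algebra_simps)
  also have "\<dots> = 4 * ?J - 2 * ?J' + (\<Sum>j<n. ?I (\<lambda>x. ?q x * ((4 * x n - (x n)\<^sup>2) * vdm_partial n j x)))"
  proof -
    have "integrable (cube (Suc n)) (\<lambda>x. ?q x * ((4 * x n - (x n)\<^sup>2) * vdm_partial n j x))" if "j < n" for j
      unfolding power2_eq_square using bmq that
      by (intro bdd_meas_integrable bdd_meas_mult bdd_meas_diff bdd_meas_const bdd_meas_coord bdd_meas_vdm_partial) auto
    moreover have "integrable (cube (Suc n)) (\<lambda>x. ?q x * ?W x)"
          "integrable (cube (Suc n)) (\<lambda>x. x n * (?q x * ?W x))"
          using bmq by (auto intro!: bdd_meas_integrable bdd_meas_mult bdd_meas_vdm bdd_meas_coord)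
    ultimately show ?thesis
      using moment_marked[of a n "Suc n"] assms
      by (subst Bochner_Integration.integral_add) (auto simp: moment_def Bochner_Integration.integral_sum)
  qed
  also have "(\<Sum>j<n. ?I (\<lambda>x. ?q x * ((4 * x n - (x n)\<^sup>2) * vdm_partial n j x))) = (\<Sum>j<n. if j < a then - ?J' / 2 else 2 * ?J - ?J')"
    using tm by (intro sum.cong) auto
  also have "\<dots> = (\<Sum>j\<in>{..<a}. - ?J' / 2) + (\<Sum>j\<in>{a..<n}. 2 * ?J - ?J')"
  proof -
    have "{..<n} \<inter> {j. j < a} = {..<a}" "{..<n} \<inter> - {j. j < a} = {a..<n}" using assms by auto
    then show ?thesis by (simp add: sum.If_cases)
  qed
  also have "\<dots> = real a * (- ?J' / 2) + (real n - real a) * (2 * ?J - ?J')"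
    using assms by (simp add: of_nat_diff)
  finally show ?thesis by (simp add: algebra_simps)
qed

text \<open>With n = m + 1, each step of the recursion multiplies by 4 (m + 2 - k) / (2m + 4 - k);
  over k = 0, ..., m these factors telescope to quotients of factorials. The induction is stated
  without division.\<close>

lemma moment_prod:
  "moment n n = moment n 0 * (4 ^ n * (fact (n + 1) * fact (n + 2) / fact (2 * n + 2)))"
proof (cases n)
  case (Suc m)
  have "moment n k * fact (2 * m + 4) * fact (m + 2 - k) = moment n 0 * (4 ^ k * (fact (m + 2) * fact (2 * m + 4 - k)))"
    if "k \<le> n" for k
    using that
  proof (induction k)
    case (Suc k)
    then have k: "k \<le> m" using \<open>n = Suc m\<close> by simp
    have f1: "fact (m + 2 - k) = (2 + real m - real k) * fact (m + 2 - Suc k)"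
      using k by (subst fact_reduce) (auto simp: of_nat_diff)
    have f2: "fact (2 * m + 4 - k) = (4 + 2 * real m - real k) * fact (2 * m + 4 - Suc k)"
      using k by (subst fact_reduce) (auto simp: of_nat_diff)
    have nz: "4 + 2 * real m - real k \<noteq> 0" "2 + real m - real k \<noteq> 0" using k by auto
    have "(moment n (Suc k) * fact (2 * m + 4) * fact (m + 2 - Suc k)) * ((4 + 2 * real m - real k) * (2 + real m - real k))
      = (moment n k * fact (2 * m + 4) * fact (m + 2 - k)) * (4 * (2 + real m - real k))"
      using moment_Suc[OF k] unfolding f1 \<open>n = Suc m\<close> by (simp add: mult_ac)
    also have "moment n k * fact (2 * m + 4) * fact (m + 2 - k) = moment n 0 * (4 ^ k * (fact (m + 2) * fact (2 * m + 4 - k)))"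
      using Suc by simp
    finally have "(moment n (Suc k) * fact (2 * m + 4) * fact (m + 2 - Suc k)) * ((4 + 2 * real m - real k) * (2 + real m - real k))
      = (moment n 0 * (4 ^ Suc k * (fact (m + 2) * fact (2 * m + 4 - Suc k)))) * ((4 + 2 * real m - real k) * (2 + real m - real k))"
      unfolding f2 by (simp only: power_Suc mult_ac)
    then show ?case using nz by (simp only: mult_cancel_right mult_eq_0_iff) simp
  qed simp
  from this[of n] have "moment n n * fact (2 * m + 4) * fact (m + 2 - n) =
      moment n 0 * (4 ^ n * (fact (m + 2) * fact (2 * m + 4 - n)))" by simp
  moreover have e: "m + 2 - n = 1" "2 * m + 4 - n = n + 2" "m + 2 = n + 1" "2 * m + 4 = 2 * n + 2"
    using Suc by auto
  ultimately have "moment n n * fact (2 * n + 2) = moment n 0 * (4 ^ n * (fact (n + 1) * fact (n + 2)))"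
    by (simp only: e fact_1 mult_1_right)
  moreover have "fact (2 * n + 2) \<noteq> (0 :: real)" by (rule fact_nonzero)
  ultimately show ?thesis by (metis nonzero_eq_divide_eq times_divide_eq_right)
qed (simp add: moment_def)

text \<open>Integration by parts with the factor \<open>x n - 4\<close> leaves only the boundary
  term at 0, where \<open>vdm (Suc n)\<close> becomes \<open>vdm n\<close> times the product of all
  coordinates. Each interaction term symmetrises to half the full integral, because (x n - 4) - (x j
  - 4) equals x n - x j.\<close>

lemma moment_zero_Suc: "moment (Suc n) 0 * (real n + 2) = 2 * moment n n"
proof -
  let ?W = "vdm (Suc n)"
  let ?I = "\<lambda>f. \<integral>x. f x \<partial>cube (Suc n)"
  have tm: "?I (\<lambda>x. (x n - 4) * vdm_partial n j x) = moment (Suc n) 0 / 2" (is "integral\<^sup>L _ ?g = _") if j: "j < n" for j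
  proof -
    let ?t = "Transposition.transpose j n"
    have bg: "bdd_meas (Suc n) ?g"
      using j by (intro bdd_meas_mult bdd_meas_diff bdd_meas_const bdd_meas_coord bdd_meas_vdm_partial) auto
    have "?g x + ?g (x \<circ> ?t) = ?W x" for x
    proof (cases "x n = x j")
      case True
      moreover have "?W x = 0"
        unfolding vdm_Suc using True j by (auto intro!: prod_zero)
      ultimately show ?thesis using j by (simp add: vdm_partial_eq vdm_transpose)
    next
      case False
      then have nz': "x n - x j \<noteq> 0" "x j - x n \<noteq> 0" by auto
      have "?g x + ?g (x \<circ> ?t) = ?W x * ((x n - 4) / (x n - x j) + (x j - 4) / (x j - x n))"
        using j by (simp add: vdm_partial_eq vdm_transpose field_simps)
      also have "(x n - 4) / (x n - x j) + (x j - 4) / (x j - x n) = 1"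
        using nz' by (simp add: divide_simps) (simp add: algebra_simps)
      finally show ?thesis by (simp add: comp_def)
    qed
    moreover have "?I ?g = ?I (\<lambda>x. ?g x + ?g (x \<circ> ?t)) / 2"
      using j bg by (intro integral_cube_symmetrize) auto
    ultimately show ?thesis by (simp add: moment_def)
  qed
  have "moment n n = (\<integral>x. vdm n x * (\<Prod>j<n. \<bar>x j\<bar>) \<partial>cube n)"
    unfolding moment_def
  proof (rule integral_cong_AE)
    show "AE x in cube n. (\<Prod>i<n. x i) * vdm n x = vdm n x * (\<Prod>j<n. \<bar>x j\<bar>)"
      using AE_cube[of n] by eventually_elim (auto intro!: prod.cong)
  qed (use bdd_meas_vdm[of n n] in \<open>auto simp: bdd_meas_def\<close>)
  also have "\<dots> = ?I (\<lambda>x. 1 * ((1 + 2 * 0 * x n) * ?W x + ((-4) + 1 * x n + 0 * (x n)\<^sup>2) * (\<Sum>j<n. vdm_partial n j x)))"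
    by (subst integration_by_parts_vdm[of n "\<lambda>_. 1" 1 0 "-4"]) auto
  also have "\<dots> = ?I (\<lambda>x. ?W x + (\<Sum>j<n. (x n - 4) * vdm_partial n j x))"
    by (intro Bochner_Integration.integral_cong refl) (simp add: sum_distrib_left algebra_simps)
  also have "\<dots> = moment (Suc n) 0 + (\<Sum>j<n. ?I (\<lambda>x. (x n - 4) * vdm_partial n j x))"
  proof -
    have "integrable (cube (Suc n)) (\<lambda>x. (x n - 4) * vdm_partial n j x)" if "j < n" for j
      using that by (intro bdd_meas_integrable bdd_meas_mult bdd_meas_diff bdd_meas_const bdd_meas_coord bdd_meas_vdm_partial) auto
    moreover have "integrable (cube (Suc n)) ?W" by (auto intro!: bdd_meas_integrable)
    ultimately show ?thesis
      by (subst Bochner_Integration.integral_add) (auto simp: moment_def Bochner_Integration.integral_sum)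
  qed
  also have "(\<Sum>j<n. ?I (\<lambda>x. (x n - 4) * vdm_partial n j x)) = (\<Sum>j<n. moment (Suc n) 0 / 2)"
    using tm by (intro sum.cong) auto
  finally show ?thesis by (simp add: field_simps)
qed

text \<open>The factor \<open>4 ^ m\<close> undoes the normalisation of the cube and
  \<open>1 / fact m\<close> passes from ordered to unordered roots, so the left side is the volume
  later found for \<open>simple_rooted_set m\<close>. The induction step goes from
  \<open>moment n 0\<close> to \<open>moment n n\<close> and on to
  \<open>moment (Suc n) 0\<close>.\<close>

lemma selberg:
  "4 ^ m / fact m * moment m 0 = 2 ^ (m * (m + 1)) * (\<Prod>k<m. (fact k)\<^sup>2 / fact (2 * k + 1))"
proof (induction m)
  case 0
  interpret prob_space "cube 0" by (rule prob_space_cube)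
  show ?case by (simp add: moment_def vdm_def prob_space)
next
  case (Suc n)
  have 1: "moment (Suc n) 0 = 2 / (real n + 2) * moment n n"
    using moment_zero_Suc[of n] by (simp add: field_simps)
  have f: "fact (n + 2) = (real n + 2) * ((real n + 1) * fact n)" "fact (n + 1) = (real n + 1) * fact n"
    "fact (Suc n) = (real n + 1) * fact n"
    "fact (2 * n + 2) = (2 * real n + 2) * fact (2 * n + 1)"
    by (auto simp: fact_reduce algebra_simps)
  have "4 ^ Suc n / fact (Suc n) * moment (Suc n) 0 =
     (4 ^ n / fact n * moment n 0) * (4 ^ Suc n * ((fact n)\<^sup>2 / fact (2 * n + 1)))"
    unfolding 1 moment_prod f by (simp add: divide_simps) (simp add: power2_eq_square algebra_simps)
  also have "\<dots> = (2 ^ (n * (n + 1)) * 4 ^ Suc n) * (\<Prod>k<Suc n. (fact k)\<^sup>2 / fact (2 * k + 1))"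
    unfolding Suc by simp
  also have "(2::real) ^ (n * (n + 1)) * 4 ^ Suc n = 2 ^ (n * (n + 1) + 2 * Suc n)"
    by (simp only: power_add power_mult) simp
  also have "n * (n + 1) + 2 * Suc n = Suc n * (Suc n + 1)" by simp
  finally show ?case .
qed

section \<open>Polynomials with simple real roots\<close>

definition rpoly :: "real set \<Rightarrow> real poly" where
  "rpoly R = (\<Prod>r\<in>R. [:- r, 1:])"

text \<open>Coefficients are listed from the second highest down to the constant term, so that appending
  a coordinate appends a constant term.\<close>

primrec monic :: "nat \<Rightarrow> (nat \<Rightarrow> 'a::comm_ring_1) \<Rightarrow> 'a poly" where
  "monic 0 c = 1"
| "monic (Suc n) c = pCons (c n) (monic n c)"

lemma monic_cong: "(\<And>i. i < n \<Longrightarrow> c i = d i) \<Longrightarrow> monic n c = monic n d"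
  by (induction n) auto

lemma degree_monic [simp]: "degree (monic n c :: 'a::comm_ring_1 poly) = n"
proof (induction n)
  case (Suc n)
  have "monic n c \<noteq> 0"
    using Suc by (cases n) auto
  then show ?case using Suc by simp
qed simp

lemma lead_coeff_monic [simp]: "coeff (monic n c) n = (1 :: 'a::comm_ring_1)"
  by (induction n) auto

lemma coeff_monic: "i < n \<Longrightarrow> coeff (monic n c) (n - Suc i) = c i"
proof (induction n)
  case (Suc n)
  show ?case
  proof (cases "i = n")
    case False
    then have "Suc n - Suc i = Suc (n - Suc i)" using Suc.prems by auto
    then show ?thesis using Suc False by simp
  qed simp
qed simp

lemma monic_surj:
  fixes p :: "'a::comm_ring_1 poly"
  assumes "degree p = n" "lead_coeff p = 1"
  shows "monic n (\<lambda>i. coeff p (n - Suc i)) = p"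
proof (rule poly_eqI)
  fix i
  consider "i < n" | "i = n" | "i > n" by linarith
  then show "coeff (monic n (\<lambda>i. coeff p (n - Suc i))) i = coeff p i"
  proof cases
    case 1
    then show ?thesis using coeff_monic[of "n - Suc i" n "\<lambda>i. coeff p (n - Suc i)"] by (simp add: Suc_diff_Suc)
  qed (use assms in \<open>auto simp: coeff_eq_0\<close>)
qed

lemma poly_rpoly: "poly (rpoly R) x = (\<Prod>r\<in>R. x - r)"
  by (simp add: rpoly_def poly_prod)

lemma degree_rpoly [simp]: "degree (rpoly R) = card R"
  unfolding rpoly_def by (subst degree_prod_sum_eq) auto

lemma lead_coeff_rpoly [simp]: "lead_coeff (rpoly R) = 1"
  unfolding rpoly_def by (subst lead_coeff_prod) auto

lemma coeff_rpoly_card [simp]: "coeff (rpoly R) (card R) = 1"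
  using lead_coeff_rpoly[of R] by simp

lemma rpoly_insert: "finite R \<Longrightarrow> r \<notin> R \<Longrightarrow> rpoly (insert r R) = [:- r, 1:] * rpoly R"
  by (simp add: rpoly_def)

lemma rpoly_roots: "finite R \<Longrightarrow> poly (rpoly R) x = 0 \<longleftrightarrow> x \<in> R"
  by (auto simp: poly_rpoly)

lemma rpoly_eqI:
  fixes p :: "real poly"
  assumes "degree p = n" "lead_coeff p = 1" "card R = n" "\<And>r. r \<in> R \<Longrightarrow> poly p r = 0" "finite R"
  shows "p = rpoly R"
  by (rule poly_eqI_degree_lead_coeff[of _ n _ R]) (use assms rpoly_roots[of R] coeff_rpoly_card[of R] in auto)

text \<open>A certificate for \<open>k\<close> distinct roots between \<open>a\<close> and
  \<open>b\<close>. For fixed points \<open>q\<close> it consists of finitely many strict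
  inequalities between values of \<open>p\<close>, hence is stable under small changes of the
  coefficients. The outermost points may be the endpoints, as the roots found lie strictly between
  the points.\<close>

definition sign_changes :: "nat \<Rightarrow> real \<Rightarrow> real \<Rightarrow> real poly \<Rightarrow> (nat \<Rightarrow> real) \<Rightarrow> bool" where
  "sign_changes k a b p q \<longleftrightarrow> a \<le> q 0 \<and> q k \<le> b \<and>
     (\<forall>i<k. q i < q (Suc i) \<and> poly p (q i) * poly p (q (Suc i)) < 0)"

lemma sign_changes_less: "sign_changes k a b p q \<Longrightarrow> i < j \<Longrightarrow> j \<le> k \<Longrightarrow> q i < q j"
proof (induction j)
  case (Suc j)
  then have "q j < q (Suc j)" by (auto simp: sign_changes_def)
  then show ?case using Suc by (cases "i = j") auto
qed simp

lemma sign_changes_le: "sign_changes k a b p q \<Longrightarrow> i \<le> j \<Longrightarrow> j \<le> k \<Longrightarrow> q i \<le> q j"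
  using sign_changes_less[of k a b p q i j] by (cases "i = j") auto

lemma sign_changes_roots:
  assumes "sign_changes k a b p q"
  obtains f where "\<And>i. i < k \<Longrightarrow> q i < f i \<and> f i < q (Suc i) \<and> poly p (f i) = 0"
    "strict_mono_on {..<k} f" "f ` {..<k} \<subseteq> {a<..<b}"
proof -
  have "\<exists>x>q i. x < q (Suc i) \<and> poly p x = 0" if "i < k" for i
    using assms that by (intro poly_IVT) (auto simp: sign_changes_def)
  then obtain f where f: "\<And>i. i < k \<Longrightarrow> q i < f i \<and> f i < q (Suc i) \<and> poly p (f i) = 0"
    by metis
  show ?thesis
  proof (rule that[OF f])
    show "strict_mono_on {..<k} f"
    proof (rule strict_mono_onI)
      fix i j assume "i \<in> {..<k}" "j \<in> {..<k}" "i < j"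
      then have "f i < q (Suc i)" "q (Suc i) \<le> q j" "q j < f j"
        using f[of i] f[of j] sign_changes_le[OF assms, of "Suc i" j] by auto
      then show "f i < f j" by linarith
    qed
    show "f ` {..<k} \<subseteq> {a<..<b}"
    proof safe
      fix i assume "i < k"
      then have "a \<le> q 0" "q 0 \<le> q i" "q i < f i" "f i < q (Suc i)" "q (Suc i) \<le> q k" "q k \<le> b"
        using assms f[of i] sign_changes_le[OF assms, of 0 i] sign_changes_le[OF assms, of "Suc i" k] by (auto simp: sign_changes_def)
      then show "f i \<in> {a<..<b}" by auto
    qed
  qed
qed

text \<open>Rational points are placed in the gaps between consecutive roots. The factor
  \<open>s\<close>, of constant sign on the interval, stands for the roots outside it. The second
  conclusion ties the position of a root among the points to its rank, which
  \<open>area_formula\<close> uses to sort roots.\<close>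

lemma sign_changes_exists:
  fixes s :: "real poly"
  assumes R: "finite R" "R \<subseteq> {a<..<b}" and "a < b" and s: "\<And>y z. y \<in> {a..b} \<Longrightarrow> z \<in> {a..b} \<Longrightarrow> poly s y * poly s z > 0"
  obtains q :: "nat \<Rightarrow> rat" where "sign_changes (card R) a b (rpoly R * s) (\<lambda>i. of_rat (q i))"
    "\<And>r. r \<in> R \<Longrightarrow> of_rat (q (card {r'\<in>R. r' < r})) < r \<and> r < of_rat (q (Suc (card {r'\<in>R. r' < r})))"
proof -
  define k where "k = card R"
  define rs where "rs = sorted_list_of_set R"
  have rs: "sorted rs" "distinct rs" "set rs = R" "length rs = k"
    using R by (auto simp: rs_def k_def)
  have inc: "rs ! i < rs ! j" if "i < j" "j < k" for i j
    using rs that by (metis sorted_wrt_iff_nth_less strict_sorted_iff)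
  have inR: "rs ! i \<in> R" if "i < k" for i using rs that by auto
  have inab: "a < x \<and> x < b" if "x \<in> R" for x using R that by auto
  \<comment> \<open>\<open>l i\<close> and \<open>u i\<close> are the ends of the gap for the point
    with index \<open>i\<close>: consecutive roots, except that the first gap starts at
    \<open>a\<close> and the last one ends at \<open>b\<close>.\<close>
  define l where "l i = (if i = 0 then a else rs ! (i - 1))" for i
  define u where "u i = (if i = k then b else rs ! i)" for i
  have lu: "l i < u i" if "i \<le> k" for i
  proof -
    show ?thesis using inab that inR[of "i - 1"] inR[of i] inc[of "i - 1" i] \<open>a < b\<close>
      by (auto simp: l_def u_def)
  qed
  have "\<forall>i. \<exists>q :: rat. i \<le> k \<longrightarrow> l i < of_rat q \<and> of_rat q < u i"
    using of_rat_dense[OF lu] by blast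
  then obtain q :: "nat \<Rightarrow> rat" where q: "\<And>i. i \<le> k \<Longrightarrow> l i < of_rat (q i) \<and> of_rat (q i) < u i"
    using choice[of "\<lambda>i q. i \<le> k \<longrightarrow> l i < of_rat q \<and> of_rat q < u i"] by blast
  have qr: "of_rat (q i) < rs ! i \<and> rs ! i < of_rat (q (Suc i))" if "i < k" for i
    using q[of i] q[of "Suc i"] that by (auto simp: l_def u_def)
  have qab: "of_rat (q i) \<in> {a..b}" if "i \<le> k" for i
  proof -
    have "a \<le> l i"
      using that inab[OF inR[of "i - 1"]] by (cases i) (auto simp: l_def)
    moreover have "u i \<le> b"
      using that inab[OF inR[of i]] by (auto simp: u_def)
    ultimately show ?thesis using q[OF that] by auto
  qed
  have neg: "poly (rpoly R * s) (of_rat (q i)) * poly (rpoly R * s) (of_rat (q (Suc i))) < 0" (is "?A < 0") if "i < k" for i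
  proof -
    let ?x = "of_rat (q i) :: real" and ?y = "of_rat (q (Suc i)) :: real"
    have "?A = (poly s ?x * poly s ?y) * ((\<Prod>r\<in>R. (?x - r) * (?y - r)))"
      by (simp add: poly_rpoly prod.distrib)
    also have "(\<Prod>r\<in>R. (?x - r) * (?y - r)) = ((?x - rs ! i) * (?y - rs ! i)) * (\<Prod>r\<in>R - {rs ! i}. (?x - r) * (?y - r))"
      using R inR[OF that] by (subst prod.remove[of _ "rs ! i"]) auto
    finally have A: "?A = (poly s ?x * poly s ?y) * (((?x - rs ! i) * (?y - rs ! i)) * (\<Prod>r\<in>R - {rs ! i}. (?x - r) * (?y - r)))" .
    \<comment> \<open>Only the root \<open>rs ! i\<close> separates the two points; every other root
      has both of them on the same side.\<close>
    have "(\<Prod>r\<in>R - {rs ! i}. (?x - r) * (?y - r)) > 0"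
    proof (rule prod_pos)
      fix r assume "r \<in> R - {rs ! i}"
      then obtain j where j: "j < k" "r = rs ! j" "j \<noteq> i" using rs by (metis DiffE in_set_conv_nth singletonI)
      show "0 < (?x - r) * (?y - r)"
      proof (cases "j < i")
        case True
        then have "j \<le> i - 1" "i - 1 < k" using that by linarith+
        then have "r \<le> rs ! (i - 1)" using inc[of j "i - 1"] j by (cases "j = i - 1") auto
        moreover have "rs ! (i - 1) < ?x" using q[of i] that True by (auto simp: l_def)
        ultimately show ?thesis using qr[OF that] by (intro mult_pos_pos) auto
      next
        case False
        then have "Suc i \<le> j" using j by linarith
        then have "rs ! Suc i \<le> r" using inc[of "Suc i" j] j by (cases "j = Suc i") auto
        moreover have "?y < rs ! Suc i" using q[of "Suc i"] that False j by (auto simp: u_def)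
        ultimately show ?thesis using qr[OF that] by (intro mult_neg_neg) auto
      qed
    qed
    moreover have "(?x - rs ! i) * (?y - rs ! i) < 0"
      using qr[OF that] by (intro mult_neg_pos) auto
    moreover have "poly s ?x * poly s ?y > 0" using that by (intro s qab) auto
    ultimately show ?thesis unfolding A by (simp add: mult_less_0_iff zero_less_mult_iff)
  qed
  have card: "card {r'\<in>R. r' < rs ! i} = i" if "i < k" for i
  proof -
    have "{r'\<in>R. r' < rs ! i} = (!) rs ` {..<i}"
    proof safe
      fix r assume "r \<in> R" "r < rs ! i"
      then obtain j where j: "j < k" "r = rs ! j" using rs by (metis in_set_conv_nth)
      then have "j < i" using \<open>r < rs ! i\<close> inc[of i j] by (metis less_irrefl less_linear less_trans)
      then show "r \<in> (!) rs ` {..<i}" using j by auto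
    qed (use that inc inR in auto)
    moreover have "inj_on ((!) rs) {..<i}"
      using rs that by (auto simp: inj_on_def nth_eq_iff_index_eq)
    ultimately show ?thesis by (simp add: card_image)
  qed
  show ?thesis
  proof (rule that[of q])
    show "sign_changes (card R) a b (rpoly R * s) (\<lambda>i. of_rat (q i))"
      using qab[of 0] qab[of k] neg qr unfolding k_def[symmetric] sign_changes_def
      by (auto intro: less_trans)
    fix r assume "r \<in> R"
    then obtain i where "i < k" "r = rs ! i" using rs by (metis in_set_conv_nth)
    then show "of_rat (q (card {r'\<in>R. r' < r})) < r \<and> r < of_rat (q (Suc (card {r'\<in>R. r' < r})))"
      using card qr by auto
  qed
qed

definition simple_rooted :: "nat \<Rightarrow> real \<Rightarrow> real \<Rightarrow> real poly \<Rightarrow> bool" where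
  "simple_rooted n a b p \<longleftrightarrow> (\<exists>R. finite R \<and> card R = n \<and> R \<subseteq> {a<..<b} \<and> p = rpoly R)"

text \<open>In degree \<open>n\<close>, the \<open>n\<close> sign changes already account for all
  roots, which leaves no room for multiple roots or for roots elsewhere.\<close>

lemma sign_changes_imp_simple_rooted:
  assumes "sign_changes n a b p q" "degree p = n" "lead_coeff p = 1"
  shows "simple_rooted n a b p"
proof -
  obtain f where f: "\<And>i. i < n \<Longrightarrow> q i < f i \<and> f i < q (Suc i) \<and> poly p (f i) = 0"
    "strict_mono_on {..<n} f" "f ` {..<n} \<subseteq> {a<..<b}"
    using sign_changes_roots[OF assms(1)] by blast
  have "card (f ` {..<n}) = n"
    using f(2) by (simp add: card_image strict_mono_on_imp_inj_on)
  then have "p = rpoly (f ` {..<n})"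
    using assms f by (intro rpoly_eqI) auto
  then show ?thesis
    unfolding simple_rooted_def using f \<open>card _ = n\<close> by blast
qed

lemma simple_rooted_iff_sign_changes:
  assumes "degree p = n" "lead_coeff p = 1" "a < b"
  shows "simple_rooted n a b p \<longleftrightarrow> (\<exists>q :: nat \<Rightarrow> rat. sign_changes n a b p (\<lambda>i. of_rat (q i)))"
proof
  assume "simple_rooted n a b p"
  then obtain R where R: "finite R" "card R = n" "R \<subseteq> {a<..<b}" "p = rpoly R"
    unfolding simple_rooted_def by blast
  from sign_changes_exists[OF R(1,3) assms(3), of 1] R
  show "\<exists>q :: nat \<Rightarrow> rat. sign_changes n a b p (\<lambda>i. of_rat (q i))" by (metis mult.right_neutral poly_1 zero_less_one)
qed (use sign_changes_imp_simple_rooted assms in blast)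

text \<open>As many sign changes as the degree put exactly one root into each interval, so the index
  of the interval is the rank of the root. In particular it does not depend on the choice of
  \<open>q\<close>.\<close>

lemma sign_changes_rank:
  assumes "sign_changes n a b p q" "degree p = n" "lead_coeff p = 1"
    "poly p x = 0" "i < n" "q i < x" "x < q (Suc i)"
  shows "card {r. poly p r = 0 \<and> r < x} = i"
proof -
  obtain f where f: "\<And>i. i < n \<Longrightarrow> q i < f i \<and> f i < q (Suc i) \<and> poly p (f i) = 0"
    "strict_mono_on {..<n} f" "f ` {..<n} \<subseteq> {a<..<b}"
    using sign_changes_roots[OF assms(1)] by blast
  have inj: "inj_on f {..<n}" using f(2) by (rule strict_mono_on_imp_inj_on)
  have p: "p = rpoly (f ` {..<n})"
    using assms f by (intro rpoly_eqI) (auto simp: card_image[OF inj])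
  then have rt: "poly p r = 0 \<longleftrightarrow> r \<in> f ` {..<n}" for r by (simp add: rpoly_roots)
  then obtain j where j: "j < n" "x = f j" using assms(4) by auto
  have "j = i"
  proof (rule ccontr)
    assume "j \<noteq> i"
    then consider "Suc j \<le> i" | "Suc i \<le> j" by linarith
    then show False
    proof cases
      case 1
      then have "q (Suc j) \<le> q i" using sign_changes_le[OF assms(1)] assms(5) by auto
      then show False using f(1)[OF j(1)] j assms by auto
    next
      case 2
      then have "q (Suc i) \<le> q j" using sign_changes_le[OF assms(1)] j by auto
      then show False using f(1)[OF j(1)] j assms by auto
    qed
  qed
  have "{r. poly p r = 0 \<and> r < x} = f ` {..<i}"
  proof safe
    fix r assume "poly p r = 0" "r < x"
    then obtain l where "l < n" "r = f l" using rt by auto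
    with \<open>r < x\<close> have "l < i"
      using strict_mono_onD[OF f(2), of i l] j \<open>j = i\<close> by (cases l i rule: linorder_cases) auto
    then show "r \<in> f ` {..<i}" using \<open>r = f l\<close> by auto
  qed (use f strict_mono_onD[OF f(2)] j \<open>j = i\<close> in auto)
  then show ?thesis using card_image[of f "{..<i}"] inj assms(5) by (auto simp: inj_on_def)
qed

section \<open>Changing variables from coefficients to roots\<close>

definition coeff_measure :: "nat \<Rightarrow> (nat \<Rightarrow> real) measure" where
  "coeff_measure n = PiM {..<n} (\<lambda>_. lborel)"

interpretation lb: product_sigma_finite "\<lambda>_ :: nat. lborel :: real measure"
  by standard

lemma measurable_coeff_coord [measurable]: "i < n \<Longrightarrow> (\<lambda>x. x i) \<in> borel_measurable (coeff_measure n)"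
  unfolding coeff_measure_def by (intro measurable_component_singleton[THEN measurable_compose]) auto

lemma measurable_poly_monic:
  assumes "\<And>i. i < n \<Longrightarrow> (\<lambda>z. f z i) \<in> borel_measurable M" "g \<in> borel_measurable M"
  shows "(\<lambda>z. poly (monic n (f z)) (g z) :: real) \<in> borel_measurable M"
  using assms by (induction n) auto

lemma measurable_poly_pderiv_monic:
  assumes "\<And>i. i < n \<Longrightarrow> (\<lambda>z. f z i) \<in> borel_measurable M" "g \<in> borel_measurable M"
  shows "(\<lambda>z. poly (pderiv (monic n (f z))) (g z) :: real) \<in> borel_measurable M"
  using assms
proof (induction n)
  case (Suc n)
  have "(\<lambda>z. poly (monic n (f z)) (g z)) \<in> borel_measurable M"
    using Suc.prems by (intro measurable_poly_monic) auto
  then show ?case using Suc by (auto simp: pderiv_pCons)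
qed (simp add: pderiv_1)

text \<open>Only the first \<open>n + 1\<close> points matter. Sequences of rationals are
  uncountable, lists are countable, and a measurable existential needs a countable range.\<close>

lemma sign_changes_list:
  "(\<exists>q :: nat \<Rightarrow> rat. sign_changes n a b p (\<lambda>i. of_rat (q i))) \<longleftrightarrow> (\<exists>l :: rat list. sign_changes n a b p (\<lambda>i. of_rat (l ! i)))"
proof
  assume "\<exists>q :: nat \<Rightarrow> rat. sign_changes n a b p (\<lambda>i. of_rat (q i))"
  then obtain q :: "nat \<Rightarrow> rat" where "sign_changes n a b p (\<lambda>i. of_rat (q i))" by blast
  moreover have "map q [0..<Suc n] ! i = q i" if "i \<le> n" for i
    using that by (simp add: nth_map del: upt_Suc)
  ultimately have "sign_changes n a b p (\<lambda>i. of_rat (map q [0..<Suc n] ! i))"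
    by (auto simp: sign_changes_def simp del: upt_Suc)
  then show "\<exists>l :: rat list. sign_changes n a b p (\<lambda>i. of_rat (l ! i))" by blast
qed blast

lemma measurable_sign_changes:
  assumes f [measurable]: "\<And>y. (\<lambda>z. poly (f z) y) \<in> borel_measurable M"
  shows "Measurable.pred M (\<lambda>z. \<exists>q :: nat \<Rightarrow> rat. sign_changes k a b (f z) (\<lambda>i. of_rat (q i)))"
  unfolding sign_changes_list unfolding sign_changes_def by measurable

lemma open_sign_changes:
  assumes "\<And>y. continuous_on UNIV (\<lambda>t :: real. poly (p t) y)"
  shows "open {t. sign_changes k a b (p t) q}"
proof (cases "a \<le> q 0 \<and> q k \<le> b \<and> (\<forall>i<k. q i < q (Suc i))")
  case True
  then have "{t. sign_changes k a b (p t) q} = (\<Inter>i\<in>{..<k}. {t. poly (p t) (q i) * poly (p t) (q (Suc i)) < 0})"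
    by (auto simp: sign_changes_def)
  also have "open \<dots>"
    by (intro open_INT ballI open_Collect_less continuous_intros assms) auto
  finally show ?thesis .
next
  case False
  then have "{t. sign_changes k a b (p t) q} = {}" by (auto simp: sign_changes_def)
  then show ?thesis by simp
qed

text \<open>The theorem for absolutely integrable functions in the form wanted for nonnegative
  integrals; continuity of \<open>F\<close> and boundedness of the image supply the
  integrability.\<close>

lemma nn_integral_injective_substitution:
  fixes \<psi> \<psi>' F :: "real \<Rightarrow> real"
  assumes "open B" and A: "open (\<psi> ` B)" "bounded (\<psi> ` B)" and "inj_on \<psi> B"
    and der: "\<And>x. x \<in> B \<Longrightarrow> (\<psi> has_real_derivative \<psi>' x) (at x)"
    and F: "continuous_on UNIV F" "\<And>t. F t \<ge> 0"
  shows "(\<integral>\<^sup>+t. indicator (\<psi> ` B) t * ennreal (F t) \<partial>lborel) =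
         (\<integral>\<^sup>+x. indicator B x * ennreal (\<bar>\<psi>' x\<bar> * F (\<psi> x)) \<partial>lborel)"
proof -
  obtain c where c: "\<psi> ` B \<subseteq> {-c..c}"
    using A(2) unfolding bounded_iff by (force simp: abs_le_iff)
  have "F absolutely_integrable_on {-c..c}"
    using F by (intro absolutely_integrable_continuous_real continuous_on_subset[OF F(1)]) auto
  then have FA: "F absolutely_integrable_on (\<psi> ` B)"
    by (rule set_integrable_subset) (use A c in \<open>auto simp: borel_open\<close>)
  define I where "I = integral (\<psi> ` B) F"
  have B: "(\<lambda>x. \<bar>\<psi>' x\<bar> * F (\<psi> x)) absolutely_integrable_on B"
    "integral B (\<lambda>x. \<bar>\<psi>' x\<bar> * F (\<psi> x)) = I"
    using has_absolute_integral_change_of_variables_1'[of B \<psi> \<psi>' F I] assms FA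
    by (auto simp: I_def borel_open intro: has_field_derivative_at_within)
  have "(F has_integral I) (\<psi> ` B)"
    using FA unfolding I_def by (simp add: absolutely_integrable_on_def integrable_integral)
  from nn_integral_has_integral_lebesgue[OF F(2) this]
  have "(\<integral>\<^sup>+t. indicator (\<psi> ` B) t * ennreal (F t) \<partial>lborel) = ennreal I"
    by (simp add: ennreal_mult' ennreal_indicator)
  moreover have "((\<lambda>x. \<bar>\<psi>' x\<bar> * F (\<psi> x)) has_integral I) B"
    using B by (simp add: absolutely_integrable_on_def has_integral_integral)
  from nn_integral_has_integral_lebesgue[OF _ this]
  have "(\<integral>\<^sup>+x. indicator B x * ennreal (\<bar>\<psi>' x\<bar> * F (\<psi> x)) \<partial>lborel) = ennreal I"
    using F(2) by (simp add: ennreal_mult' ennreal_indicator)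
  ultimately show ?thesis by simp
qed

section \<open>The constant term as a function of a root\<close>

definition root_const :: "real poly \<Rightarrow> real \<Rightarrow> real" where
  "root_const h x = - x * poly h x"

lemma root_const_iff: "poly (pCons t h) x = 0 \<longleftrightarrow> t = root_const h x"
  by (auto simp: root_const_def)

lemma root_const_root [simp]: "poly (pCons (root_const h x) h) x = 0"
  by (simp add: root_const_def)

text \<open>Up to sign this is the derivative at \<open>x\<close> of the whole polynomial
  \<open>pCons t h\<close>, as the implicit function theorem predicts for the dependence of the
  constant term on a root.\<close>

lemma DERIV_root_const:
  "(root_const h has_real_derivative - poly (h + pCons 0 (pderiv h)) x) (at x)"
proof -
  have "((\<lambda>x. - x * poly h x) has_real_derivative (- 1) * poly h x + poly (pderiv h) x * - x) (at x)"
    by (rule DERIV_mult) (auto intro!: derivative_eq_intros poly_DERIV)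
  then show ?thesis
    unfolding root_const_def[abs_def] by (simp add: algebra_simps)
qed

lemma continuous_root_const: "continuous_on UNIV (\<lambda>x. poly (pCons (root_const h x) h) y)"
  unfolding root_const_def by (auto intro!: continuous_intros)

lemma open_root_const_sign_changes: "open {x. \<exists>q. sign_changes k a b (pCons (root_const h x) h) q \<and> u q < x \<and> x < v q}"
proof -
  have "{x. \<exists>q. sign_changes k a b (pCons (root_const h x) h) q \<and> u q < x \<and> x < v q} =
    (\<Union>q. {x. sign_changes k a b (pCons (root_const h x) h) q} \<inter> {u q<..<v q})" by auto
  also have "open \<dots>"
    by (intro open_UN ballI open_Int open_sign_changes continuous_root_const) auto
  finally show ?thesis .
qed

lemma open_pCons_sign_changes: "open {t. \<exists>q. sign_changes k a b (pCons t h) q \<and> Q q}"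
proof -
  have "{t. \<exists>q. sign_changes k a b (pCons t h) q \<and> Q q} = (\<Union>q\<in>{q. Q q}. {t. sign_changes k a b (pCons t h) q})" by auto
  also have "open \<dots>" by (intro open_UN ballI open_sign_changes) (auto intro!: continuous_intros)
  finally show ?thesis .
qed

lemma bounded_root_const: "B \<subseteq> {a..b} \<Longrightarrow> bounded (root_const h ` B)"
proof (rule bounded_subset)
  show "bounded (root_const h ` {a..b})"
    unfolding root_const_def[abs_def]
    by (intro compact_imp_bounded compact_continuous_image) (auto intro!: continuous_intros)
qed auto

lemma simple_rooted_iff_sign_changes_real:
  assumes "degree p = n" "lead_coeff p = 1" "a < b"
  shows "simple_rooted n a b p \<longleftrightarrow> (\<exists>q. sign_changes n a b p q)"
  using assms simple_rooted_iff_sign_changes sign_changes_imp_simple_rooted by metis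

text \<open>Each \<^term>\<open>t\<close> with \<^term>\<open>simple_rooted (Suc n) 0 4 (pCons t h)\<close> is hit \<^term>\<open>Suc n\<close> times
  by \<^term>\<open>root_const h\<close>; sorting the preimages by rank makes the map injective.\<close>

lemma area_formula:
  assumes h: "degree h = n" "lead_coeff h = 1"
    and F: "continuous_on UNIV F" "\<And>t. F t \<ge> (0 :: real)"
  shows "of_nat (Suc n) * (\<integral>\<^sup>+t. indicator {t. simple_rooted (Suc n) 0 4 (pCons t h)} t * ennreal (F t) \<partial>lborel)
     = (\<integral>\<^sup>+x. indicator {x. simple_rooted (Suc n) 0 4 (pCons (root_const h x) h)} x *
          ennreal (\<bar>poly (h + pCons 0 (pderiv h)) x\<bar> * F (root_const h x)) \<partial>lborel)"
proof -
  let ?P = "\<lambda>x. pCons (root_const h x) h"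
  let ?G = "\<lambda>x. ennreal (\<bar>poly (h + pCons 0 (pderiv h)) x\<bar> * F (root_const h x))"
  \<comment> \<open>The points \<open>x\<close> that are the root of rank \<open>i\<close> in the
    polynomial of which they determine the constant term, with rank certified by the interval of
    \<open>q\<close> containing \<open>x\<close>; this keeps \<open>B i\<close> open.\<close>
  define B where "B i = {x. \<exists>q. sign_changes (Suc n) 0 4 (?P x) q \<and> q i < x \<and> x < q (Suc i)}" for i
  have mon: "degree (pCons t h) = Suc n" "lead_coeff (pCons t h) = 1" for t using h by auto
  have rank: "card {r. poly (?P x) r = 0 \<and> r < x} = i" if "x \<in> B i" "i < Suc n" for x i
    using that sign_changes_rank[OF _ mon] root_const_root by (fastforce simp: B_def)
  have img: "root_const h ` B i = {t. simple_rooted (Suc n) 0 4 (pCons t h)}" if i: "i < Suc n" for i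
  proof (intro set_eqI iffI)
    fix t assume "t \<in> root_const h ` B i"
    then show "t \<in> {t. simple_rooted (Suc n) 0 4 (pCons t h)}"
      using sign_changes_imp_simple_rooted[OF _ mon] by (auto simp: B_def)
  next
    fix t assume "t \<in> {t. simple_rooted (Suc n) 0 4 (pCons t h)}"
    then obtain q where q: "sign_changes (Suc n) 0 4 (pCons t h) q"
      using simple_rooted_iff_sign_changes_real[OF mon, of 0 4] by auto
    obtain f where f: "q i < f i \<and> f i < q (Suc i) \<and> poly (pCons t h) (f i) = 0"
      using sign_changes_roots[OF q] i by metis
    then have "t = root_const h (f i)" using root_const_iff by blast
    then show "t \<in> root_const h ` B i" using f q by (auto simp: B_def)
  qed
  have inj: "inj_on (root_const h) (B i)" if i: "i < Suc n" for i
  proof (rule inj_onI)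
    fix x y assume xy: "x \<in> B i" "y \<in> B i" "root_const h x = root_const h y"
    let ?c = "\<lambda>z. {r. poly (?P x) r = 0 \<and> r < z}"
    have c: "card (?c x) = i" "card (?c y) = i" using rank[OF xy(1) i] rank[OF xy(2) i] xy(3) by auto
    have r: "poly (?P x) x = 0" "poly (?P x) y = 0" using root_const_root[of h x] root_const_root[of h y] xy(3) by auto
    have "?P x \<noteq> 0" using mon by auto
    then have fin: "finite (?c z)" for z using poly_roots_finite[of "?P x"] by auto
    show "x = y"
    proof (rule ccontr)
      assume "x \<noteq> y"
      then consider "x < y" | "y < x" by linarith
      then show False
      proof cases
        case 1
        then have "?c x \<subset> ?c y" using r by auto
        then have "card (?c x) < card (?c y)" by (rule psubset_card_mono[OF fin])
        then show False using c by linarith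
      next
        case 2
        then have "?c y \<subset> ?c x" using r by auto
        then have "card (?c y) < card (?c x)" by (rule psubset_card_mono[OF fin])
        then show False using c by linarith
      qed
    qed
  qed
  have B04: "B i \<subseteq> {0..4}" if i: "i < Suc n" for i
  proof
    fix x assume "x \<in> B i"
    then obtain q where q: "sign_changes (Suc n) 0 4 (?P x) q" "q i < x" "x < q (Suc i)" by (auto simp: B_def)
    have "0 \<le> q 0" "q (Suc n) \<le> 4" using q by (auto simp: sign_changes_def)
    moreover have "q 0 \<le> q i" "q (Suc i) \<le> q (Suc n)" using sign_changes_le[OF q(1)] i by auto
    ultimately show "x \<in> {0..4}" using q by auto
  qed
  have opB: "open (B i)" for i unfolding B_def by (rule open_root_const_sign_changes)
  have opS: "open {t. simple_rooted (Suc n) 0 4 (pCons t h)}"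
    using open_pCons_sign_changes[of "Suc n" 0 4 h "\<lambda>_. True"] simple_rooted_iff_sign_changes_real[OF mon, of 0 4] by simp
  have piece: "(\<integral>\<^sup>+t. indicator {t. simple_rooted (Suc n) 0 4 (pCons t h)} t * ennreal (F t) \<partial>lborel)
     = (\<integral>\<^sup>+x. indicator (B i) x * ?G x \<partial>lborel)" if i: "i < Suc n" for i
    using nn_integral_injective_substitution[OF opB[of i] _ bounded_root_const[OF B04[OF i]] inj[OF i] DERIV_root_const F]
      opS unfolding img[OF i] abs_minus_cancel by simp
  \<comment> \<open>A root has exactly one rank, so the sets \<open>B i\<close> partition the domain
    on the right-hand side.\<close>
  have ind: "indicator {x. simple_rooted (Suc n) 0 4 (?P x)} x = (\<Sum>i<Suc n. indicator (B i) x :: ennreal)" for x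
  proof (cases "simple_rooted (Suc n) 0 4 (?P x)")
    case True
    then obtain R where R: "finite R" "card R = Suc n" "R \<subseteq> {0<..<4}" "?P x = rpoly R"
      by (auto simp: simple_rooted_def)
    have "x \<in> R" using rpoly_roots[OF R(1), of x] R(4) root_const_root[of h x] by simp
    define i where "i = card {r\<in>R. r < x}"
    have "card {r\<in>R. r < x} < card R"
      by (rule psubset_card_mono) (use R \<open>x \<in> R\<close> in auto)
    then have i: "i < Suc n" using R by (simp add: i_def)
    obtain q :: "nat \<Rightarrow> rat" where q: "sign_changes (card R) 0 4 (rpoly R * 1) (\<lambda>i. of_rat (q i))"
      "\<And>r. r \<in> R \<Longrightarrow> of_rat (q (card {r'\<in>R. r' < r})) < r \<and> r < of_rat (q (Suc (card {r'\<in>R. r' < r})))"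
      by (rule sign_changes_exists[OF R(1,3), of 1]) auto
    from q(1) have "sign_changes (Suc n) 0 4 (?P x) (\<lambda>i. of_rat (q i))" by (simp add: R)
    moreover have "of_rat (q i) < x \<and> x < of_rat (q (Suc i))"
      using q(2)[OF \<open>x \<in> R\<close>] by (simp add: i_def)
    ultimately have "x \<in> B i" unfolding B_def by blast
    moreover have "x \<notin> B j" if "j < Suc n" "j \<noteq> i" for j
      using rank[of x i] rank[of x j] that i \<open>x \<in> B i\<close> by auto
    ultimately have "(\<Sum>i<Suc n. indicator (B i) x :: ennreal) = (\<Sum>j<Suc n. if j = i then 1 else 0)"
      by (intro sum.cong) (auto simp: indicator_def)
    then show ?thesis using True i by simp
  next
    case False
    then have "x \<notin> B i" for i using sign_changes_imp_simple_rooted[OF _ mon] by (auto simp: B_def)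
    then show ?thesis using False by (simp add: indicator_def)
  qed
  have contG: "continuous_on UNIV (\<lambda>x. \<bar>poly (h + pCons 0 (pderiv h)) x\<bar> * F (root_const h x))"
    unfolding root_const_def by (intro continuous_intros continuous_on_compose2[OF F(1)]) auto
  have [measurable]: "?G \<in> borel_measurable lborel"
    using measurable_compose[OF borel_measurable_continuous_onI[OF contG] measurable_ennreal] by simp
  have [measurable]: "B i \<in> sets lborel" for i using opB by (simp add: borel_open)
  have "(\<integral>\<^sup>+x. indicator {x. simple_rooted (Suc n) 0 4 (?P x)} x * ?G x \<partial>lborel)
      = (\<integral>\<^sup>+x. (\<Sum>i<Suc n. indicator (B i) x * ?G x) \<partial>lborel)"
    unfolding ind by (simp only: sum_distrib_right)
  also have "\<dots> = (\<Sum>i<Suc n. (\<integral>\<^sup>+x. indicator (B i) x * ?G x \<partial>lborel))"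
    by (intro nn_integral_sum) measurable
  also have "\<dots> = (\<Sum>i<Suc n. (\<integral>\<^sup>+t. indicator {t. simple_rooted (Suc n) 0 4 (pCons t h)} t * ennreal (F t) \<partial>lborel))"
    using piece by (intro sum.cong) auto
  finally show ?thesis by simp
qed

section \<open>Measure-preserving shears of the coefficients\<close>

lemma measurable_coeff_update:
  assumes "j < n" "g \<in> borel_measurable (coeff_measure n)"
  shows "(\<lambda>x. x(j := g x)) \<in> measurable (coeff_measure n) (coeff_measure n)"
  unfolding coeff_measure_def
  by (rule measurable_fun_upd[where J = "{..<n}"]) (use assms in \<open>auto simp: coeff_measure_def\<close>)

text \<open>Integrating coordinate \<open>j\<close> innermost turns the map into a translation of
  Lebesgue measure on the line, as \<open>g\<close> is constant there.\<close>

lemma nn_integral_coordinate_shift: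
  fixes G :: "(nat \<Rightarrow> real) \<Rightarrow> ennreal"
  assumes j: "j < n" and g: "g \<in> borel_measurable (coeff_measure n)" "\<And>x u. g (x(j := u)) = g x"
    and G: "G \<in> borel_measurable (coeff_measure n)"
  shows "(\<integral>\<^sup>+x. G (x(j := x j + g x)) \<partial>coeff_measure n) = (\<integral>\<^sup>+x. G x \<partial>coeff_measure n)"
proof -
  define J where "J = {..<n} - {j}"
  have n: "{..<n} = insert j J" "finite J" "j \<notin> J" using j by (auto simp: J_def)
  have up: "(\<lambda>x. x(j := x j + g x)) \<in> measurable (coeff_measure n) (coeff_measure n)"
    using j g by (intro measurable_coeff_update) auto
  have G2: "(\<lambda>x. G (x(j := x j + g x))) \<in> borel_measurable (coeff_measure n)"
    by (rule measurable_compose[OF up G])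
  have "(\<integral>\<^sup>+x. G (x(j := x j + g x)) \<partial>coeff_measure n) =
    (\<integral>\<^sup>+x. (\<integral>\<^sup>+y. G (x(j := y + g x)) \<partial>lborel) \<partial>PiM J (\<lambda>_. lborel))"
    using G2 lb.product_nn_integral_insert[OF n(2,3)] g(2) by (simp add: coeff_measure_def n(1))
  also have "\<dots> = (\<integral>\<^sup>+x. (\<integral>\<^sup>+y. G (x(j := y)) \<partial>lborel) \<partial>PiM J (\<lambda>_. lborel))"
  proof (rule nn_integral_cong)
    fix x assume x: "x \<in> space (PiM J (\<lambda>_. lborel :: real measure))"
    have "(\<lambda>y. x(j := y)) \<in> measurable lborel (PiM (insert j J) (\<lambda>_. lborel))"
      using measurable_component_update[OF x n(3)] by simp
    then have m: "(\<lambda>y. G (x(j := y))) \<in> borel_measurable borel"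
      using measurable_compose[OF _ G] by (fastforce simp: coeff_measure_def n(1))
    show "(\<integral>\<^sup>+y. G (x(j := y + g x)) \<partial>lborel) = (\<integral>\<^sup>+y. G (x(j := y)) \<partial>lborel)"
      using nn_integral_real_affine[OF m, of 1 "g x"] by (simp add: add.commute)
  qed
  also have "\<dots> = (\<integral>\<^sup>+x. G x \<partial>coeff_measure n)"
    using G lb.product_nn_integral_insert[OF n(2,3)] by (simp add: coeff_measure_def n(1))
  finally show ?thesis .
qed

text \<open>Multiplication by X - \<gamma> on coefficients, without the constant term of the
  product. At index 0 the leading coefficient 1 stands in for the missing predecessor. The cut-off
  \<open>k\<close> makes the map a composition of shifts of single coordinates.\<close>

definition shear :: "nat \<Rightarrow> real \<Rightarrow> (nat \<Rightarrow> real) \<Rightarrow> nat \<Rightarrow> real" where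
  "shear k \<gamma> d = (\<lambda>i. if i < k then d i - \<gamma> * (if i = 0 then 1 else d (i - 1)) else d i)"

text \<open>The highest coordinate is shifted first, while its predecessor still has its old
  value.\<close>

lemma shear_Suc: "shear (Suc k) \<gamma> d = shear k \<gamma> (d(k := d k + - \<gamma> * (if k = 0 then 1 else d (k - 1))))"
  by (auto simp: shear_def fun_eq_iff less_Suc_eq)

lemma measurable_shear: "k \<le> n \<Longrightarrow> shear k \<gamma> \<in> measurable (coeff_measure n) (coeff_measure n)"
proof (induction k)
  case 0
  then show ?case by (simp add: shear_def)
next
  case (Suc k)
  have "(\<lambda>d. d(k := d k + - \<gamma> * (if k = 0 then 1 else d (k - 1)))) \<in> measurable (coeff_measure n) (coeff_measure n)"
    by (rule measurable_coeff_update) (use Suc.prems in auto)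
  from measurable_compose[OF this] Suc show ?case by (simp add: shear_Suc[abs_def])
qed

lemma nn_integral_shear:
  assumes "k \<le> n" and G: "G \<in> borel_measurable (coeff_measure n)"
  shows "(\<integral>\<^sup>+d. G (shear k \<gamma> d) \<partial>coeff_measure n) = (\<integral>\<^sup>+c. G c \<partial>coeff_measure n)"
  using assms(1)
proof (induction k)
  case 0
  then show ?case by (simp add: shear_def)
next
  case (Suc k)
  have "(\<lambda>d. G (shear k \<gamma> d)) \<in> borel_measurable (coeff_measure n)"
    using Suc.prems by (intro measurable_compose[OF measurable_shear G]) auto
  from nn_integral_coordinate_shift[OF _ _ _ this, of k "\<lambda>d. - \<gamma> * (if k = 0 then 1 else d (k - 1))"]
  moreover have "(if k = 0 then 1 else (d(k := u)) (k - 1)) = (if k = 0 then 1 else d (k - 1))" for d :: "nat \<Rightarrow> real" and u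
    by (cases k) auto
  ultimately show ?case using Suc by (auto simp: shear_Suc)
qed

text \<open>Synthetic multiplication, stated for every truncation to the first \<open>k\<close>
  coefficients so that the induction can follow the recursion of \<open>monic\<close>. The appended
  constant is \<open>- \<gamma>\<close> times the last coefficient of the truncation.\<close>

lemma monic_shear:
  assumes "k \<le> n"
  shows "pCons (- \<gamma> * (if k = 0 then 1 else d (k - 1))) (monic k (shear n \<gamma> d)) = [:- \<gamma>, 1:] * monic k d"
  using assms
proof (induction k)
  case 0
  show ?case by simp
next
  case (Suc k)
  have "poly (pCons (- \<gamma> * d k) (monic (Suc k) (shear n \<gamma> d))) y = poly ([:- \<gamma>, 1:] * monic (Suc k) d) y" for y
  proof -
    have "poly (pCons (- \<gamma> * (if k = 0 then 1 else d (k - 1))) (monic k (shear n \<gamma> d))) y = poly ([:- \<gamma>, 1:] * monic k d) y"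
      using Suc by simp
    then have IH: "y * poly (monic k (shear n \<gamma> d)) y = (y - \<gamma>) * poly (monic k d) y + \<gamma> * (if k = 0 then 1 else d (k - 1))"
      by (simp add: algebra_simps)
    have "poly (pCons (- \<gamma> * d k) (monic (Suc k) (shear n \<gamma> d))) y
      = - \<gamma> * d k + y * (d k - \<gamma> * (if k = 0 then 1 else d (k - 1)) + y * poly (monic k (shear n \<gamma> d)) y)"
      using Suc.prems by (simp add: shear_def)
    also have "\<dots> = poly ([:- \<gamma>, 1:] * monic (Suc k) d) y"
      unfolding IH by (simp add: algebra_simps)
    finally show ?thesis .
  qed
  then have "pCons (- \<gamma> * d k) (monic (Suc k) (shear n \<gamma> d)) = [:- \<gamma>, 1:] * monic (Suc k) d"
    using poly_eq_poly_eq_iff by blast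
  then show ?case by simp
qed

text \<open>If P = (X - \<gamma>) q then P'(\<gamma>) = q(\<gamma>). Thus the Jacobian of
  \<open>root_const\<close> is the value of the quotient at the removed root.\<close>

lemma root_const_shear:
  "pCons (root_const (monic n (shear n \<gamma> d)) \<gamma>) (monic n (shear n \<gamma> d)) = [:- \<gamma>, 1:] * monic n d"
  "poly (monic n (shear n \<gamma> d) + pCons 0 (pderiv (monic n (shear n \<gamma> d)))) \<gamma> = poly (monic n d) \<gamma>"
proof -
  let ?h = "monic n (shear n \<gamma> d)"
  obtain a where a: "pCons a ?h = [:- \<gamma>, 1:] * monic n d"
    using monic_shear[OF order_refl[of n], where \<gamma> = \<gamma> and d = d] by blast
  then have "poly (pCons a ?h) \<gamma> = 0" by simp
  then have "a = root_const ?h \<gamma>" using root_const_iff by blast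
  then show 1: "pCons (root_const ?h \<gamma>) ?h = [:- \<gamma>, 1:] * monic n d" using a by simp
  have "poly (?h + pCons 0 (pderiv ?h)) \<gamma> = poly (pderiv ([:- \<gamma>, 1:] * monic n d)) \<gamma>"
    unfolding 1[symmetric] by (simp add: pderiv_pCons)
  also have "\<dots> = poly (monic n d) \<gamma>" by (subst pderiv_mult) (simp add: pderiv_pCons)
  finally show "poly (?h + pCons 0 (pderiv ?h)) \<gamma> = poly (monic n d) \<gamma>" .
qed

lemma simple_rooted_mult:
  "simple_rooted (Suc n) a b ([:- x, 1:] * p) \<longleftrightarrow> x \<in> {a<..<b} \<and> simple_rooted n a b p \<and> poly p x \<noteq> 0"
proof
  assume "simple_rooted (Suc n) a b ([:- x, 1:] * p)"
  then obtain R where R: "finite R" "card R = Suc n" "R \<subseteq> {a<..<b}" "[:- x, 1:] * p = rpoly R"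
    unfolding simple_rooted_def by blast
  have "poly (rpoly R) x = 0" unfolding R(4)[symmetric] by simp
  then have x: "x \<in> R" using rpoly_roots R by blast
  then have "rpoly R = [:- x, 1:] * rpoly (R - {x})"
    using rpoly_insert[of "R - {x}" x] R by (simp add: insert_absorb)
  with R(4) have "[:- x, 1:] * p = [:- x, 1:] * rpoly (R - {x})" by simp
  then have p: "p = rpoly (R - {x})" by (subst (asm) mult_cancel_left) auto
  have "poly p x \<noteq> 0" unfolding p using R by (subst rpoly_roots) auto
  then show "x \<in> {a<..<b} \<and> simple_rooted n a b p \<and> poly p x \<noteq> 0"
    using R x p unfolding simple_rooted_def by (auto intro!: exI[of _ "R - {x}"])
next
  assume *: "x \<in> {a<..<b} \<and> simple_rooted n a b p \<and> poly p x \<noteq> 0"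
  then obtain R where R: "finite R" "card R = n" "R \<subseteq> {a<..<b}" "p = rpoly R"
    unfolding simple_rooted_def by blast
  then have "x \<notin> R" using * rpoly_roots by auto
  then show "simple_rooted (Suc n) a b ([:- x, 1:] * p)"
    using R * rpoly_insert[of R x] unfolding simple_rooted_def
    by (intro exI[of _ "insert x R"]) auto
qed

section \<open>Weighted volumes of the polynomials with simple roots in (0,4)\<close>

definition simple_rooted_set :: "nat \<Rightarrow> (nat \<Rightarrow> real) set" where
  "simple_rooted_set n = {c. simple_rooted n 0 4 (monic n c)}"

text \<open>The evaluation points \<open>ts\<close> make an induction on the degree possible:
  removing a root \<open>x\<close> leaves the weight \<open>\<bar>poly h x\<bar>\<close> on the
  quotient \<open>h\<close>, which is one more evaluation point. With no points this is the volume
  itself.\<close>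

definition root_moment :: "nat \<Rightarrow> real list \<Rightarrow> ennreal" where
  "root_moment n ts = (\<integral>\<^sup>+c. indicator (simple_rooted_set n) c *
      ennreal (\<Prod>t\<leftarrow>ts. \<bar>poly (monic n c) t\<bar>) \<partial>coeff_measure n)"

lemma measurable_prod_list:
  assumes "\<And>t. (\<lambda>z. f t z :: real) \<in> borel_measurable M"
  shows "(\<lambda>z. \<Prod>t\<leftarrow>ts. f t z) \<in> borel_measurable M"
  using assms by (induction ts) auto

lemma pred_simple_rooted:
  assumes "\<And>y. (\<lambda>z. poly (p z) y) \<in> borel_measurable M"
    "\<And>z. degree (p z) = n" "\<And>z. lead_coeff (p z) = 1" "a < b"
  shows "Measurable.pred M (\<lambda>z. simple_rooted n a b (p z))"
  using measurable_sign_changes[OF assms(1)] simple_rooted_iff_sign_changes[OF assms(2,3,4)] by simp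

lemma measurable_indicator_pred:
  assumes "Measurable.pred M P"
  shows "(indicator {z. P z} :: _ \<Rightarrow> ennreal) \<in> borel_measurable M"
proof -
  have "(\<lambda>z. indicator {z. P z} z :: ennreal) = (\<lambda>z. if P z then 1 else 0)" by (auto simp: indicator_def)
  also have "\<dots> \<in> borel_measurable M" using assms by (intro measurable_If_set measurable_If) (auto simp: pred_def)
  finally show ?thesis by simp
qed

lemma measurable_root_moment_integrand:
  "(\<lambda>c. indicator (simple_rooted_set n) c * ennreal (\<Prod>t\<leftarrow>ts. \<bar>poly (monic n c) t\<bar>)) \<in> borel_measurable (coeff_measure n)"
proof -
  have p: "(\<lambda>z. poly (monic n z) y) \<in> borel_measurable (coeff_measure n)" for y
    by (intro measurable_poly_monic) auto
  have "(indicator (simple_rooted_set n) :: _ \<Rightarrow> ennreal) \<in> borel_measurable (coeff_measure n)"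
    unfolding simple_rooted_set_def by (intro measurable_indicator_pred pred_simple_rooted p) auto
  moreover have "(\<lambda>c. \<Prod>t\<leftarrow>ts. \<bar>poly (monic n c) t\<bar>) \<in> borel_measurable (coeff_measure n)"
    using p by (intro measurable_prod_list) auto
  ultimately show ?thesis by measurable
qed

lemma prod_list_abs_nonneg: "0 \<le> (\<Prod>t\<leftarrow>ts. \<bar>f t :: real\<bar>)"
  by (induction ts) auto

lemma prod_list_nonneg_map: "(\<And>t. f t \<ge> (0 :: real)) \<Longrightarrow> 0 \<le> (\<Prod>t\<leftarrow>ts. f t)"
  by (induction ts) auto

lemma monic_nonzero [simp]: "monic n (c :: nat \<Rightarrow> real) \<noteq> 0"
  using lead_coeff_monic[of n c] by (metis coeff_0 zero_neq_one)

lemma monic_upd [simp]: "monic n (c(n := t)) = monic n c"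
  by (rule monic_cong) auto

lemma continuous_prod_list:
  assumes "\<And>t. continuous_on UNIV (\<lambda>z :: real. f t z :: real)"
  shows "continuous_on UNIV (\<lambda>z. \<Prod>t\<leftarrow>ts. f t z)"
  using assms by (induction ts) (auto intro!: continuous_intros)

lemma nn_integral_coeff_measure_Suc:
  assumes "G \<in> borel_measurable (coeff_measure (Suc n))"
  shows "(\<integral>\<^sup>+z. G z \<partial>coeff_measure (Suc n)) = (\<integral>\<^sup>+c. (\<integral>\<^sup>+t. G (c(n := t)) \<partial>lborel) \<partial>coeff_measure n)"
    "(\<integral>\<^sup>+z. G z \<partial>coeff_measure (Suc n)) = (\<integral>\<^sup>+t. (\<integral>\<^sup>+c. G (c(n := t)) \<partial>coeff_measure n) \<partial>lborel)"
  using assms lb.product_nn_integral_insert[of "{..<n}" n G] lb.product_nn_integral_insert_rev[of "{..<n}" n G]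
  by (simp_all add: coeff_measure_def lessThan_Suc)

text \<open>Dividing by the linear factor of a given root is a shear of the coefficients, hence preserves the measure.\<close>

lemma nn_integral_peel:
  assumes G [measurable]: "G \<in> borel_measurable (coeff_measure (Suc n))"
    and G_eq: "\<And>z. G z = g (z n) (pCons (root_const (monic n z) (z n)) (monic n z)) (poly (monic n z + pCons 0 (pderiv (monic n z))) (z n))"
  shows "(\<integral>\<^sup>+c. (\<integral>\<^sup>+x. G (c(n := x)) \<partial>lborel) \<partial>coeff_measure n) =
    (\<integral>\<^sup>+x. (\<integral>\<^sup>+d. g x ([:- x, 1:] * monic n d) (poly (monic n d) x) \<partial>coeff_measure n) \<partial>lborel)"
proof -
  have "(\<integral>\<^sup>+c. (\<integral>\<^sup>+x. G (c(n := x)) \<partial>lborel) \<partial>coeff_measure n) = (\<integral>\<^sup>+x. (\<integral>\<^sup>+c. G (c(n := x)) \<partial>coeff_measure n) \<partial>lborel)"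
    using nn_integral_coeff_measure_Suc[OF G] by simp
  also have "\<dots> = (\<integral>\<^sup>+x. (\<integral>\<^sup>+d. G ((shear n x d)(n := x)) \<partial>coeff_measure n) \<partial>lborel)"
  proof (rule nn_integral_cong, rule nn_integral_shear[symmetric, OF order_refl])
    fix x :: real
    have "(\<lambda>c. c(n := x)) \<in> measurable (coeff_measure n) (coeff_measure (Suc n))"
      unfolding coeff_measure_def by (rule measurable_fun_upd[where J = "{..<n}"]) auto
    then show "(\<lambda>c. G (c(n := x))) \<in> borel_measurable (coeff_measure n)"
      by (rule measurable_compose[OF _ G])
  qed
  finally show ?thesis by (simp only: G_eq monic_upd fun_upd_same root_const_shear)
qed

text \<open>\<open>area_formula\<close> in the constant term, then \<open>nn_integral_peel\<close>.
  The factor \<open>Suc n\<close> counts the choices of the removed root \<open>x\<close>; the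
  Jacobian adds \<open>x\<close> to the list, and each old evaluation splits into
  \<open>\<bar>t - x\<bar>\<close> times the evaluation of the quotient.\<close>

lemma root_moment_Suc:
  "ennreal (real (Suc n)) * root_moment (Suc n) ts =
   (\<integral>\<^sup>+x. indicator {0<..<4} x * (ennreal (\<Prod>t\<leftarrow>ts. \<bar>t - x\<bar>) * root_moment n (x # ts)) \<partial>lborel)"
proof -
  let ?h = "\<lambda>z :: nat \<Rightarrow> real. monic n z"
  let ?P = "\<lambda>z :: nat \<Rightarrow> real. pCons (root_const (monic n z) (z n)) (monic n z)"
  let ?D = "\<lambda>z :: nat \<Rightarrow> real. poly (monic n z + pCons 0 (pderiv (monic n z))) (z n)"
  define g where "g x p D = indicator {p. simple_rooted (Suc n) 0 4 p} p * ennreal (\<bar>D\<bar> * (\<Prod>t\<leftarrow>ts. \<bar>poly p t\<bar>))"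
    for x :: real and p D
  define G where "G z = g (z n) (?P z) (?D z)" for z
  have hm: "(\<lambda>z. poly (?h z) y) \<in> borel_measurable (coeff_measure (Suc n))"
    "(\<lambda>z. poly (?h z) (z n)) \<in> borel_measurable (coeff_measure (Suc n))"
    "(\<lambda>z. poly (pderiv (?h z)) (z n)) \<in> borel_measurable (coeff_measure (Suc n))" for y
    by (intro measurable_poly_monic measurable_poly_pderiv_monic; simp)+
  have P: "(\<lambda>z. poly (?P z) y) \<in> borel_measurable (coeff_measure (Suc n))" for y
    using hm by (simp add: root_const_def)
  have "G \<in> borel_measurable (coeff_measure (Suc n))"
  proof -
    have "(\<lambda>z. indicator {z. simple_rooted (Suc n) 0 4 (?P z)} z :: ennreal) \<in> borel_measurable (coeff_measure (Suc n))"
      by (intro measurable_indicator_pred pred_simple_rooted P) auto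
    moreover have "?D \<in> borel_measurable (coeff_measure (Suc n))" using hm by simp
    moreover have "(\<lambda>z. \<Prod>t\<leftarrow>ts. \<bar>poly (?P z) t\<bar>) \<in> borel_measurable (coeff_measure (Suc n))"
      using P by (intro measurable_prod_list) auto
    ultimately have "(\<lambda>z. indicator {z. simple_rooted (Suc n) 0 4 (?P z)} z * ennreal (\<bar>?D z\<bar> * (\<Prod>t\<leftarrow>ts. \<bar>poly (?P z) t\<bar>)))
      \<in> borel_measurable (coeff_measure (Suc n))" by measurable
    then show ?thesis by (simp add: G_def[abs_def] g_def indicator_def)
  qed
  note peel = nn_integral_peel[OF this G_def]
  have "ennreal (real (Suc n)) * root_moment (Suc n) ts = (\<integral>\<^sup>+z. ennreal (real (Suc n)) *
     (indicator (simple_rooted_set (Suc n)) z * ennreal (\<Prod>t\<leftarrow>ts. \<bar>poly (monic (Suc n) z) t\<bar>)) \<partial>coeff_measure (Suc n))"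
    unfolding root_moment_def by (rule nn_integral_cmult[symmetric, OF measurable_root_moment_integrand])
  also have "\<dots> = (\<integral>\<^sup>+c. (\<integral>\<^sup>+t. ennreal (real (Suc n)) * (indicator (simple_rooted_set (Suc n)) (c(n := t)) *
      ennreal (\<Prod>s\<leftarrow>ts. \<bar>poly (monic (Suc n) (c(n := t))) s\<bar>)) \<partial>lborel) \<partial>coeff_measure n)"
    by (rule nn_integral_coeff_measure_Suc) (intro borel_measurable_times_ennreal measurable_root_moment_integrand borel_measurable_const)
  also have "\<dots> = (\<integral>\<^sup>+c. (\<integral>\<^sup>+x. G (c(n := x)) \<partial>lborel) \<partial>coeff_measure n)"
  proof (rule nn_integral_cong)
    fix c :: "nat \<Rightarrow> real"
    define F where "F t = (\<Prod>s\<leftarrow>ts. \<bar>poly (pCons t (monic n c)) s\<bar>)" for t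
    have F: "continuous_on UNIV F" "F t \<ge> 0" for t
      unfolding F_def by (auto intro!: continuous_prod_list continuous_intros simp: prod_list_abs_nonneg)
    have mon: "degree (pCons t (monic n c)) = Suc n" "lead_coeff (pCons t (monic n c)) = 1" for t
      by auto
    have op: "open {t. simple_rooted (Suc n) 0 4 (pCons t (monic n c))}"
      using open_pCons_sign_changes[of "Suc n" 0 4 "monic n c" "\<lambda>_. True"] simple_rooted_iff_sign_changes_real[OF mon, of 0 4] by simp
    then have "(\<lambda>t. indicator {t. simple_rooted (Suc n) 0 4 (pCons t (monic n c))} t :: ennreal) \<in> borel_measurable lborel"
      by (simp add: borel_open)
    moreover have "(\<lambda>t. ennreal (F t)) \<in> borel_measurable lborel"
      using measurable_compose[OF borel_measurable_continuous_onI[OF F(1)] measurable_ennreal] by simp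
    ultimately have m: "(\<lambda>t. indicator {t. simple_rooted (Suc n) 0 4 (pCons t (monic n c))} t * ennreal (F t)) \<in> borel_measurable lborel"
      by (rule borel_measurable_times_ennreal)
    have "(\<integral>\<^sup>+t. ennreal (real (Suc n)) * (indicator (simple_rooted_set (Suc n)) (c(n := t)) *
      ennreal (\<Prod>s\<leftarrow>ts. \<bar>poly (monic (Suc n) (c(n := t))) s\<bar>)) \<partial>lborel) =
      (\<integral>\<^sup>+t. of_nat (Suc n) * (indicator {t. simple_rooted (Suc n) 0 4 (pCons t (monic n c))} t * ennreal (F t)) \<partial>lborel)"
      unfolding simple_rooted_set_def F_def ennreal_of_nat_eq_real_of_nat by (simp add: indicator_def)
    also have "\<dots> = (\<integral>\<^sup>+x. indicator {x. simple_rooted (Suc n) 0 4 (pCons (root_const (monic n c) x) (monic n c))} x *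
          ennreal (\<bar>poly (monic n c + pCons 0 (pderiv (monic n c))) x\<bar> * F (root_const (monic n c) x)) \<partial>lborel)"
      by (subst nn_integral_cmult[OF m], rule area_formula) (auto intro: F)
    also have "\<dots> = (\<integral>\<^sup>+x. G (c(n := x)) \<partial>lborel)"
      unfolding G_def g_def F_def by (simp add: indicator_def)
    finally show "(\<integral>\<^sup>+t. ennreal (real (Suc n)) * (indicator (simple_rooted_set (Suc n)) (c(n := t)) *
      ennreal (\<Prod>s\<leftarrow>ts. \<bar>poly (monic (Suc n) (c(n := t))) s\<bar>)) \<partial>lborel) = (\<integral>\<^sup>+x. G (c(n := x)) \<partial>lborel)" .
  qed
  also have "\<dots> = (\<integral>\<^sup>+x. (\<integral>\<^sup>+d. g x ([:- x, 1:] * monic n d) (poly (monic n d) x) \<partial>coeff_measure n) \<partial>lborel)"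
    by (rule peel)
  also have "\<dots> = (\<integral>\<^sup>+x. indicator {0<..<4} x * (ennreal (\<Prod>t\<leftarrow>ts. \<bar>t - x\<bar>) * root_moment n (x # ts)) \<partial>lborel)"
  proof (rule nn_integral_cong)
    fix x :: real
    have "poly ([:- x, 1:] * p) t = (t - x) * poly p t" for p t
      by (simp add: algebra_simps)
    then have e: "(\<Prod>t\<leftarrow>ts. \<bar>poly ([:- x, 1:] * p) t\<bar>) = (\<Prod>t\<leftarrow>ts. \<bar>t - x\<bar>) * (\<Prod>t\<leftarrow>ts. \<bar>poly p t\<bar>)" for p
      by (induction ts) (simp_all only: list.map prod_list.Cons prod_list.Nil abs_mult mult_1_right mult_ac)
    have "g x ([:- x, 1:] * monic n d) (poly (monic n d) x) = indicator {0<..<4} x * ennreal (\<Prod>t\<leftarrow>ts. \<bar>t - x\<bar>) *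
       (indicator (simple_rooted_set n) d * ennreal (\<Prod>t\<leftarrow>x # ts. \<bar>poly (monic n d) t\<bar>))" for d
    \<comment> \<open>If the quotient vanishes at \<open>x\<close>, the product has a double root
      and the indicators may disagree, but the Jacobian is then 0 on both sides.\<close>
    proof (cases "poly (monic n d) x = 0")
      case False
      have "g x ([:- x, 1:] * monic n d) (poly (monic n d) x) = indicator {0<..<4} x * indicator (simple_rooted_set n) d
        * ennreal (\<bar>poly (monic n d) x\<bar> * ((\<Prod>t\<leftarrow>ts. \<bar>t - x\<bar>) * (\<Prod>t\<leftarrow>ts. \<bar>poly (monic n d) t\<bar>)))"
        unfolding g_def e using simple_rooted_mult[of n 0 4 x "monic n d"] False
        by (auto simp: indicator_def simple_rooted_set_def)
      also have "\<dots> = indicator {0<..<4} x * indicator (simple_rooted_set n) d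
        * (ennreal (\<Prod>t\<leftarrow>ts. \<bar>t - x\<bar>) * ennreal (\<bar>poly (monic n d) x\<bar> * (\<Prod>t\<leftarrow>ts. \<bar>poly (monic n d) t\<bar>)))"
        by (subst ennreal_mult[symmetric]) (auto simp: prod_list_abs_nonneg mult_ac)
      finally show ?thesis by (simp add: mult_ac)
    qed (simp add: g_def)
    then show "(\<integral>\<^sup>+d. g x ([:- x, 1:] * monic n d) (poly (monic n d) x) \<partial>coeff_measure n) =
      indicator {0<..<4} x * (ennreal (\<Prod>t\<leftarrow>ts. \<bar>t - x\<bar>) * root_moment n (x # ts))"
      unfolding root_moment_def by (simp only: nn_integral_cmult[OF measurable_root_moment_integrand]) (simp add: mult_ac)
  qed
  finally show ?thesis .
qed

lemma nn_integral_unif: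
  assumes f: "f \<in> borel_measurable borel"
  shows "(\<integral>\<^sup>+x. indicator {0<..<4} x * f x \<partial>lborel) = 4 * (\<integral>\<^sup>+x. f x \<partial>unif)"
proof -
  have "(\<integral>\<^sup>+x. f x \<partial>unif) = (\<integral>\<^sup>+x. f x * indicator {0..4} x \<partial>lborel) / 4"
    unfolding unif_def using f by (subst nn_integral_uniform_measure) auto
  also have "(\<integral>\<^sup>+x. f x * indicator {0..4} x \<partial>lborel) = (\<integral>\<^sup>+x. indicator {0<..<4} x * f x \<partial>lborel)"
  proof (rule nn_integral_cong_AE)
    have "AE x in lborel. x \<noteq> (0::real)" "AE x in lborel. x \<noteq> (4::real)" by (rule AE_lborel_singleton)+
    then show "AE x in lborel. f x * indicator {0..4} x = indicator {0<..<4} x * f x"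
      by eventually_elim (auto simp: indicator_def)
  qed
  finally show ?thesis
    by (simp add: ennreal_times_divide mult.commute[of 4] ennreal_mult_divide_eq)
qed

text \<open>Every removed root contributes a factor 4 from the normalisation and one factor of 1/n!;
  the distances to the roots removed before it build up the Vandermonde product.\<close>

lemma root_moment_eq:
  "root_moment n ts = ennreal (4 ^ n / fact n) *
     (\<integral>\<^sup>+x. ennreal ((\<Prod>t\<leftarrow>ts. \<Prod>i<n. \<bar>t - x i\<bar>) * vdm n x) \<partial>cube n)"
proof (induction n arbitrary: ts)
  case 0
  have "simple_rooted 0 0 4 1" unfolding simple_rooted_def by (auto simp: rpoly_def intro!: exI[of _ "{}"])
  moreover have "(\<Prod>t\<leftarrow>ts. \<bar>1 :: real\<bar>) = 1" "(\<Prod>t\<leftarrow>ts. 1 :: real) = 1" by (induction ts) auto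
  ultimately show ?case
    by (simp add: root_moment_def coeff_measure_def cube_def vdm_def simple_rooted_set_def
        PiM_empty nn_integral_count_space_finite)
next
  case (Suc n)
  let ?f = "\<lambda>z. ennreal ((\<Prod>t\<leftarrow>ts. \<Prod>i<Suc n. \<bar>t - z i\<bar>) * vdm (Suc n) z)"
  have fm: "?f \<in> borel_measurable (cube (Suc n))"
  proof -
    have "(\<lambda>z. \<Prod>t\<leftarrow>ts. \<Prod>i<Suc n. \<bar>t - z i\<bar>) \<in> borel_measurable (cube (Suc n))"
      by (intro measurable_prod_list borel_measurable_prod borel_measurable_abs borel_measurable_diff borel_measurable_const measurable_cube_coord) auto
    moreover have "vdm (Suc n) \<in> borel_measurable (cube (Suc n))"
      using bdd_meas_vdm[of "Suc n" "Suc n"] by (simp add: bdd_meas_def)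
    ultimately show ?thesis by measurable
  qed
  have fe: "?f (y(n := x)) = ennreal (\<Prod>t\<leftarrow>ts. \<bar>t - x\<bar>) * ennreal ((\<Prod>t\<leftarrow>x # ts. \<Prod>i<n. \<bar>t - y i\<bar>) * vdm n y)" for x y
  proof -
    have "vdm n (y(n := x)) = vdm n y" by (rule vdm_cong) auto
    moreover have "(\<Prod>i<n. \<bar>t - (y(n := x)) i\<bar>) = (\<Prod>i<n. \<bar>t - y i\<bar>)" for t by (intro prod.cong) auto
    moreover have "(\<Prod>t\<leftarrow>ts. (\<Prod>i<n. \<bar>t - y i\<bar>) * \<bar>t - x\<bar>) = (\<Prod>t\<leftarrow>ts. \<bar>t - x\<bar>) * (\<Prod>t\<leftarrow>ts. \<Prod>i<n. \<bar>t - y i\<bar>)"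
      by (induction ts) auto
    moreover have "(\<Prod>j<n. \<bar>x - (y(n := x)) j\<bar>) = (\<Prod>j<n. \<bar>x - y j\<bar>)" by (intro prod.cong) auto
    ultimately show ?thesis
      by (simp add: vdm_Suc ennreal_mult[symmetric] prod_list_abs_nonneg prod_list_nonneg_map vdm_nonneg prod_nonneg mult_ac)
  qed
  have ym: "(\<lambda>y. ennreal ((\<Prod>t\<leftarrow>ts'. \<Prod>i<n. \<bar>t - y i\<bar>) * vdm n y)) \<in> borel_measurable (cube n)" for ts'
  proof -
    have "(\<lambda>z. \<Prod>t\<leftarrow>ts'. \<Prod>i<n. \<bar>t - z i\<bar>) \<in> borel_measurable (cube n)"
      by (intro measurable_prod_list borel_measurable_prod borel_measurable_abs borel_measurable_diff borel_measurable_const measurable_cube_coord) auto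
    moreover have "vdm n \<in> borel_measurable (cube n)"
      using bdd_meas_vdm[of n n] by (simp add: bdd_meas_def)
    ultimately show ?thesis by measurable
  qed
  define I where "I x = (\<integral>\<^sup>+y. ?f (y(n := x)) \<partial>cube n)" for x
  have Im: "I \<in> borel_measurable borel"
  proof -
    interpret sf: sigma_finite_measure "cube n"
      using prob_space_cube[of n] by (simp add: prob_space_imp_sigma_finite)
    have "(\<lambda>(x, y). y(n := x)) \<in> measurable (borel \<Otimes>\<^sub>M cube n) (cube (Suc n))"
      unfolding cube_def split_beta by (rule measurable_fun_upd[where J = "{..<n}"]) auto
    from measurable_compose[OF this fm] have "(\<lambda>(x, y). ?f (y(n := x))) \<in> borel_measurable (borel \<Otimes>\<^sub>M cube n)"
      by (simp add: split_beta)
    then show ?thesis unfolding I_def by (rule sf.borel_measurable_nn_integral)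
  qed
  have "ennreal (real (Suc n)) * root_moment (Suc n) ts =
    (\<integral>\<^sup>+x. indicator {0<..<4} x * (ennreal (4 ^ n / fact n) * I x) \<partial>lborel)"
    unfolding root_moment_Suc Suc I_def fe
    by (simp only: nn_integral_cmult[OF ym]) (simp only: mult_ac)
  also have "\<dots> = 4 * (\<integral>\<^sup>+x. ennreal (4 ^ n / fact n) * I x \<partial>unif)"
    by (rule nn_integral_unif) (use Im in measurable)
  also have "\<dots> = 4 * (ennreal (4 ^ n / fact n) * (\<integral>\<^sup>+x. I x \<partial>unif))"
    by (subst nn_integral_cmult) (use Im measurable_cong_sets[OF sets_unif refl, of borel] in auto)
  also have "(\<integral>\<^sup>+x. I x \<partial>unif) = (\<integral>\<^sup>+z. ?f z \<partial>cube (Suc n))"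
    unfolding I_def using fm unif.product_nn_integral_insert_rev[of "{..<n}" n ?f]
    by (simp add: cube_def lessThan_Suc)
  also have "4 * (ennreal (4 ^ n / fact n) * (\<integral>\<^sup>+z. ?f z \<partial>cube (Suc n))) =
    ennreal (real (Suc n)) * (ennreal (4 ^ Suc n / fact (Suc n)) * (\<integral>\<^sup>+z. ?f z \<partial>cube (Suc n)))"
  proof -
    have "4 * ennreal (4 ^ n / fact n) = ennreal (4 * (4 ^ n / fact n))" by (subst ennreal_mult) auto
    also have "4 * (4 ^ n / fact n) = real (Suc n) * (4 ^ Suc n / fact (Suc n))" by (simp del: of_nat_Suc)
    also have "ennreal \<dots> = ennreal (real (Suc n)) * ennreal (4 ^ Suc n / fact (Suc n))" by (subst ennreal_mult) auto
    finally show ?thesis by (simp only: mult.assoc[symmetric])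
  qed
  finally show ?case by (subst (asm) ennreal_mult_cancel_left) auto
qed

text \<open>The factor \<open>m + 1\<close> is later cancelled by integrating the m-th power of the
  large root.\<close>

lemma root_moment_Nil: "root_moment m [] = ennreal (real (m + 1) * omega m)"
proof -
  have "(\<integral>\<^sup>+x. ennreal (vdm m x) \<partial>cube m) = ennreal (moment m 0)"
    unfolding moment_def using bdd_meas_integrable[OF bdd_meas_vdm[of m m]]
    by (subst nn_integral_eq_integral) (auto simp: vdm_nonneg)
  moreover have "moment m 0 \<ge> 0" unfolding moment_def by (intro Bochner_Integration.integral_nonneg) (auto simp: vdm_nonneg)
  ultimately have "root_moment m [] = ennreal (4 ^ m / fact m) * ennreal (moment m 0)"
    by (simp add: root_moment_eq)
  also have "\<dots> = ennreal (4 ^ m / fact m * moment m 0)"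
    using \<open>moment m 0 \<ge> 0\<close> by (intro ennreal_mult[symmetric]) auto
  finally have "root_moment m [] = ennreal (4 ^ m / fact m * moment m 0)" .
  moreover have "r \<noteq> 0 \<Longrightarrow> r * (A / r * P) = A * P" for r A P :: real by simp
  from this[of "real (m + 1)"]
  have "real (m + 1) * omega m = 2 ^ (m * (m + 1)) * (\<Prod>k<m. (fact k)\<^sup>2 / fact (2 * k + 1))"
    unfolding omega_def by simp
  ultimately show ?thesis by (simp only: selberg)
qed

section \<open>The volume of the region of trace polynomials\<close>

definition salem_poly :: "nat \<Rightarrow> real \<Rightarrow> real poly \<Rightarrow> bool" where
  "salem_poly m T p \<longleftrightarrow> (\<exists>R x. finite R \<and> card R = m \<and> R \<subseteq> {0<..<4} \<and> 4 < x \<and> x < T \<and> p = [:- x, 1:] * rpoly R)"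

lemma monic_root_factor:
  fixes p :: "'a::idom poly"
  assumes "degree p = Suc m" "lead_coeff p = 1" "poly p x = 0"
  obtains g where "p = [:- x, 1:] * g" "degree g = m" "lead_coeff g = 1"
proof -
  obtain g where g: "p = [:- x, 1:] * g" using assms(3) poly_eq_0_iff_dvd by (metis dvdE)
  then have "g \<noteq> 0" using assms by auto
  then have "degree g = m" using assms(1) unfolding g by (subst (asm) degree_mult_eq) auto
  moreover have "lead_coeff g = 1" using assms(2) unfolding g by (simp only: lead_coeff_mult) auto
  ultimately show ?thesis using that g by blast
qed

text \<open>The roots supplied by the sign changes lie below 4, so none of them is \<open>x\<close>;
  all are roots of \<open>g\<close> and exhaust its degree.\<close>

lemma sign_changes_imp_simple_rooted_factor:
  assumes g: "degree g = m" "lead_coeff g = 1" and x: "x > 4" and q: "sign_changes m 0 4 ([:- x, 1:] * g) q"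
  shows "simple_rooted m 0 4 g"
proof -
  obtain f where f: "\<And>i. i < m \<Longrightarrow> q i < f i \<and> f i < q (Suc i) \<and> poly ([:- x, 1:] * g) (f i) = 0"
    "strict_mono_on {..<m} f" "f ` {..<m} \<subseteq> {0<..<4}"
    using sign_changes_roots[OF q] by blast
  have "poly g (f i) = 0" if "i < m" for i
  proof -
    have "f i < 4" using f(3) that by auto
    then show ?thesis using f(1)[OF that] x by auto
  qed
  moreover have c: "card (f ` {..<m}) = m"
    using f(2) by (simp add: card_image strict_mono_on_imp_inj_on)
  ultimately have "g = rpoly (f ` {..<m})"
    using g by (intro rpoly_eqI) auto
  then show ?thesis unfolding simple_rooted_def using c f(3) by blast
qed

lemma simple_rooted_imp_sign_changes_factor:
  assumes "simple_rooted m 0 4 g" and x: "x > 4"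
  shows "\<exists>q :: nat \<Rightarrow> rat. sign_changes m 0 4 ([:- x, 1:] * g) (\<lambda>i. of_rat (q i))"
proof -
  obtain R where R: "finite R" "card R = m" "R \<subseteq> {0<..<4}" "g = rpoly R"
    using assms unfolding simple_rooted_def by blast
  obtain q :: "nat \<Rightarrow> rat" where "sign_changes (card R) 0 4 (rpoly R * [:- x, 1:]) (\<lambda>i. of_rat (q i))"
    by (rule sign_changes_exists[OF R(1,3), of "[:- x, 1:]"]) (use x in \<open>auto intro: mult_neg_neg\<close>)
  then have "sign_changes m 0 4 ([:- x, 1:] * g) (\<lambda>i. of_rat (q i))" by (simp only: R mult.commute)
  then show ?thesis by blast
qed

lemma salem_poly_iff_root:
  assumes "degree p = Suc m" "lead_coeff p = 1"
  shows "salem_poly m T p \<longleftrightarrow> (\<exists>x. 4 < x \<and> x < T \<and> poly p x = 0 \<and> (\<exists>q. sign_changes m 0 4 p q))"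
proof
  assume "salem_poly m T p"
  then obtain R x where R: "finite R" "card R = m" "R \<subseteq> {0<..<4}" and x: "4 < x" "x < T" "p = [:- x, 1:] * rpoly R"
    unfolding salem_poly_def by blast
  then have "simple_rooted m 0 4 (rpoly R)" unfolding simple_rooted_def by blast
  then have "\<exists>q :: nat \<Rightarrow> rat. sign_changes m 0 4 p (\<lambda>i. of_rat (q i))"
    unfolding x(3) using x(1) by (rule simple_rooted_imp_sign_changes_factor)
  then show "\<exists>x. 4 < x \<and> x < T \<and> poly p x = 0 \<and> (\<exists>q. sign_changes m 0 4 p q)"
    using x by (intro exI[of _ x]) auto
next
  assume "\<exists>x. 4 < x \<and> x < T \<and> poly p x = 0 \<and> (\<exists>q. sign_changes m 0 4 p q)"
  then obtain x q where x: "4 < x" "x < T" "poly p x = 0" "sign_changes m 0 4 p q" by blast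
  obtain g where g: "p = [:- x, 1:] * g" "degree g = m" "lead_coeff g = 1"
    using monic_root_factor[OF assms x(3)] by blast
  have "simple_rooted m 0 4 g"
    using sign_changes_imp_simple_rooted_factor[OF g(2,3) x(1)] x(4) unfolding g(1) by blast
  then show "salem_poly m T p" unfolding salem_poly_def simple_rooted_def using x g(1) by blast
qed

lemma sign_changes_one_root:
  assumes "sign_changes 1 a b p q"
  shows "\<exists>x. a < x \<and> x < b \<and> poly p x = 0"
proof -
  obtain f where f: "\<And>i. i < 1 \<Longrightarrow> q i < f i \<and> f i < q (Suc i) \<and> poly p (f i) = 0"
    "strict_mono_on {..<1} f" "f ` {..<1} \<subseteq> {a<..<b}"
    using sign_changes_roots[OF assms] by blast
  then have "f 0 \<in> {a<..<b}" by auto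
  then show ?thesis using f(1)[of 0] by auto
qed

text \<open>The large root gets its own sign change on \<open>{4..T}\<close>. Both certificates use
  rational points, so the region is measurable, and its traces on lines are open.\<close>

lemma salem_poly_iff_sign_changes:
  assumes p: "degree p = Suc m" "lead_coeff p = 1" and "4 < T"
  shows "salem_poly m T p \<longleftrightarrow> (\<exists>q :: nat \<Rightarrow> rat. sign_changes m 0 4 p (\<lambda>i. of_rat (q i))) \<and> (\<exists>q :: nat \<Rightarrow> rat. sign_changes 1 4 T p (\<lambda>i. of_rat (q i)))"
proof
  assume "salem_poly m T p"
  then obtain R x where R: "finite R" "card R = m" "R \<subseteq> {0<..<4}" and x: "4 < x" "x < T" "p = [:- x, 1:] * rpoly R"
    unfolding salem_poly_def by blast
  then have "simple_rooted m 0 4 (rpoly R)" unfolding simple_rooted_def by blast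
  then have 1: "\<exists>q :: nat \<Rightarrow> rat. sign_changes m 0 4 p (\<lambda>i. of_rat (q i))"
    unfolding x(3) using x(1) by (rule simple_rooted_imp_sign_changes_factor)
  have pos: "poly (rpoly R) y > 0" if "y \<ge> 4" for y
    unfolding poly_rpoly using R(3) that by (intro prod_pos) force
  have sub: "{x} \<subseteq> {4<..<T}" using x by auto
  obtain q :: "nat \<Rightarrow> rat" where "sign_changes (card {x}) 4 T (rpoly {x} * rpoly R) (\<lambda>i. of_rat (q i))"
    by (rule sign_changes_exists[OF _ sub, of "rpoly R"]) (use pos \<open>4 < T\<close> in auto)
  then have "sign_changes 1 4 T p (\<lambda>i. of_rat (q i))" using x(3) by (simp add: rpoly_def)
  with 1 show "(\<exists>q :: nat \<Rightarrow> rat. sign_changes m 0 4 p (\<lambda>i. of_rat (q i))) \<and> (\<exists>q :: nat \<Rightarrow> rat. sign_changes 1 4 T p (\<lambda>i. of_rat (q i)))"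
    by blast
next
  assume *: "(\<exists>q :: nat \<Rightarrow> rat. sign_changes m 0 4 p (\<lambda>i. of_rat (q i))) \<and> (\<exists>q :: nat \<Rightarrow> rat. sign_changes 1 4 T p (\<lambda>i. of_rat (q i)))"
  then obtain q where q: "sign_changes 1 4 T p q" by blast
  with sign_changes_one_root[OF q] * show "salem_poly m T p" unfolding salem_poly_iff_root[OF p] by blast
qed

text \<open>There is no multiplicity here: only one root exceeds 4, so \<open>root_const h\<close>
  is injective on the relevant set without sorting by rank.\<close>

lemma area_formula_top:
  assumes h: "degree h = m" "lead_coeff h = 1"
  shows "(\<integral>\<^sup>+t. indicator {t. salem_poly m T (pCons t h)} t \<partial>lborel)
     = (\<integral>\<^sup>+x. indicator {x. 4 < x \<and> x < T \<and> (\<exists>q. sign_changes m 0 4 (pCons (root_const h x) h) q)} x *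
          ennreal \<bar>poly (h + pCons 0 (pderiv h)) x\<bar> \<partial>lborel)"
proof -
  let ?P = "\<lambda>x. pCons (root_const h x) h"
  define B where "B = {x. 4 < x \<and> x < T \<and> (\<exists>q. sign_changes m 0 4 (?P x) q)}"
  have mon: "degree (pCons t h) = Suc m" "lead_coeff (pCons t h) = 1" for t using h by auto
  have img: "root_const h ` B = {t. salem_poly m T (pCons t h)}"
    unfolding salem_poly_iff_root[OF mon] B_def root_const_iff by auto
  have inj: "inj_on (root_const h) B"
  proof (rule inj_onI)
    fix x y assume xy: "x \<in> B" "y \<in> B" "root_const h x = root_const h y"
    then have "salem_poly m T (?P x)" using img by blast
    then obtain R z where R: "finite R" "card R = m" "R \<subseteq> {0<..<4}" "4 < z" "?P x = [:- z, 1:] * rpoly R"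
      unfolding salem_poly_def by blast
    have "w = z" if "w > 4" "poly (?P x) w = 0" for w
      using that R rpoly_roots[OF R(1), of w] unfolding R(5) by auto
    moreover have "poly (?P x) y = 0" using xy(3) root_const_root[of h y] by simp
    ultimately show "x = y" using xy(1,2) root_const_root[of h x] unfolding B_def by (metis (mono_tags, lifting) mem_Collect_eq)
  qed
  have "B = {4<..<T} \<inter> (\<Union>q. {x. sign_changes m 0 4 (?P x) q})" unfolding B_def by auto
  also have "open \<dots>" by (intro open_Int open_UN ballI open_sign_changes continuous_root_const) auto
  finally have opB: "open B" .
  have opS: "open (root_const h ` B)"
  proof (cases "4 < T")
    case True
    have e: "root_const h ` B = {t. \<exists>q. sign_changes m 0 4 (pCons t h) q \<and> True} \<inter> {t. \<exists>q. sign_changes 1 4 T (pCons t h) q \<and> True}"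
    proof (intro set_eqI iffI)
      fix t assume "t \<in> root_const h ` B"
      then have "salem_poly m T (pCons t h)" using img by blast
      then show "t \<in> {t. \<exists>q. sign_changes m 0 4 (pCons t h) q \<and> True} \<inter> {t. \<exists>q. sign_changes 1 4 T (pCons t h) q \<and> True}"
        unfolding salem_poly_iff_sign_changes[OF mon True] by blast
    next
      fix t assume "t \<in> {t. \<exists>q. sign_changes m 0 4 (pCons t h) q \<and> True} \<inter> {t. \<exists>q. sign_changes 1 4 T (pCons t h) q \<and> True}"
      then obtain q q' where q: "sign_changes m 0 4 (pCons t h) q" "sign_changes 1 4 T (pCons t h) q'" by blast
      then have "salem_poly m T (pCons t h)" using sign_changes_one_root[OF q(2)] unfolding salem_poly_iff_root[OF mon] by blast
      then show "t \<in> root_const h ` B" using img by blast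
    qed
    show ?thesis unfolding e by (intro open_Int open_pCons_sign_changes)
  next
    case False
    then have "B = {}" by (auto simp: B_def)
    then show ?thesis by simp
  qed
  have "B \<subseteq> {4..T}" by (auto simp: B_def)
  from nn_integral_injective_substitution[OF opB opS bounded_root_const[OF this] inj DERIV_root_const, of "\<lambda>_. 1"]
  show ?thesis unfolding img abs_minus_cancel B_def[symmetric] by simp
qed

definition salem_region :: "nat \<Rightarrow> real \<Rightarrow> (nat \<Rightarrow> real) set" where
  "salem_region m T = {c. salem_poly m T (monic (Suc m) c)}"

lemma pred_salem_region:
  assumes "4 < T"
  shows "Measurable.pred (coeff_measure (Suc m)) (\<lambda>c. c \<in> salem_region m T)"
proof -
  have m: "(\<lambda>z. poly (monic (Suc m) z) y) \<in> borel_measurable (coeff_measure (Suc m))" for y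
    by (intro measurable_poly_monic) auto
  have "salem_poly m T (monic (Suc m) c) \<longleftrightarrow> (\<exists>q :: nat \<Rightarrow> rat. sign_changes m 0 4 (monic (Suc m) c) (\<lambda>i. of_rat (q i))) \<and>
     (\<exists>q :: nat \<Rightarrow> rat. sign_changes 1 4 T (monic (Suc m) c) (\<lambda>i. of_rat (q i)))" for c
    using assms by (intro salem_poly_iff_sign_changes) (auto simp del: monic.simps)
  then show ?thesis
    unfolding salem_region_def mem_Collect_eq
    by (simp only:) (intro pred_intros_logic measurable_sign_changes m)
qed

text \<open>The peeling of \<open>root_moment_Suc\<close> applied to the unique root above 4: no
  factor for a choice of root occurs, and the Jacobian is the single evaluation point of
  \<open>root_moment m [x]\<close>.\<close>

lemma volume_salem_region:
  assumes "4 < T"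
  shows "(\<integral>\<^sup>+c. indicator (salem_region m T) c \<partial>coeff_measure (Suc m)) =
     (\<integral>\<^sup>+x. indicator {4<..<T} x * root_moment m [x] \<partial>lborel)"
proof -
  define g where "g x p D = indicator {p. x \<in> {4<..<T} \<and> (\<exists>q :: nat \<Rightarrow> rat. sign_changes m 0 4 p (\<lambda>i. of_rat (q i)))} p * ennreal \<bar>D\<bar>"
    for x :: real and p D
  let ?P = "\<lambda>z :: nat \<Rightarrow> real. pCons (root_const (monic m z) (z m)) (monic m z)"
  let ?D = "\<lambda>z :: nat \<Rightarrow> real. poly (monic m z + pCons 0 (pderiv (monic m z))) (z m)"
  define G where "G z = g (z m) (?P z) (?D z)" for z
  have hm: "(\<lambda>z. poly (monic m z) y) \<in> borel_measurable (coeff_measure (Suc m))"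
    "(\<lambda>z. poly (monic m z) (z m)) \<in> borel_measurable (coeff_measure (Suc m))"
    "(\<lambda>z. poly (pderiv (monic m z)) (z m)) \<in> borel_measurable (coeff_measure (Suc m))" for y
    by (intro measurable_poly_monic measurable_poly_pderiv_monic; simp)+
  have P: "(\<lambda>z. poly (?P z) y) \<in> borel_measurable (coeff_measure (Suc m))" for y
    using hm by (simp add: root_const_def)
  have "G \<in> borel_measurable (coeff_measure (Suc m))"
  proof -
    have "(\<lambda>z. indicator {z. z m \<in> {4<..<T} \<and> (\<exists>q :: nat \<Rightarrow> rat. sign_changes m 0 4 (?P z) (\<lambda>i. of_rat (q i)))} z :: ennreal)
       \<in> borel_measurable (coeff_measure (Suc m))"
      by (intro measurable_indicator_pred pred_intros_logic measurable_sign_changes P) measurable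
    moreover have "?D \<in> borel_measurable (coeff_measure (Suc m))" using hm by simp
    ultimately have "(\<lambda>z. indicator {z. z m \<in> {4<..<T} \<and> (\<exists>q :: nat \<Rightarrow> rat. sign_changes m 0 4 (?P z) (\<lambda>i. of_rat (q i)))} z * ennreal \<bar>?D z\<bar>)
      \<in> borel_measurable (coeff_measure (Suc m))" by measurable
    then show ?thesis by (simp add: G_def[abs_def] g_def indicator_def)
  qed
  note peel = nn_integral_peel[OF this G_def]
  have "(\<integral>\<^sup>+c. indicator (salem_region m T) c \<partial>coeff_measure (Suc m)) =
    (\<integral>\<^sup>+c. (\<integral>\<^sup>+t. indicator (salem_region m T) (c(m := t)) \<partial>lborel) \<partial>coeff_measure m)"
  proof (rule nn_integral_coeff_measure_Suc)
    show "(indicator (salem_region m T) :: _ \<Rightarrow> ennreal) \<in> borel_measurable (coeff_measure (Suc m))"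
      using measurable_indicator_pred[OF pred_salem_region[OF assms, of m]] by simp
  qed
  also have "\<dots> = (\<integral>\<^sup>+c. (\<integral>\<^sup>+x. G (c(m := x)) \<partial>lborel) \<partial>coeff_measure m)"
  proof (rule nn_integral_cong)
    fix c :: "nat \<Rightarrow> real"
    have 1: "indicator (salem_region m T) (c(m := t)) = (indicator {t. salem_poly m T (pCons t (monic m c))} t :: ennreal)" for t
      by (simp add: salem_region_def indicator_def)
    \<comment> \<open>The area formula speaks of real points, whereas measurability of
      \<open>G\<close> was obtained with rational ones; the factorisation at \<open>x\<close> shows
      that both conditions agree.\<close>
    have "sign_changes m 0 4 p q \<longrightarrow> (\<exists>q :: nat \<Rightarrow> rat. sign_changes m 0 4 p (\<lambda>i. of_rat (q i)))"
      if p: "x > 4" "poly p x = 0" "degree p = Suc m" "lead_coeff p = 1" for p q x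
    proof
      assume q: "sign_changes m 0 4 p q"
      obtain g where g: "p = [:- x, 1:] * g" "degree g = m" "lead_coeff g = 1"
        using monic_root_factor[OF p(3,4,2)] by blast
      show "\<exists>q :: nat \<Rightarrow> rat. sign_changes m 0 4 p (\<lambda>i. of_rat (q i))"
        using sign_changes_imp_simple_rooted_factor[OF g(2,3) p(1)] q simple_rooted_imp_sign_changes_factor[OF _ p(1)]
        unfolding g(1) by blast
    qed
    from this[of _ "pCons (root_const (monic m c) _) (monic m c)"]
    have "(\<exists>q. sign_changes m 0 4 (pCons (root_const (monic m c) x) (monic m c)) q) \<longleftrightarrow>
      (\<exists>q :: nat \<Rightarrow> rat. sign_changes m 0 4 (pCons (root_const (monic m c) x) (monic m c)) (\<lambda>i. of_rat (q i)))" if "x > 4" for x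
      using that root_const_root[of "monic m c" x] by (auto simp del: poly_pCons)
    then have 2: "indicator {x. 4 < x \<and> x < T \<and> (\<exists>q. sign_changes m 0 4 (pCons (root_const (monic m c) x) (monic m c)) q)} x *
          ennreal \<bar>poly (monic m c + pCons 0 (pderiv (monic m c))) x\<bar> = G (c(m := x))" for x
      unfolding G_def g_def by (auto simp: indicator_def)
    show "(\<integral>\<^sup>+t. indicator (salem_region m T) (c(m := t)) \<partial>lborel) = (\<integral>\<^sup>+x. G (c(m := x)) \<partial>lborel)"
      unfolding 1 by (subst area_formula_top) (simp_all only: 2 degree_monic lead_coeff_monic)
  qed
  also have "\<dots> = (\<integral>\<^sup>+x. (\<integral>\<^sup>+d. g x ([:- x, 1:] * monic m d) (poly (monic m d) x) \<partial>coeff_measure m) \<partial>lborel)"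
    by (rule peel)
  also have "\<dots> = (\<integral>\<^sup>+x. indicator {4<..<T} x * root_moment m [x] \<partial>lborel)"
  proof (rule nn_integral_cong)
    fix x :: real
    have "g x ([:- x, 1:] * monic m d) (poly (monic m d) x) = indicator {4<..<T} x *
       (indicator (simple_rooted_set m) d * ennreal (\<Prod>t\<leftarrow>[x]. \<bar>poly (monic m d) t\<bar>))" for d
    proof -
      have "(\<exists>q :: nat \<Rightarrow> rat. sign_changes m 0 4 ([:- x, 1:] * monic m d) (\<lambda>i. of_rat (q i))) \<longleftrightarrow> simple_rooted m 0 4 (monic m d)" if "x > 4"
      proof
        have h: "degree (monic m d) = m" "lead_coeff (monic m d) = 1" by auto
        show "simple_rooted m 0 4 (monic m d)" if "\<exists>q :: nat \<Rightarrow> rat. sign_changes m 0 4 ([:- x, 1:] * monic m d) (\<lambda>i. of_rat (q i))"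
          using that sign_changes_imp_simple_rooted_factor[OF h \<open>x > 4\<close>] by blast
      qed (rule simple_rooted_imp_sign_changes_factor[OF _ that])
      then show ?thesis unfolding g_def by (auto simp: indicator_def simple_rooted_set_def)
    qed
    then show "(\<integral>\<^sup>+d. g x ([:- x, 1:] * monic m d) (poly (monic m d) x) \<partial>coeff_measure m) =
      indicator {4<..<T} x * root_moment m [x]"
      unfolding root_moment_def by (simp only: nn_integral_cmult[OF measurable_root_moment_integrand])
  qed
  finally show ?thesis .
qed

lemma omega_pos: "omega m > 0"
  unfolding omega_def by (intro mult_pos_pos divide_pos_pos prod_pos) auto

lemma nn_integral_power:
  assumes "0 \<le> a" "a \<le> b" "d \<le> a"
  shows "(\<integral>\<^sup>+x. ennreal ((x - d) ^ m) * indicator {a..b} x \<partial>lborel) = ennreal ((b - d) ^ (m + 1) / real (m + 1) - (a - d) ^ (m + 1) / real (m + 1))"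
proof (rule nn_integral_FTC_Icc)
  fix x assume "x \<in> {a..b}"
  have "((\<lambda>x. (x - d) ^ (m + 1) / real (m + 1)) has_real_derivative (real (m + 1) * (x - d) ^ m) / real (m + 1)) (at x)"
  proof (rule DERIV_cdivide)
    have "((\<lambda>x. x - d) has_real_derivative 1) (at x)" by (auto intro!: derivative_eq_intros)
    from DERIV_chain2[OF DERIV_pow[of "m + 1" "x - d"] this]
    show "((\<lambda>x. (x - d) ^ (m + 1)) has_real_derivative (real (m + 1) * (x - d) ^ m)) (at x)" by simp
  qed
  then show "((\<lambda>x. (x - d) ^ (m + 1) / real (m + 1)) has_real_derivative (x - d) ^ m) (at x)"
    by simp
  show "0 \<le> (x - d) ^ m" using assms \<open>x \<in> {a..b}\<close> by simp
qed (use assms in auto)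

text \<open>Both bounds share the leading term \<open>omega m * T ^ (m + 1)\<close>, and their
  difference has the order of the permitted error. The intersection with the space discards
  functions that are not \<open>undefined\<close> beyond the last coordinate.\<close>

lemma volume_bounds:
  assumes "4 < T"
  shows "emeasure (coeff_measure (Suc m)) (salem_region m T \<inter> space (coeff_measure (Suc m))) \<in> {ennreal (omega m * (T - 4) ^ (m + 1)) .. ennreal (omega m * T ^ (m + 1))}"
proof -
  let ?V = "\<integral>\<^sup>+c. indicator (salem_region m T) c \<partial>coeff_measure (Suc m)"
  let ?\<omega> = "real (m + 1) * omega m"
  have gen: "real (m + 1) * omega m * (X / real (m + 1)) = omega m * X" for X by simp
  have w: "?\<omega> \<ge> 0" using omega_pos[of m] by simp
  have b: "(x - 4) ^ m \<le> \<bar>poly (monic m c) x\<bar> \<and> \<bar>poly (monic m c) x\<bar> \<le> x ^ m" if "x > 4" "c \<in> simple_rooted_set m" for x c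
  proof -
    have "simple_rooted m 0 4 (monic m c)" using that(2) by (simp add: simple_rooted_set_def)
    then obtain R where R: "finite R" "card R = m" "R \<subseteq> {0<..<4}" "monic m c = rpoly R"
      unfolding simple_rooted_def by blast
    have "(\<Prod>r\<in>R. x - 4) \<le> (\<Prod>r\<in>R. x - r)" "(\<Prod>r\<in>R. x - r) \<le> (\<Prod>r\<in>R. x)"
      using R(3) that(1) by (intro prod_mono; force)+
    moreover have "(\<Prod>r\<in>R. x - 4) \<ge> 0" using that by (intro prod_nonneg) auto
    ultimately show ?thesis using R by (simp add: poly_rpoly)
  qed
  have lo: "ennreal ((x - 4) ^ m) * ennreal ?\<omega> \<le> root_moment m [x]" if "x > 4" for x
  proof -
    have "ennreal ((x - 4) ^ m) * root_moment m [] = (\<integral>\<^sup>+c. ennreal ((x - 4) ^ m) * (indicator (simple_rooted_set m) c *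
      ennreal (\<Prod>t\<leftarrow>[]. \<bar>poly (monic m c) t\<bar>)) \<partial>coeff_measure m)"
      unfolding root_moment_def by (rule nn_integral_cmult[symmetric, OF measurable_root_moment_integrand])
    also have "\<dots> \<le> root_moment m [x]"
      unfolding root_moment_def using b[OF that] by (intro nn_integral_mono) (auto simp: indicator_def intro!: ennreal_leI)
    finally show ?thesis by (simp only: root_moment_Nil)
  qed
  have hi: "root_moment m [x] \<le> ennreal (x ^ m) * ennreal ?\<omega>" if "x > 4" for x
  proof -
    have "root_moment m [x] \<le> (\<integral>\<^sup>+c. ennreal (x ^ m) * (indicator (simple_rooted_set m) c *
      ennreal (\<Prod>t\<leftarrow>[]. \<bar>poly (monic m c) t\<bar>)) \<partial>coeff_measure m)"
      unfolding root_moment_def using b[OF that] by (intro nn_integral_mono) (auto simp: indicator_def intro!: ennreal_leI)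
    also have "\<dots> = ennreal (x ^ m) * root_moment m []"
      unfolding root_moment_def by (rule nn_integral_cmult[OF measurable_root_moment_integrand])
    finally show ?thesis by (simp only: root_moment_Nil)
  qed
  have ae: "AE x in lborel. x \<noteq> (4 :: real) \<and> x \<noteq> T"
    using AE_lborel_singleton[of 4] AE_lborel_singleton[of T] by eventually_elim auto
  have "ennreal (omega m * (T - 4) ^ (m + 1)) = ennreal ?\<omega> * ennreal ((T - 4) ^ (m + 1) / real (m + 1) - (4 - 4) ^ (m + 1) / real (m + 1))"
    using w assms by (subst ennreal_mult[symmetric]) (simp_all add: gen del: of_nat_Suc of_nat_add)
  also have "\<dots> = (\<integral>\<^sup>+x. ennreal ?\<omega> * (ennreal ((x - 4) ^ m) * indicator {4..T} x) \<partial>lborel)"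
    using assms by (subst nn_integral_cmult) (auto simp: nn_integral_power)
  also have "\<dots> \<le> (\<integral>\<^sup>+x. indicator {4<..<T} x * root_moment m [x] \<partial>lborel)"
    by (rule nn_integral_mono_AE, use ae in eventually_elim) (use lo in \<open>auto simp: indicator_def mult.commute\<close>)
  finally have 1: "ennreal (omega m * (T - 4) ^ (m + 1)) \<le> ?V" by (simp only: volume_salem_region[OF assms])
  have "?V \<le> (\<integral>\<^sup>+x. ennreal ?\<omega> * (ennreal ((x - 0) ^ m) * indicator {0..T} x) \<partial>lborel)"
    unfolding volume_salem_region[OF assms]
    by (rule nn_integral_mono) (use hi in \<open>auto simp: indicator_def mult.commute\<close>)
  also have "\<dots> = ennreal ?\<omega> * ennreal ((T - 0) ^ (m + 1) / real (m + 1) - (0 - 0) ^ (m + 1) / real (m + 1))"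
    using assms by (subst nn_integral_cmult) (auto simp: nn_integral_power[of 0 T 0, simplified])
  also have "\<dots> = ennreal (omega m * T ^ (m + 1))"
    using w assms by (subst ennreal_mult[symmetric]) (simp_all add: gen del: of_nat_Suc of_nat_add)
  finally have 2: "?V \<le> ennreal (omega m * T ^ (m + 1))" .
  have s: "salem_region m T \<inter> space (coeff_measure (Suc m)) \<in> sets (coeff_measure (Suc m))"
    using pred_salem_region[OF assms, of m] by (simp add: pred_def Int_def conj_commute)
  have "?V = (\<integral>\<^sup>+c. indicator (salem_region m T \<inter> space (coeff_measure (Suc m))) c \<partial>coeff_measure (Suc m))"
    by (intro nn_integral_cong) (auto simp: indicator_def)
  also have "\<dots> = emeasure (coeff_measure (Suc m)) (salem_region m T \<inter> space (coeff_measure (Suc m)))"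
    using s by (rule nn_integral_indicator)
  finally show ?thesis using 1 2 by simp
qed

section \<open>Counting lattice points\<close>

text \<open>Unlike \<open>rpoly\<close>, this allows repeated roots, so limits of polynomials with
  simple roots stay representable.\<close>

definition root_poly :: "nat \<Rightarrow> (nat \<Rightarrow> real) \<Rightarrow> real poly" where
  "root_poly n x = (\<Prod>i<n. [:- x i, 1:])"

lemma root_poly_Suc: "root_poly (Suc n) x = [:- x n, 1:] * root_poly n x"
  by (simp add: root_poly_def mult.commute)

lemma poly_root_poly: "poly (root_poly n x) y = (\<Prod>i<n. y - x i)"
  by (simp add: root_poly_def poly_prod)

lemma root_poly_cong: "(\<And>i. i < n \<Longrightarrow> x i = y i) \<Longrightarrow> root_poly n x = root_poly n y"
  unfolding root_poly_def by (rule prod.cong) auto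

lemma root_poly_eq_rpoly: "inj_on x {..<n} \<Longrightarrow> root_poly n x = rpoly (x ` {..<n})"
  by (simp add: root_poly_def rpoly_def prod.reindex)

lemma coeff_linear_mult: "coeff ([:- a, 1:] * p) j = (if j = 0 then 0 else coeff p (j - 1)) - a * coeff p j"
  for a :: "'a::comm_ring_1"
  by (cases j) auto

text \<open>Each linear factor enlarges the coefficients at most by 1 + 4.\<close>

lemma coeff_root_poly_bound:
  assumes "\<And>i. i < m \<Longrightarrow> \<bar>x i\<bar> \<le> 4"
  shows "\<bar>coeff (root_poly m x) j\<bar> \<le> 5 ^ m"
  using assms
proof (induction m arbitrary: j)
  case 0
  then show ?case by (simp add: root_poly_def)
next
  case (Suc m)
  let ?c = "coeff (root_poly m x)"
  have "\<bar>x m * ?c j\<bar> \<le> 4 * 5 ^ m"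
    unfolding abs_mult using Suc by (intro mult_mono) auto
  moreover have "\<bar>if j = 0 then 0 else ?c (j - 1)\<bar> \<le> 5 ^ m" using Suc by auto
  ultimately show ?case unfolding root_poly_Suc coeff_linear_mult by (simp add: abs_if split: if_splits)
qed

text \<open>One more factor turns a bound \<open>L\<close> into 5 L + 5^m \<delta>: four copies of
  \<open>L\<close> from multiplying by the root, one from the shift of coefficients, and the last
  term from moving the new root.\<close>

lemma coeff_root_poly_Lipschitz:
  assumes "\<And>i. i < m \<Longrightarrow> \<bar>x i\<bar> \<le> 4" "\<And>i. i < m \<Longrightarrow> \<bar>y i\<bar> \<le> 4" "\<And>i. i < m \<Longrightarrow> \<bar>x i - y i\<bar> \<le> \<delta>" "\<delta> \<ge> 0"
  shows "\<bar>coeff (root_poly m x) j - coeff (root_poly m y) j\<bar> \<le> real m * 5 ^ m * \<delta>"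
  using assms
proof (induction m arbitrary: j)
  case 0
  then show ?case by (simp add: root_poly_def)
next
  case (Suc m)
  let ?c = "coeff (root_poly m x)" and ?d = "coeff (root_poly m y)"
  let ?L = "real m * 5 ^ m * \<delta>"
  have IH: "\<bar>?c j - ?d j\<bar> \<le> ?L" for j using Suc by auto
  have 1: "\<bar>(x m - y m) * ?c j\<bar> \<le> \<delta> * 5 ^ m"
    unfolding abs_mult using Suc.prems by (intro mult_mono coeff_root_poly_bound) auto
  have 2: "\<bar>y m * (?c j - ?d j)\<bar> \<le> 4 * ?L"
    unfolding abs_mult using Suc.prems IH by (intro mult_mono) auto
  have 3: "\<bar>(if j = 0 then 0 else ?c (j - 1)) - (if j = 0 then 0 else ?d (j - 1))\<bar> \<le> ?L"
    using IH[of "j - 1"] Suc.prems(4) by auto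
  have "coeff (root_poly (Suc m) x) j - coeff (root_poly (Suc m) y) j =
    ((if j = 0 then 0 else ?c (j - 1)) - (if j = 0 then 0 else ?d (j - 1))) - (x m - y m) * ?c j - y m * (?c j - ?d j)"
    unfolding root_poly_Suc coeff_linear_mult by (simp add: algebra_simps)
  then have "\<bar>coeff (root_poly (Suc m) x) j - coeff (root_poly (Suc m) y) j\<bar> \<le> ?L + \<delta> * 5 ^ m + 4 * ?L"
    using 1 2 3 by linarith
  also have "\<dots> \<le> real (Suc m) * 5 ^ Suc m * \<delta>"
    using Suc.prems(4) by (simp add: algebra_simps)
  finally show ?case .
qed

lemma coeff_root_poly_top_bound:
  assumes "\<And>i. i < m \<Longrightarrow> \<bar>x i\<bar> \<le> 4" "\<bar>x m\<bar> \<le> T" "T \<ge> 1"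
  shows "\<bar>coeff (root_poly (Suc m) x) j\<bar> \<le> 2 * 5 ^ m * T"
proof -
  let ?c = "coeff (root_poly m x)"
  have b: "\<bar>?c j\<bar> \<le> 5 ^ m" for j using assms by (intro coeff_root_poly_bound) auto
  have "\<bar>x m * ?c j\<bar> \<le> 5 ^ m * T"
    unfolding abs_mult mult.commute[of "\<bar>x m\<bar>"] using assms b by (intro mult_mono) auto
  moreover have "\<bar>if j = 0 then 0 else ?c (j - 1)\<bar> \<le> 5 ^ m" using b by auto
  moreover have "(5::real) ^ m \<le> 5 ^ m * T" using assms(3) by simp
  ultimately show ?thesis unfolding root_poly_Suc coeff_linear_mult by linarith
qed

text \<open>Multiplication by the large root amplifies an error of order \<delta> in the small roots
  by at most \<open>T\<close>, which \<open>\<delta> * T \<le> 1\<close> compensates; hence a bound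
  independent of \<open>T\<close> although the large root itself moves by up to 1.\<close>

lemma coeff_root_poly_top_Lipschitz:
  assumes "\<And>i. i < m \<Longrightarrow> \<bar>x i\<bar> \<le> 4" "\<And>i. i < m \<Longrightarrow> \<bar>y i\<bar> \<le> 4" "\<And>i. i < m \<Longrightarrow> \<bar>x i - y i\<bar> \<le> \<delta>"
    "\<delta> \<ge> 0" "\<delta> * T \<le> 1" "\<bar>y m\<bar> \<le> T" "\<bar>x m - y m\<bar> \<le> 1" "T \<ge> 1"
  shows "\<bar>coeff (root_poly (Suc m) x) j - coeff (root_poly (Suc m) y) j\<bar> \<le> real (2 * m + 1) * 5 ^ m"
proof -
  let ?c = "coeff (root_poly m x)" and ?d = "coeff (root_poly m y)"
  let ?L = "real m * 5 ^ m * \<delta>"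
  have b: "\<bar>?c j\<bar> \<le> 5 ^ m" for j using assms by (intro coeff_root_poly_bound) auto
  have IH: "\<bar>?c j - ?d j\<bar> \<le> ?L" for j using assms by (intro coeff_root_poly_Lipschitz) auto
  have 1: "\<bar>(x m - y m) * ?c j\<bar> \<le> 1 * 5 ^ m"
    unfolding abs_mult using assms b by (intro mult_mono) auto
  have 2: "\<bar>y m * (?c j - ?d j)\<bar> \<le> T * ?L"
    unfolding abs_mult using assms IH by (intro mult_mono) auto
  have 3: "\<bar>(if j = 0 then 0 else ?c (j - 1)) - (if j = 0 then 0 else ?d (j - 1))\<bar> \<le> ?L"
    using IH[of "j - 1"] assms(4) by auto
  have "T * ?L = real m * 5 ^ m * (\<delta> * T)" by simp
  also have "\<dots> \<le> real m * 5 ^ m * 1" using assms(5) by (intro mult_left_mono) auto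
  finally have 4: "T * ?L \<le> real m * 5 ^ m" by simp
  moreover have "?L \<le> T * ?L" using assms by (intro mult_right_mono[of 1 T, simplified]) auto
  moreover have "coeff (root_poly (Suc m) x) j - coeff (root_poly (Suc m) y) j =
    ((if j = 0 then 0 else ?c (j - 1)) - (if j = 0 then 0 else ?d (j - 1))) - (x m - y m) * ?c j - y m * (?c j - ?d j)"
    unfolding root_poly_Suc coeff_linear_mult by (simp add: algebra_simps)
  ultimately have "\<bar>coeff (root_poly (Suc m) x) j - coeff (root_poly (Suc m) y) j\<bar> \<le> real m * 5 ^ m + 5 ^ m + real m * 5 ^ m"
    using 1 2 3 by linarith
  then show ?thesis by (simp add: algebra_simps)
qed

lemma salem_poly_root_poly:
  assumes "salem_poly m T p"
  obtains x where "p = root_poly (Suc m) x" "\<And>i. i < m \<Longrightarrow> x i \<in> {0<..<4}" "x m \<in> {4<..<T}"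
proof -
  obtain R w where R: "finite R" "card R = m" "R \<subseteq> {0<..<4}" "4 < w" "w < T" "p = [:- w, 1:] * rpoly R"
    using assms unfolding salem_poly_def by blast
  obtain f where f: "bij_betw f {..<m} R"
    using ex_bij_betw_nat_finite[OF R(1)] R(2) by (auto simp: atLeast0LessThan)
  define x where "x = f(m := w)"
  have "root_poly m x = root_poly m f" by (rule root_poly_cong) (auto simp: x_def)
  also have "\<dots> = rpoly R" using f root_poly_eq_rpoly[of f m] by (auto simp: bij_betw_def)
  finally have "p = root_poly (Suc m) x" using R by (simp add: root_poly_Suc x_def)
  moreover have "x i \<in> {0<..<4}" if "i < m" for i
    using R(3) bij_betwE[OF f] that by (auto simp: x_def)
  moreover have "x m \<in> {4<..<T}" using R by (simp add: x_def)
  ultimately show ?thesis using that by blast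
qed

section \<open>Degenerate configurations on the boundary of the region\<close>

lemma convergent_subseq_finite:
  fixes X :: "nat \<Rightarrow> nat \<Rightarrow> real"
  assumes "\<And>k i. i < n \<Longrightarrow> \<bar>X k i\<bar> \<le> B"
  shows "\<exists>r L. strict_mono (r :: nat \<Rightarrow> nat) \<and> (\<forall>i<n. (\<lambda>k. X (r k) i) \<longlonglongrightarrow> L i)"
  using assms
proof (induction n)
  case 0
  show ?case by (intro exI[of _ id]) (auto simp: strict_mono_def)
next
  case (Suc n)
  then obtain r L where r: "strict_mono r" "\<And>i. i < n \<Longrightarrow> (\<lambda>k. X (r k) i) \<longlonglongrightarrow> L i" by fastforce
  have "\<forall>k. X (r k) n \<in> {-B..B}" using Suc.prems[of n] by (auto simp: abs_le_iff minus_le_iff)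
  then obtain l s where s: "strict_mono s" "((\<lambda>k. X (r k) n) \<circ> s) \<longlonglongrightarrow> l"
    using compact_Icc[of "-B" B] unfolding compact_def by meson
  show ?case
  proof (intro exI conjI allI impI)
    show "strict_mono (r \<circ> s)" using r s by (intro strict_mono_o)
    fix i assume "i < Suc n"
    show "(\<lambda>k. X ((r \<circ> s) k) i) \<longlonglongrightarrow> (L(n := l)) i"
    proof (cases "i = n")
      case True
      then show ?thesis using s(2) by (simp add: comp_def)
    next
      case False
      then have "(\<lambda>k. X (r k) i) \<longlonglongrightarrow> L i" using \<open>i < Suc n\<close> r(2) by auto
      from LIMSEQ_subseq_LIMSEQ[OF this s(1)] show ?thesis using False by (simp add: comp_def)
    qed
  qed
qed

text \<open>Each alternative is one equation in the coordinates of a root vector and so lowers the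
  dimension by one; this is the source of the saved factor \<open>T\<close>.\<close>

definition degenerate :: "nat \<Rightarrow> real \<Rightarrow> (nat \<Rightarrow> real) \<Rightarrow> bool" where
  "degenerate m T x \<longleftrightarrow> (\<forall>i<m. x i \<in> {0..4}) \<and> x m \<in> {4..T} \<and>
     ((\<exists>i<m. x i = 0 \<or> x i = 4) \<or> x m = 4 \<or> x m = T \<or> (\<exists>i<m. \<exists>j<m. i \<noteq> j \<and> x i = x j))"

lemma continuous_monic:
  assumes "\<And>i. i < n \<Longrightarrow> continuous_on UNIV (\<lambda>t :: real. f t i :: real)"
  shows "continuous_on UNIV (\<lambda>t. poly (monic n (f t)) y)"
  using assms by (induction n) (auto intro!: continuous_intros)

text \<open>The parameters inside the region form an open set, so it has a frontier point
  \<open>t\<close> outside itself. Root vectors for parameters tending to \<open>t\<close> lie in a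
  bounded box, and a limit of a subsequence is a root vector at \<open>t\<close>. Compactness thus
  replaces any choice of continuous roots.\<close>

lemma segment_meets_degenerate:
  assumes T: "4 < T" and c: "c0 \<in> salem_region m T" "c1 \<notin> salem_region m T"
  shows "\<exists>t x. t \<in> {0..1} \<and> degenerate m T x \<and> monic (Suc m) (\<lambda>i. (1 - t) * c0 i + t * c1 i) = root_poly (Suc m) x"
proof -
  define s where "s t = (\<lambda>i. (1 - t) * c0 i + t * c1 i)" for t
  define A where "A = {t. s t \<in> salem_region m T}"
  have cont: "continuous_on UNIV (\<lambda>t. poly (monic (Suc m) (s t)) y)" for y
    unfolding s_def by (intro continuous_monic continuous_intros)
  have mon: "degree (monic (Suc m) (s t)) = Suc m" "lead_coeff (monic (Suc m) (s t)) = 1" for t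
    by (auto simp del: monic.simps)
  have "A = (\<Union>q :: nat \<Rightarrow> rat. {t. sign_changes m 0 4 (monic (Suc m) (s t)) (\<lambda>i. of_rat (q i))}) \<inter>
     (\<Union>q :: nat \<Rightarrow> rat. {t. sign_changes 1 4 T (monic (Suc m) (s t)) (\<lambda>i. of_rat (q i))})"
    unfolding A_def salem_region_def mem_Collect_eq salem_poly_iff_sign_changes[OF mon T] by auto
  also have "open \<dots>" by (intro open_Int open_UN ballI open_sign_changes cont)
  finally have "open A" .
  have "0 \<in> A" "1 \<notin> A" using c by (auto simp: A_def s_def)
  moreover have "(0 :: real) \<in> {0..1}" "(1 :: real) \<in> {0..1}" by auto
  ultimately have "{0..1} \<inter> A \<noteq> {}" "{0..1} - A \<noteq> {}" by blast+
  then have "{0..1} \<inter> frontier A \<noteq> {}"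
    by (intro connected_Int_frontier) auto
  then obtain t where "t \<in> {0..1} \<inter> frontier A" by blast
  then have t: "t \<in> {0..1}" "t \<in> closure A" "t \<notin> A"
    using \<open>open A\<close> by (auto simp: frontier_def interior_open)
  then obtain u where u: "\<And>k. u k \<in> A" "u \<longlonglongrightarrow> t" unfolding closure_sequential by blast
  have "\<exists>x. monic (Suc m) (s (u k)) = root_poly (Suc m) x \<and> (\<forall>i<m. x i \<in> {0<..<4}) \<and> x m \<in> {4<..<T}" for k
  proof -
    have "salem_poly m T (monic (Suc m) (s (u k)))" using u(1)[of k] by (simp add: A_def salem_region_def)
    then show ?thesis by (rule salem_poly_root_poly) blast
  qed
  then obtain X where X: "\<And>k. monic (Suc m) (s (u k)) = root_poly (Suc m) (X k)"
    "\<And>k i. i < m \<Longrightarrow> X k i \<in> {0<..<4}" "\<And>k. X k m \<in> {4<..<T}"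
    by metis
  have "\<bar>X k i\<bar> \<le> T" if "i < Suc m" for k i
    using X(2)[of i k] X(3)[of k] that T by (cases "i = m") auto
  from convergent_subseq_finite[of "Suc m" X T, OF this]
  obtain r L where r: "strict_mono r" "\<And>i. i < Suc m \<Longrightarrow> (\<lambda>k. X (r k) i) \<longlonglongrightarrow> L i" by blast
  have L: "L i \<in> {0..4}" if "i < m" for i
  proof -
    have "L i \<ge> 0" by (rule LIMSEQ_le_const[OF r(2)]) (use X(2)[OF that] that in \<open>auto intro!: less_imp_le\<close>)
    moreover have "L i \<le> 4" by (rule LIMSEQ_le_const2[OF r(2)]) (use X(2)[OF that] that in \<open>auto intro!: less_imp_le\<close>)
    ultimately show ?thesis by auto
  qed
  have Lm: "L m \<in> {4..T}"
  proof -
    have "L m \<ge> 4" by (rule LIMSEQ_le_const[OF r(2)]) (use X(3) in \<open>auto intro!: less_imp_le\<close>)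
    moreover have "L m \<le> T" by (rule LIMSEQ_le_const2[OF r(2)]) (use X(3) in \<open>auto intro!: less_imp_le\<close>)
    ultimately show ?thesis by auto
  qed
  have "poly (monic (Suc m) (s t)) y = poly (root_poly (Suc m) L) y" for y
  proof (rule LIMSEQ_unique)
    have "(\<lambda>k. u (r k)) \<longlonglongrightarrow> t" using LIMSEQ_subseq_LIMSEQ[OF u(2) r(1)] by (simp add: comp_def)
    then show "(\<lambda>k. poly (monic (Suc m) (s (u (r k)))) y) \<longlonglongrightarrow> poly (monic (Suc m) (s t)) y"
      by (rule continuous_on_tendsto_compose[OF cont]) auto
    show "(\<lambda>k. poly (monic (Suc m) (s (u (r k)))) y) \<longlonglongrightarrow> poly (root_poly (Suc m) L) y"
      unfolding X(1) poly_root_poly by (intro tendsto_prod tendsto_diff tendsto_const r(2)) auto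
  qed
  then have e: "monic (Suc m) (s t) = root_poly (Suc m) L" using poly_eq_poly_eq_iff by blast
  \<comment> \<open>A limit vector in the closed box satisfying none of the equations would have
    distinct roots in the open intervals, and \<open>t\<close> would be an inner parameter.\<close>
  have "degenerate m T L"
  proof (rule ccontr)
    assume n: "\<not> degenerate m T L"
    then have n': "\<not> (\<exists>i<m. L i = 0 \<or> L i = 4)" "L m \<noteq> 4" "L m \<noteq> T" "\<not> (\<exists>i<m. \<exists>j<m. i \<noteq> j \<and> L i = L j)"
      using L Lm unfolding degenerate_def by blast+
    then have inj: "inj_on L {..<m}" unfolding inj_on_def by blast
    have in04: "L i \<in> {0<..<4}" if "i < m" for i using L[OF that] n'(1) that by (auto simp: less_le)
    have Lm': "4 < L m" "L m < T" using n' Lm by auto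
    have "salem_poly m T (monic (Suc m) (s t))"
      unfolding salem_poly_def e root_poly_Suc root_poly_eq_rpoly[OF inj]
      using in04 Lm' card_image[OF inj] by (intro exI[of _ "L ` {..<m}"] exI[of _ "L m"]) auto
    then show False using t(3) by (simp add: A_def salem_region_def)
  qed
  then show ?thesis using t(1) e unfolding s_def by blast
qed

section \<open>Unit cells and the comparison of volume with number of points\<close>

definition lattice_cell :: "nat \<Rightarrow> (nat \<Rightarrow> int) \<Rightarrow> (nat \<Rightarrow> real) set" where
  "lattice_cell n p = PiE {..<n} (\<lambda>i. {of_int (p i)..<of_int (p i) + 1})"

text \<open>Values beyond the last coordinate are fixed, so that a tuple of integers corresponds to
  one function and cardinalities count tuples.\<close>

definition int_vectors :: "nat \<Rightarrow> (nat \<Rightarrow> int) set" where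
  "int_vectors n = PiE {..<n} (\<lambda>_. UNIV)"

definition lattice_points :: "nat \<Rightarrow> real \<Rightarrow> (nat \<Rightarrow> int) set" where
  "lattice_points m T = {p \<in> int_vectors (Suc m). (\<lambda>i. of_int (p i)) \<in> salem_region m T}"

lemma lattice_cell_measure:
  "lattice_cell n p \<in> sets (coeff_measure n)" "emeasure (coeff_measure n) (lattice_cell n p) = 1"
proof -
  show "lattice_cell n p \<in> sets (coeff_measure n)"
    unfolding lattice_cell_def coeff_measure_def by (intro sets_PiM_I_finite) auto
  show "emeasure (coeff_measure n) (lattice_cell n p) = 1"
    unfolding lattice_cell_def coeff_measure_def by (subst lb.emeasure_PiM) auto
qed

lemma lattice_cell_cover:
  assumes "c \<in> space (coeff_measure n)"
  obtains p where "p \<in> int_vectors n" "c \<in> lattice_cell n p"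
proof (rule that)
  show "(\<lambda>i\<in>{..<n}. \<lfloor>c i\<rfloor>) \<in> int_vectors n" by (simp add: int_vectors_def)
  show "c \<in> lattice_cell n (\<lambda>i\<in>{..<n}. \<lfloor>c i\<rfloor>)"
    using assms unfolding lattice_cell_def coeff_measure_def space_PiM by (auto simp: PiE_iff)
qed

text \<open>The sides are half-open, so the cell of a point is recovered from the floors of its
  coordinates.\<close>

lemma lattice_cell_disjoint: "disjoint_family_on (lattice_cell n) (int_vectors n)"
proof (unfold disjoint_family_on_def, intro ballI impI, rule ccontr)
  fix p q assume pq: "p \<in> int_vectors n" "q \<in> int_vectors n" "p \<noteq> q" "lattice_cell n p \<inter> lattice_cell n q \<noteq> {}"
  then obtain c where c: "c \<in> lattice_cell n p" "c \<in> lattice_cell n q" by blast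
  have "p i = q i" if "i < n" for i
  proof -
    have "c i \<in> {of_int (p i)..<of_int (p i) + 1}" "c i \<in> {of_int (q i)..<of_int (q i) + 1}"
      using c that by (auto simp: lattice_cell_def PiE_iff)
    then have "\<lfloor>c i\<rfloor> = p i" "\<lfloor>c i\<rfloor> = q i" by (auto simp: floor_eq_iff)
    then show ?thesis by simp
  qed
  then have "p = q" using pq(1,2) unfolding int_vectors_def by (intro PiE_ext) auto
  with pq(3) show False by blast
qed

text \<open>Both the volume and \<open>card L\<close> lie between the number of cells inside
  \<open>S\<close> and the number of cells touching \<open>S\<close>; these differ by the number of
  cells counted in \<open>bad\<close>.\<close>

lemma lattice_count_discrepancy:
  assumes S: "S \<in> sets (coeff_measure n)"
    and touch: "finite {p \<in> int_vectors n. lattice_cell n p \<inter> S \<noteq> {}}"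
    and L: "L \<subseteq> {p \<in> int_vectors n. lattice_cell n p \<inter> S \<noteq> {}}"
    and good: "{p \<in> int_vectors n. lattice_cell n p \<subseteq> S} \<subseteq> L"
    and bad: "card {p \<in> int_vectors n. lattice_cell n p \<inter> S \<noteq> {} \<and> \<not> lattice_cell n p \<subseteq> S} \<le> N"
  shows "emeasure (coeff_measure n) S \<le> of_nat (card L + N)" "of_nat (card L) \<le> emeasure (coeff_measure n) S + of_nat N"
proof -
  let ?T = "{p \<in> int_vectors n. lattice_cell n p \<inter> S \<noteq> {}}"
  let ?G = "{p \<in> int_vectors n. lattice_cell n p \<subseteq> S}"
  let ?B = "{p \<in> int_vectors n. lattice_cell n p \<inter> S \<noteq> {} \<and> \<not> lattice_cell n p \<subseteq> S}"
  have fin: "finite L" "finite ?G" "finite ?B"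
    using finite_subset[OF L touch] finite_subset[OF good] finite_subset[OF _ touch, of ?B] by auto
  have T: "?T \<subseteq> L \<union> ?B" using good by auto
  have "card ?T \<le> card (L \<union> ?B)" using T fin by (intro card_mono) auto
  also have "\<dots> \<le> card L + card ?B" by (rule card_Un_le)
  finally have cT: "card ?T \<le> card L + N" using bad by linarith
  have "S \<subseteq> (\<Union>p\<in>?T. lattice_cell n p)"
  proof
    fix c assume "c \<in> S"
    then have "c \<in> space (coeff_measure n)" using sets.sets_into_space[OF S] by auto
    then obtain p where "p \<in> int_vectors n" "c \<in> lattice_cell n p" by (rule lattice_cell_cover)
    then show "c \<in> (\<Union>p\<in>?T. lattice_cell n p)" using \<open>c \<in> S\<close> by blast
  qed
  then have "emeasure (coeff_measure n) S \<le> emeasure (coeff_measure n) (\<Union>p\<in>?T. lattice_cell n p)"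
    using touch by (intro emeasure_mono sets.finite_UN) (auto simp: lattice_cell_measure)
  also have "\<dots> \<le> (\<Sum>p\<in>?T. emeasure (coeff_measure n) (lattice_cell n p))"
    using touch by (intro emeasure_subadditive_finite) (auto simp: lattice_cell_measure)
  also have "\<dots> = of_nat (card ?T)" by (simp add: lattice_cell_measure)
  also have "\<dots> \<le> of_nat (card L + N)" using cT by (intro of_nat_mono)
  finally show "emeasure (coeff_measure n) S \<le> of_nat (card L + N)" .
  have "L \<subseteq> ?G \<union> ?B" using L by auto
  then have "card L \<le> card (?G \<union> ?B)" using fin by (intro card_mono) auto
  also have "\<dots> \<le> card ?G + card ?B" by (rule card_Un_le)
  finally have cL: "card L \<le> card ?G + N" using bad by linarith
  have "of_nat (card ?G) = (\<Sum>p\<in>?G. emeasure (coeff_measure n) (lattice_cell n p))" by (simp add: lattice_cell_measure)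
  also have "\<dots> = emeasure (coeff_measure n) (\<Union>p\<in>?G. lattice_cell n p)"
    by (rule sum_emeasure) (use fin lattice_cell_measure in \<open>auto intro: disjoint_family_on_mono[OF _ lattice_cell_disjoint]\<close>)
  also have "\<dots> \<le> emeasure (coeff_measure n) S" using S by (intro emeasure_mono) auto
  finally have G: "of_nat (card ?G) \<le> emeasure (coeff_measure n) S" .
  have "(of_nat (card L) :: ennreal) \<le> of_nat (card ?G + N)" using cL by (rule of_nat_mono)
  also have "\<dots> = of_nat (card ?G) + of_nat N" by simp
  also have "\<dots> \<le> emeasure (coeff_measure n) S + of_nat N" using G by (intro add_mono) auto
  finally show "of_nat (card L) \<le> emeasure (coeff_measure n) S + of_nat N" .
qed

text \<open>Forgetting coordinate \<open>i\<close> is injective on \<open>F\<close>. The hypothesis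
  \<open>det\<close> covers a prescribed coordinate as well as a coordinate equal to another
  one.\<close>

lemma card_face:
  fixes F :: "('a \<Rightarrow> 'b) set"
  assumes "finite I" "i \<in> I" "finite A" "F \<subseteq> PiE I (\<lambda>_. A)"
    and det: "\<And>z w. z \<in> F \<Longrightarrow> w \<in> F \<Longrightarrow> (\<And>j. j \<in> I \<Longrightarrow> j \<noteq> i \<Longrightarrow> z j = w j) \<Longrightarrow> z i = w i"
  shows "card F \<le> card A ^ (card I - 1)"
proof -
  let ?r = "\<lambda>z. restrict z (I - {i})"
  have "inj_on ?r F"
  proof (rule inj_onI)
    fix z w assume zw: "z \<in> F" "w \<in> F" "?r z = ?r w"
    have e: "z j = w j" if "j \<in> I" "j \<noteq> i" for j
      using fun_cong[OF zw(3), of j] that by simp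
    then have "z i = w i" using det zw by blast
    with e have "z j = w j" if "j \<in> I" for j using that by (cases "j = i") auto
    then show "z = w" using zw(1,2) assms(4) by (intro PiE_ext[of z I "\<lambda>_. A" w]) auto
  qed
  moreover have "?r ` F \<subseteq> PiE (I - {i}) (\<lambda>_. A)" by (auto dest!: subsetD[OF assms(4)] simp: PiE_iff split: if_splits)
  ultimately have "card F \<le> card (PiE (I - {i}) (\<lambda>_. A))"
    using assms by (intro card_inj_on_le[of ?r]) (auto intro: finite_PiE)
  also have "\<dots> = card A ^ (card I - 1)" using assms by (simp add: card_PiE)
  finally show ?thesis .
qed

lemma card_int_box:
  fixes w :: "nat \<Rightarrow> real"
  assumes "D \<ge> 0"
  shows "finite {p \<in> int_vectors n. \<forall>i<n. \<bar>of_int (p i) - w i\<bar> \<le> D}"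
    "real (card {p \<in> int_vectors n. \<forall>i<n. \<bar>of_int (p i) - w i\<bar> \<le> D}) \<le> (2 * D + 1) ^ n"
proof -
  let ?A = "\<lambda>i. {\<lceil>w i - D\<rceil>..\<lfloor>w i + D\<rfloor>}"
  have sub: "{p \<in> int_vectors n. \<forall>i<n. \<bar>of_int (p i) - w i\<bar> \<le> D} \<subseteq> PiE {..<n} ?A"
    by (auto simp: int_vectors_def PiE_iff abs_le_iff ceiling_le_iff le_floor_iff extensional_def algebra_simps)
  have fin: "finite (PiE {..<n} ?A)" by (intro finite_PiE) auto
  show "finite {p \<in> int_vectors n. \<forall>i<n. \<bar>of_int (p i) - w i\<bar> \<le> D}" using finite_subset[OF sub fin] .
  have "real (card {p \<in> int_vectors n. \<forall>i<n. \<bar>of_int (p i) - w i\<bar> \<le> D}) \<le> real (card (PiE {..<n} ?A))"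
    using card_mono[OF fin sub] by simp
  also have "\<dots> = (\<Prod>i<n. real (nat (\<lfloor>w i + D\<rfloor> - \<lceil>w i - D\<rceil> + 1)))"
    by (simp add: card_PiE)
  also have "\<dots> \<le> (\<Prod>i<n. 2 * D + 1)"
  proof (rule prod_mono, safe)
    fix i
    have "real_of_int (\<lfloor>w i + D\<rfloor> - \<lceil>w i - D\<rceil> + 1) \<le> 2 * D + 1"
      using of_int_floor_le[of "w i + D"] le_of_int_ceiling[of "w i - D"] by linarith
    then show "real (nat (\<lfloor>w i + D\<rfloor> - \<lceil>w i - D\<rceil> + 1)) \<le> 2 * D + 1"
      using assms by (cases "0 \<le> \<lfloor>w i + D\<rfloor> - \<lceil>w i - D\<rceil> + 1") simp_all
  qed simp
  also have "\<dots> = (2 * D + 1) ^ n" by simp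
  finally show "real (card {p \<in> int_vectors n. \<forall>i<n. \<bar>of_int (p i) - w i\<bar> \<le> D}) \<le> (2 * D + 1) ^ n" .
qed

text \<open>The integers \<open>z i\<close> with \<open>i < m\<close> stand for small roots \<open>z i / \<lceil>T\<rceil>\<close>, and \<open>z m\<close> for the large root.\<close>

definition grid :: "nat \<Rightarrow> real \<Rightarrow> (nat \<Rightarrow> int) set" where
  "grid m T = {z \<in> PiE {..<Suc m} (\<lambda>_. {0..4 * \<lceil>T\<rceil>}).
     (\<exists>i<Suc m. z i \<in> {0, 4, 4 * \<lceil>T\<rceil>, \<lfloor>T\<rfloor>}) \<or> (\<exists>i<m. \<exists>j<m. i \<noteq> j \<and> z i = z j)}"

text \<open>There are at most 4 (m + 1) faces with a prescribed value and at most m^2 diagonals, and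
  each contains at most (4 \<lceil>T\<rceil> + 1)^m points. The 9 comes from 4 (T + 1) + 1 \<le> 9
  T.\<close>

lemma card_grid:
  assumes "T \<ge> 1"
  shows "finite (grid m T)" "real (card (grid m T)) \<le> real (4 * Suc m + m\<^sup>2) * (9 * T) ^ m"
proof -
  let ?A = "{0..4 * \<lceil>T\<rceil>}"
  let ?P = "PiE {..<Suc m} (\<lambda>_. ?A)"
  let ?V = "{0, 4, 4 * \<lceil>T\<rceil>, \<lfloor>T\<rfloor>}"
  define F where "F i v = {z \<in> ?P. z i = v}" for i v
  define E where "E i j = {z \<in> ?P. z i = z j}" for i j
  have finP: "finite ?P" by (intro finite_PiE) auto
  show "finite (grid m T)" by (rule finite_subset[OF _ finP]) (auto simp: grid_def)
  have F: "card (F i v) \<le> card ?A ^ m" if "i < Suc m" for i v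
    using card_face[of "{..<Suc m}" i ?A "F i v"] that by (auto simp: F_def)
  have E: "card (E i j) \<le> card ?A ^ m" if "i < m" "j < m" "i \<noteq> j" for i j
    using card_face[of "{..<Suc m}" i ?A "E i j"] that by (auto simp: E_def)
  let ?I = "{..<Suc m} \<times> ?V" and ?J = "{(i, j). i < m \<and> j < m \<and> i \<noteq> j}"
  have J: "?J \<subseteq> {..<m} \<times> {..<m}" by auto
  then have finJ: "finite ?J" by (rule finite_subset) auto
  have cJ: "card ?J \<le> m\<^sup>2" using card_mono[OF _ J] by (simp add: power2_eq_square)
  have "card ?V \<le> 4"
    using card_length[of "[0, 4, 4 * \<lceil>T\<rceil>, \<lfloor>T\<rfloor>]"] by simp
  then have cI: "card ?I \<le> 4 * Suc m" 
    unfolding card_cartesian_product card_lessThan mult.commute[of "Suc m"] by (rule mult_le_mono1)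
  have "grid m T \<subseteq> (\<Union>(i, v)\<in>?I. F i v) \<union> (\<Union>(i, j)\<in>?J. E i j)"
    unfolding grid_def F_def E_def by blast
  then have "card (grid m T) \<le> card ((\<Union>(i, v)\<in>?I. F i v) \<union> (\<Union>(i, j)\<in>?J. E i j))"
    by (intro card_mono finite_subset[OF _ finP]) (auto simp: F_def E_def)
  also have "\<dots> \<le> card (\<Union>(i, v)\<in>?I. F i v) + card (\<Union>(i, j)\<in>?J. E i j)" by (rule card_Un_le)
  also have "\<dots> \<le> (\<Sum>(i, v)\<in>?I. card (F i v)) + (\<Sum>(i, j)\<in>?J. card (E i j))"
    using finJ by (intro add_mono order_trans[OF card_UN_le]) (auto simp: split_beta)
  also have "\<dots> \<le> (\<Sum>(i, v)\<in>?I. card ?A ^ m) + (\<Sum>(i, j)\<in>?J. card ?A ^ m)"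
    using F E by (intro add_mono sum_mono) auto
  also have "\<dots> = (card ?I + card ?J) * card ?A ^ m" by (simp add: split_beta algebra_simps)
  also have "\<dots> \<le> (4 * Suc m + m\<^sup>2) * card ?A ^ m" using cI cJ by (intro mult_right_mono) auto
  finally have "real (card (grid m T)) \<le> real ((4 * Suc m + m\<^sup>2) * card ?A ^ m)" by (rule of_nat_mono)
  also have "\<dots> = real (4 * Suc m + m\<^sup>2) * real (card ?A) ^ m" by simp
  also have "\<dots> \<le> real (4 * Suc m + m\<^sup>2) * (9 * T) ^ m"
  proof (intro mult_left_mono power_mono)
    have "real_of_int \<lceil>T\<rceil> \<le> T + 1" by linarith
    moreover have "\<lceil>T\<rceil> \<ge> 1" using assms by linarith
    then have "real (card ?A) = 4 * real_of_int \<lceil>T\<rceil> + 1" by simp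
    ultimately show "real (card ?A) \<le> 9 * T" using assms by linarith
  qed auto
  finally show "real (card (grid m T)) \<le> real (4 * Suc m + m\<^sup>2) * (9 * T) ^ m" .
qed

text \<open>All small roots are rounded down by the same map, so equal roots stay equal and endpoint
  values go to the values listed in \<open>grid\<close>: degeneracy survives rounding.\<close>

lemma grid_approximation:
  assumes T: "T \<ge> 4" and x: "degenerate m T x"
  shows "\<exists>z\<in>grid m T. \<forall>j. \<bar>coeff (root_poly (Suc m) x) j -
     coeff (root_poly (Suc m) (\<lambda>i. if i < m then of_int (z i) / of_int \<lceil>T\<rceil> else of_int (z i))) j\<bar> \<le> real (2 * m + 1) * 5 ^ m"
proof -
  let ?k = "\<lceil>T\<rceil>"
  have k: "real_of_int ?k \<ge> T" "real_of_int ?k > 0" "?k \<ge> 4" using T by linarith+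
  have kn: "?k \<noteq> 0" using k(3) by linarith
  define z where "z = (\<lambda>i\<in>{..<Suc m}. if i < m then \<lfloor>x i * ?k\<rfloor> else \<lfloor>x i\<rfloor>)"
  define y :: "nat \<Rightarrow> real" where "y i = (if i < m then of_int (z i) / of_int ?k else of_int (z i))" for i
  have xi: "0 \<le> x i" "x i \<le> 4" if "i < m" for i using x that unfolding degenerate_def by auto
  have xm: "4 \<le> x m" "x m \<le> T" using x unfolding degenerate_def by auto
  have zi: "z i = \<lfloor>x i * ?k\<rfloor>" if "i < m" for i using that by (simp add: z_def)
  have zm: "z m = \<lfloor>x m\<rfloor>" by (simp add: z_def)
  have range: "z i \<in> {0..4 * ?k}" if "i < Suc m" for i
  proof (cases "i = m")
    case True
    have "\<lfloor>x m\<rfloor> \<le> \<lfloor>T\<rfloor>" using xm by (intro floor_mono)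
    also have "\<dots> \<le> 4 * ?k" using k(3) floor_le_ceiling[of T] by linarith
    finally show ?thesis using True zm xm by (simp add: le_floor_iff)
  next
    case False
    then have i: "i < m" using that by simp
    have "x i * ?k \<le> 4 * real_of_int ?k" using xi[OF i] k by (intro mult_right_mono) auto
    then have "\<lfloor>x i * ?k\<rfloor> \<le> \<lfloor>real_of_int (4 * ?k)\<rfloor>" by (intro floor_mono) simp
    then have "\<lfloor>x i * ?k\<rfloor> \<le> 4 * ?k" by (simp only: floor_of_int)
    moreover have "0 \<le> x i * ?k" using xi[OF i] k by simp
    ultimately show ?thesis using zi[OF i] by simp
  qed
  have "z \<in> grid m T"
  proof -
    have "z \<in> PiE {..<Suc m} (\<lambda>_. {0..4 * ?k})" using range by (auto simp: PiE_iff z_def)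
    \<comment> \<open>A small root 0 or 4 becomes 0 or \<open>4 * \<lceil>T\<rceil>\<close>, a large
      root 4 or \<open>T\<close> becomes 4 or \<open>\<lfloor>T\<rfloor>\<close>. The grid does not
      ask which kind of coordinate takes which value; this costs only a constant.\<close>
    moreover have "(\<exists>i<Suc m. z i \<in> {0, 4, 4 * ?k, \<lfloor>T\<rfloor>}) \<or> (\<exists>i<m. \<exists>j<m. i \<noteq> j \<and> z i = z j)"
    proof -
      consider i where "i < m" "x i = 0 \<or> x i = 4" | "x m = 4 \<or> x m = T" | i j where "i < m" "j < m" "i \<noteq> j" "x i = x j"
        using x unfolding degenerate_def by blast
      then show ?thesis
      proof cases
        case 1
        have "\<lfloor>4 * real_of_int ?k\<rfloor> = 4 * ?k" by linarith
        then have "z i \<in> {0, 4, 4 * ?k, \<lfloor>T\<rfloor>}" using 1 zi by auto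
        then show ?thesis using 1 less_SucI by blast
      next
        case 2
        then have "z m \<in> {0, 4, 4 * ?k, \<lfloor>T\<rfloor>}" using zm by auto
        then show ?thesis by blast
      next
        case 3
        then show ?thesis using zi by metis
      qed
    qed
    ultimately show ?thesis by (simp add: grid_def)
  qed
  moreover have "\<bar>coeff (root_poly (Suc m) x) j - coeff (root_poly (Suc m) y) j\<bar> \<le> real (2 * m + 1) * 5 ^ m" for j
  proof (rule coeff_root_poly_top_Lipschitz[where \<delta> = "1 / of_int ?k" and T = T])
    fix i assume i: "i < m"
    show "\<bar>x i\<bar> \<le> 4" using xi[OF i] by auto
    have r: "real_of_int (z i) \<ge> 0" "real_of_int (z i) \<le> 4 * of_int ?k" using range[of i] i by auto
    then show "\<bar>y i\<bar> \<le> 4" using i k by (auto simp: y_def field_simps)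
    have "\<bar>x i * ?k - z i\<bar> \<le> 1" unfolding zi[OF i] by linarith
    then have "\<bar>x i * ?k - z i\<bar> / ?k \<le> 1 / ?k" using k by (intro divide_right_mono) auto
    also have "\<bar>x i * ?k - z i\<bar> / ?k = \<bar>(x i * ?k - z i) / ?k\<bar>" using k by (simp add: abs_divide)
    also have "(x i * ?k - z i) / ?k = x i - y i" using kn i by (simp add: y_def diff_divide_distrib)
    finally show "\<bar>x i - y i\<bar> \<le> 1 / of_int ?k" .
  next
    show "1 / real_of_int ?k * T \<le> 1" using k T by (simp add: field_simps)
    have "\<lfloor>x m\<rfloor> \<ge> 0" "real_of_int \<lfloor>x m\<rfloor> \<le> x m" using xm by auto
    then have "\<bar>real_of_int \<lfloor>x m\<rfloor>\<bar> \<le> T" using xm by linarith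
    then show "\<bar>y m\<bar> \<le> T" using zm by (simp add: y_def)
    show "\<bar>x m - y m\<bar> \<le> 1" using zm by (simp add: y_def) linarith
  qed (use k T in auto)
  moreover have "y = (\<lambda>i. if i < m then of_int (z i) / of_int \<lceil>T\<rceil> else of_int (z i))"
    by (simp add: y_def fun_eq_iff)
  ultimately show ?thesis by auto
qed

section \<open>The number of lattice points in the region\<close>

lemma salem_region_cong:
  assumes "\<And>i. i < Suc m \<Longrightarrow> c i = d i"
  shows "c \<in> salem_region m T \<longleftrightarrow> d \<in> salem_region m T"
  unfolding salem_region_def mem_Collect_eq by (subst monic_cong[OF assms]) auto

lemma coeff_monic_rev: "i < Suc m \<Longrightarrow> coeff (monic (Suc m) c) (m - i) = c i"
  using coeff_monic[of i "Suc m" c] by simp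

lemma salem_region_bound:
  assumes "c \<in> salem_region m T" "i < Suc m" "T \<ge> 4"
  shows "\<bar>c i\<bar> \<le> 2 * 5 ^ m * T"
proof -
  obtain x where x: "monic (Suc m) c = root_poly (Suc m) x" "\<And>i. i < m \<Longrightarrow> x i \<in> {0<..<4}" "x m \<in> {4<..<T}"
    using salem_poly_root_poly[of m T "monic (Suc m) c"] assms(1) unfolding salem_region_def by blast
  have "\<bar>coeff (root_poly (Suc m) x) (m - i)\<bar> \<le> 2 * 5 ^ m * T"
  proof (rule coeff_root_poly_top_bound)
    show "\<bar>x i\<bar> \<le> 4" if "i < m" for i using x(2)[OF that] by auto
  qed (use x(3) assms(3) in auto)
  then show ?thesis using coeff_monic_rev[OF assms(2), of c] x(1) by simp
qed

lemma lattice_cell_imp_close: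
  assumes "c \<in> lattice_cell n p" "i < n"
  shows "of_int (p i) \<le> c i" "c i \<le> of_int (p i) + 1"
proof -
  have "c i \<in> {of_int (p i)..<of_int (p i) + 1}" using assms unfolding lattice_cell_def by (auto simp: PiE_iff)
  then show "of_int (p i) \<le> c i" "c i \<le> of_int (p i) + 1" by auto
qed

lemma lattice_points_bounds:
  "\<exists>C\<ge>0. \<forall>T>4. finite (lattice_points m T) \<and>
     omega m * (T - 4) ^ (m + 1) - C * T ^ m \<le> real (card (lattice_points m T)) \<and>
     real (card (lattice_points m T)) \<le> omega m * T ^ (m + 1) + C * T ^ m"
proof -
  define n where "n = Suc m"
  define K :: real where "K = real (2 * m + 1) * 5 ^ m"
  have K: "K \<ge> 0" by (simp add: K_def)
  \<comment> \<open>The bound of \<open>card_grid\<close> without its power of \<open>T\<close>,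
    times the number of integer points that a single grid polynomial can account for.\<close>
  define C where "C = real (4 * Suc m + m\<^sup>2) * 9 ^ m * (2 * (K + 1) + 1) ^ n + 1"
  have C: "C \<ge> 1" using K by (simp add: C_def)
  have "finite (lattice_points m T) \<and>
     omega m * (T - 4) ^ (m + 1) - C * T ^ m \<le> real (card (lattice_points m T)) \<and>
     real (card (lattice_points m T)) \<le> omega m * T ^ (m + 1) + C * T ^ m" if T: "T > 4" for T
  proof -
    define S where "S = salem_region m T \<inter> space (coeff_measure n)"
    let ?L = "lattice_points m T"
    let ?touch = "{p \<in> int_vectors n. lattice_cell n p \<inter> S \<noteq> {}}"
    let ?bad = "{p \<in> int_vectors n. lattice_cell n p \<inter> S \<noteq> {} \<and> \<not> lattice_cell n p \<subseteq> S}"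
    have S: "S \<in> sets (coeff_measure n)"
      using pred_salem_region[OF T, of m] by (simp add: pred_def Int_def conj_commute S_def n_def)
    have cell_space: "lattice_cell n p \<subseteq> space (coeff_measure n)" for p
      using sets.sets_into_space[OF lattice_cell_measure(1)] .
    \<comment> \<open>An integer point is a corner of its own cell. Hence the lattice points of the
      region include all cells inside it and occur only among the cells touching it.\<close>
    have corner: "(\<lambda>i\<in>{..<n}. of_int (p i)) \<in> lattice_cell n p" for p
      by (auto simp: lattice_cell_def)
    have corner_iff: "(\<lambda>i\<in>{..<n}. of_int (p i)) \<in> salem_region m T \<longleftrightarrow> (\<lambda>i. of_int (p i)) \<in> salem_region m T" for p :: "nat \<Rightarrow> int"
      by (rule salem_region_cong) (simp add: n_def)
    have touch: "?L \<subseteq> ?touch"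
    proof
      fix p assume p: "p \<in> ?L"
      then have "(\<lambda>i\<in>{..<n}. of_int (p i)) \<in> S"
        using corner[of p] cell_space[of p] corner_iff[of p] unfolding S_def lattice_points_def by blast
      then show "p \<in> ?touch" using corner[of p] p unfolding lattice_points_def n_def by blast
    qed
    have good: "{p \<in> int_vectors n. lattice_cell n p \<subseteq> S} \<subseteq> ?L"
      using corner corner_iff unfolding S_def lattice_points_def n_def by blast
    have fin_touch: "finite ?touch"
    proof (rule finite_subset)
      show "?touch \<subseteq> {p \<in> int_vectors n. \<forall>i<n. \<bar>of_int (p i) - 0\<bar> \<le> 2 * 5 ^ m * T + 1}"
      proof (rule subsetI)
        fix p assume "p \<in> ?touch"
        then have p: "p \<in> int_vectors n" "lattice_cell n p \<inter> S \<noteq> {}" by auto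
        then obtain c where c: "c \<in> lattice_cell n p" "c \<in> salem_region m T" unfolding S_def by blast
        have "\<bar>of_int (p i) - 0\<bar> \<le> 2 * 5 ^ m * T + 1" if "i < n" for i
          using salem_region_bound[OF c(2), of i] lattice_cell_imp_close[OF c(1) that] that T
          unfolding n_def by linarith
        then show "p \<in> {p \<in> int_vectors n. \<forall>i<n. \<bar>of_int (p i) - 0\<bar> \<le> 2 * 5 ^ m * T + 1}" using p by blast
      qed
      show "finite {p \<in> int_vectors n. \<forall>i<n. \<bar>of_int (p i) - 0\<bar> \<le> 2 * 5 ^ m * T + 1}"
        using T by (intro card_int_box(1)) auto
    qed
    define w where "w z i = coeff (root_poly (Suc m) (\<lambda>i. if i < m then of_int (z i) / of_int \<lceil>T\<rceil> else of_int (z i))) (m - i)"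
      for z :: "nat \<Rightarrow> int" and i
    let ?box = "\<lambda>z. {p \<in> int_vectors n. \<forall>i<n. \<bar>of_int (p i) - w z i\<bar> \<le> K + 1}"
    have bad: "?bad \<subseteq> (\<Union>z\<in>grid m T. ?box z)"
    proof (rule subsetI)
      fix p assume "p \<in> ?bad"
      then have p: "p \<in> int_vectors n" "lattice_cell n p \<inter> S \<noteq> {}" "\<not> lattice_cell n p \<subseteq> S" by auto
      obtain c0 c1 where c: "c0 \<in> lattice_cell n p" "c0 \<in> salem_region m T" "c1 \<in> lattice_cell n p" "c1 \<notin> salem_region m T"
        using p cell_space[of p] unfolding S_def by blast
      obtain t x where t: "t \<in> {0..1}" "degenerate m T x" "monic (Suc m) (\<lambda>i. (1 - t) * c0 i + t * c1 i) = root_poly (Suc m) x"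
        using segment_meets_degenerate[OF T c(2,4)] by blast
      obtain z where z: "z \<in> grid m T" "\<And>j. \<bar>coeff (root_poly (Suc m) x) j -
         coeff (root_poly (Suc m) (\<lambda>i. if i < m then of_int (z i) / of_int \<lceil>T\<rceil> else of_int (z i))) j\<bar> \<le> K"
        using grid_approximation[OF less_imp_le[OF T] t(2)] unfolding K_def by blast
      \<comment> \<open>Cells are convex, so the degenerate polynomial on the segment is still
        within 1 of \<open>p\<close> in every coordinate; rounding its roots costs another
        \<open>K\<close>.\<close>
      have "\<bar>of_int (p i) - w z i\<bar> \<le> K + 1" if i: "i < n" for i
      proof -
        let ?c = "(1 - t) * c0 i + t * c1 i"
        have "?c = coeff (root_poly (Suc m) x) (m - i)"
          using coeff_monic_rev[of i m "\<lambda>i. (1 - t) * c0 i + t * c1 i"] i t(3) by (simp add: n_def)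
        then have 1: "\<bar>?c - w z i\<bar> \<le> K" using z(2)[of "m - i"] by (simp add: w_def)
        have "(1 - t) * of_int (p i) + t * of_int (p i) \<le> ?c"
          using t(1) lattice_cell_imp_close[OF c(1) i] lattice_cell_imp_close[OF c(3) i] by (intro add_mono mult_left_mono) auto
        then have 2: "of_int (p i) \<le> ?c" by (simp add: algebra_simps)
        have "?c \<le> (1 - t) * (of_int (p i) + 1) + t * (of_int (p i) + 1)"
          using t(1) lattice_cell_imp_close[OF c(1) i] lattice_cell_imp_close[OF c(3) i] by (intro add_mono mult_left_mono) auto
        then have 3: "?c \<le> of_int (p i) + 1" by (simp add: algebra_simps)
        show ?thesis using 1 2 3 by linarith
      qed
      then show "p \<in> (\<Union>z\<in>grid m T. ?box z)" using z(1) p(1) by blast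
    qed
    have grid: "finite (grid m T)" "real (card (grid m T)) \<le> real (4 * Suc m + m\<^sup>2) * (9 * T) ^ m"
      using card_grid[of T m] T by auto
    have finb: "finite (?box z)" "real (card (?box z)) \<le> (2 * (K + 1) + 1) ^ n" for z
      using card_int_box[of "K + 1" n "w z"] K by auto
    have "card ?bad \<le> card (\<Union>z\<in>grid m T. ?box z)"
      by (rule card_mono[OF finite_UN_I[OF grid(1) finb(1)] bad])
    also have "\<dots> \<le> (\<Sum>z\<in>grid m T. card (?box z))" by (rule card_UN_le[OF grid(1)])
    finally have "real (card ?bad) \<le> (\<Sum>z\<in>grid m T. real (card (?box z)))"
      by (simp only: of_nat_sum[symmetric] of_nat_le_iff)
    also have "\<dots> \<le> (\<Sum>z\<in>grid m T. (2 * (K + 1) + 1) ^ n)" using finb by (intro sum_mono) auto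
    also have "\<dots> = real (card (grid m T)) * (2 * (K + 1) + 1) ^ n" by simp
    also have "\<dots> \<le> (real (4 * Suc m + m\<^sup>2) * (9 * T) ^ m) * (2 * (K + 1) + 1) ^ n"
      using grid(2) K by (intro mult_right_mono) auto
    also have "\<dots> = (C - 1) * T ^ m" by (simp add: C_def power_mult_distrib)
    finally have b: "real (card ?bad) \<le> (C - 1) * T ^ m" .
    define N where "N = card ?bad"
    have N: "real N \<le> C * T ^ m"
    proof -
      have "(C - 1) * T ^ m \<le> C * T ^ m" using T by (intro mult_right_mono) auto
      then show ?thesis using b by (simp add: N_def)
    qed
    from lattice_count_discrepancy[OF S fin_touch touch good, of N]
    have d: "emeasure (coeff_measure n) S \<le> of_nat (card ?L + N)" "of_nat (card ?L) \<le> emeasure (coeff_measure n) S + of_nat N"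
      by (auto simp: N_def)
    have v: "ennreal (omega m * (T - 4) ^ (m + 1)) \<le> emeasure (coeff_measure n) S"
      "emeasure (coeff_measure n) S \<le> ennreal (omega m * T ^ (m + 1))"
      using volume_bounds[OF T, of m] by (auto simp: S_def n_def)
    have w: "omega m * T ^ (m + 1) \<ge> 0" using omega_pos[of m] T by simp
    have "ennreal (omega m * (T - 4) ^ (m + 1)) \<le> of_nat (card ?L + N)" using v(1) d(1) by (rule order_trans)
    then have lo: "omega m * (T - 4) ^ (m + 1) \<le> real (card ?L + N)"
      by (simp only: ennreal_of_nat_eq_real_of_nat) (subst (asm) ennreal_le_iff, auto)
    have "of_nat (card ?L) \<le> ennreal (omega m * T ^ (m + 1)) + of_nat N"
      using d(2) v(2) by (meson add_right_mono order_trans)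
    also have "\<dots> = ennreal (omega m * T ^ (m + 1) + real N)"
      using w by (simp only: ennreal_of_nat_eq_real_of_nat ennreal_plus[symmetric] of_nat_0_le_iff)
    finally have hi: "real (card ?L) \<le> omega m * T ^ (m + 1) + real N"
      using w by (simp only: ennreal_of_nat_eq_real_of_nat) (subst (asm) ennreal_le_iff, auto)
    have "finite ?L" using touch fin_touch by (rule finite_subset)
    then show ?thesis using lo hi N by auto
  qed
  then show ?thesis using C by (intro exI[of _ C]) auto
qed

section \<open>Minimal polynomials\<close>

text \<open>Kept polymorphic in the field, since one rational polynomial is evaluated at real and at
  complex points, and kept folded so that the homomorphism rules can simplify.\<close>

definition rat_poly_at :: "rat poly \<Rightarrow> 'a::field_char_0 \<Rightarrow> 'a" where
  "rat_poly_at p z = poly (map_poly of_rat p) z"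

lemma rat_poly_at_pCons [simp]: "rat_poly_at (pCons a p) z = of_rat a + z * rat_poly_at p z"
  by (simp add: rat_poly_at_def map_poly_pCons)

lemma rat_poly_at_0 [simp]: "rat_poly_at 0 z = 0" and rat_poly_at_1 [simp]: "rat_poly_at 1 z = 1"
  by (simp_all add: rat_poly_at_def)

lemma rat_poly_at_add [simp]: "rat_poly_at (p + q) z = rat_poly_at p z + rat_poly_at q z"
  by (induction p q rule: poly_induct2) (auto simp: of_rat_add algebra_simps)

lemma rat_poly_at_smult [simp]: "rat_poly_at (smult a p) z = of_rat a * rat_poly_at p z"
  by (induction p) (auto simp: of_rat_mult algebra_simps)

lemma rat_poly_at_mult [simp]: "rat_poly_at (p * q) z = rat_poly_at p z * rat_poly_at q z"
  by (induction p) (auto simp: algebra_simps)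

lemma rat_poly_at_power [simp]: "rat_poly_at (p ^ n) z = rat_poly_at p z ^ n"
  by (induction n) auto

lemma rat_poly_at_sum [simp]: "rat_poly_at (sum f A) z = (\<Sum>i\<in>A. rat_poly_at (f i) z)"
  by (induction A rule: infinite_finite_induct) auto

lemma rat_poly_at_monom [simp]: "rat_poly_at (monom a n) z = of_rat a * z ^ n"
  by (simp add: rat_poly_at_def map_poly_monom poly_monom)

lemma rat_poly_at_uminus [simp]: "rat_poly_at (- p) z = - rat_poly_at p z"
  using rat_poly_at_smult[of "-1" p z] by (simp add: of_rat_minus)

lemma rat_poly_at_diff [simp]: "rat_poly_at (p - q) z = rat_poly_at p z - rat_poly_at q z"
  using rat_poly_at_add[of p "- q" z] by simp

lemma rat_poly_at_of_rat: "rat_poly_at p (of_rat x) = of_rat (poly p x)"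
  by (induction p) (auto simp: of_rat_add of_rat_mult)

lemma of_rat_complex: "complex_of_rat a = complex_of_real (of_rat a)"
  by (cases a) (simp add: of_rat_rat)

lemma rat_poly_at_of_real: "rat_poly_at p (complex_of_real x) = complex_of_real (rat_poly_at p x)"
  by (induction p) (auto simp: of_rat_complex)

lemma rat_poly_at_cnj: "rat_poly_at p (cnj z) = cnj (rat_poly_at p z)"
  by (induction p) (auto simp: of_rat_complex)

lemma degree_map_of_rat [simp]: "degree (map_poly (of_rat :: rat \<Rightarrow> 'a::field_char_0) p) = degree p"
  by (rule degree_map_poly) simp

lemma coeff_map_of_rat [simp]: "coeff (map_poly (of_rat :: rat \<Rightarrow> 'a::field_char_0) p) i = of_rat (coeff p i)"
  by (simp add: coeff_map_poly)

lemma monic_dvd_antisym: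
  fixes p q :: "'a::field poly"
  assumes "p dvd q" "degree q \<le> degree p" "lead_coeff p = 1" "lead_coeff q = 1"
  shows "p = q"
proof -
  obtain r where r: "q = p * r" using assms(1) by blast
  have nz: "p \<noteq> 0" "r \<noteq> 0" using assms(3,4) r by auto
  then have "degree r = 0" using assms(2) unfolding r by (simp add: degree_mult_eq)
  moreover have "lead_coeff r = 1" using assms(3,4) unfolding r by (simp only: lead_coeff_mult) simp
  ultimately have "r = 1" by (metis degree_0_id degree_eq_zeroE lead_coeff_pCons(2) one_pCons pCons_0_0)
  then show ?thesis using r by simp
qed

lemma irreducible_no_rational_root:
  fixes p :: "rat poly"
  assumes "irreducible p" "degree p \<ge> 2"
  shows "poly p a \<noteq> 0"
proof
  assume "poly p a = 0"
  then obtain h where h: "p = [:- a, 1:] * h" unfolding poly_eq_0_iff_dvd by blast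
  then have "[:- a, 1:] dvd 1 \<or> h dvd 1" using assms(1) irreducibleD by blast
  moreover have "\<not> [:- a, 1:] dvd 1" by (subst is_unit_iff_degree) auto
  moreover have hz: "h \<noteq> 0" using assms(2) h by auto
  ultimately have "degree h = 0" using is_unit_iff_degree by blast
  with hz show False using assms(2) unfolding h by (subst (asm) degree_mult_eq) auto
qed

text \<open>A nonzero polynomial of least degree vanishing at \<open>z\<close>, made monic: a proper
  factor would contradict minimality, and division with remainder gives the divisibility.\<close>

lemma exists_irreducible_root:
  fixes z :: "'a::field_char_0"
  assumes "q \<noteq> 0" "rat_poly_at q z = 0"
  shows "\<exists>p. lead_coeff p = 1 \<and> irreducible p \<and> rat_poly_at p z = 0 \<and> (\<forall>q. rat_poly_at q z = 0 \<longrightarrow> p dvd q)"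
proof -
  define n where "n = (LEAST n. \<exists>p. p \<noteq> 0 \<and> rat_poly_at p z = 0 \<and> degree p = n)"
  have "\<exists>p. p \<noteq> 0 \<and> rat_poly_at p z = 0 \<and> degree p = n"
    unfolding n_def by (rule LeastI[of _ "degree q"]) (use assms in blast)
  then obtain p0 where p0: "p0 \<noteq> 0" "rat_poly_at p0 z = 0" "degree p0 = n" by blast
  have min: "n \<le> degree p" if "p \<noteq> 0" "rat_poly_at p z = 0" for p
    unfolding n_def by (rule Least_le) (use that in blast)
  define p where "p = smult (1 / lead_coeff p0) p0"
  have p: "p \<noteq> 0" "lead_coeff p = 1" "rat_poly_at p z = 0" "degree p = n"
    using p0 by (auto simp: p_def)
  have "irreducible p"
  proof (rule irreducibleI)
    show "\<not> p dvd 1"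
    proof
      assume "p dvd 1"
      then have "degree p = 0" using p(1) is_unit_iff_degree by blast
      then have "p = 1" using p(2) by (metis degree_eq_zeroE lead_coeff_pCons(2) one_pCons)
      then show False using p(3) by simp
    qed
    fix a b assume ab: "p = a * b"
    then have nz: "a \<noteq> 0" "b \<noteq> 0" using p(1) by auto
    have deg: "degree a + degree b = n" using ab p(4) nz degree_mult_eq by metis
    have "rat_poly_at a z = 0 \<or> rat_poly_at b z = 0" using p(3) ab by simp
    then show "a dvd 1 \<or> b dvd 1"
    proof
      assume "rat_poly_at a z = 0"
      then have "degree b = 0" using min[of a] nz deg by simp
      then show ?thesis using nz is_unit_iff_degree by blast
    next
      assume "rat_poly_at b z = 0"
      then have "degree a = 0" using min[of b] nz deg by simp
      then show ?thesis using nz is_unit_iff_degree by blast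
    qed
  qed (use p in auto)
  moreover have "p dvd q" if "rat_poly_at q z = 0" for q
  proof -
    have "rat_poly_at (q mod p) z = rat_poly_at (q - q div p * p) z" by (simp only: minus_div_mult_eq_mod)
    then have "rat_poly_at (q mod p) z = 0" using that p(3) by simp
    moreover have "q mod p = 0 \<or> degree (q mod p) < degree p" using degree_mod_less[OF p(1)] .
    ultimately have "q mod p = 0" using min[of "q mod p"] p(4) by fastforce
    then show ?thesis by (simp add: dvd_eq_mod_eq_0)
  qed
  ultimately show ?thesis using p by blast
qed

text \<open>The tool for all comparisons of polynomials below: an irreducible polynomial with root
  \<open>z\<close> is a unit multiple of the polynomial of least degree at \<open>z\<close>, so it
  divides whatever vanishes there.\<close>

lemma irreducible_dvd_common_root:
  fixes z :: "'a::field_char_0"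
  assumes "irreducible p" "rat_poly_at p z = 0" "rat_poly_at q z = 0"
  shows "p dvd q"
proof -
  have "p \<noteq> 0" using assms(1) by auto
  then obtain r where r: "irreducible r" "r dvd p" "r dvd q"
    using exists_irreducible_root[OF _ assms(2)] assms by blast
  then obtain h where h: "p = r * h" by blast
  then have "h dvd 1" using assms(1) r(1) irreducibleD irreducible_not_unit by blast
  then have "p dvd r" unfolding h by (metis dvd_refl mult_unit_dvd_iff)
  then show ?thesis using r(3) dvd_trans by blast
qed

lemma min_poly_rat_eqI:
  assumes "lead_coeff p = 1" "irreducible p" "rat_poly_at p z = 0"
  shows "min_poly_rat z = p"
  unfolding min_poly_rat_def rat_poly_at_def[symmetric]
proof (rule the_equality)
  fix q assume q: "lead_coeff q = 1 \<and> irreducible q \<and> rat_poly_at q z = 0"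
  then have "p dvd q" "q dvd p" using assms irreducible_dvd_common_root by blast+
  moreover have "degree q \<le> degree p"
    using \<open>q dvd p\<close> assms(1) by (intro dvd_imp_degree_le) auto
  ultimately show "q = p" using monic_dvd_antisym assms(1) q by metis
qed (use assms in auto)

lemma min_poly_rat_root:
  assumes "q \<noteq> 0" "rat_poly_at q z = 0"
  shows "lead_coeff (min_poly_rat z) = 1" "irreducible (min_poly_rat z)" "rat_poly_at (min_poly_rat z) z = 0"
  using exists_irreducible_root[OF assms] min_poly_rat_eqI by metis+

section \<open>Integrality of factors\<close>

definition integral_poly :: "rat poly \<Rightarrow> bool" where
  "integral_poly p \<longleftrightarrow> (\<forall>i. coeff p i \<in> \<int>)"

lemma integral_poly_iff: "integral_poly p \<longleftrightarrow> (\<exists>P :: int poly. p = map_poly of_int P)"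
proof
  assume "integral_poly p"
  then have "\<forall>i. \<exists>k :: int. coeff p i = of_int k" unfolding integral_poly_def by (auto elim: Ints_cases)
  then obtain f :: "nat \<Rightarrow> int" where f: "\<And>i. coeff p i = of_int (f i)" by metis
  define P where "P = Abs_poly f"
  have "\<forall>\<^sub>\<infinity>i. f i = 0" using MOST_coeff_eq_0[of p] unfolding f by simp
  then have "coeff P = f" unfolding P_def by (rule Abs_poly_inverse[simplified])
  then have "p = map_poly of_int P" by (intro poly_eqI) (simp add: coeff_map_poly f)
  then show "\<exists>P :: int poly. p = map_poly of_int P" by blast
qed (auto simp: integral_poly_def coeff_map_poly)

lemma common_denominator: "\<exists>d :: int. d > 0 \<and> integral_poly (smult (of_int d) p)"
proof (induction p)
  case 0
  show ?case by (intro exI[of _ 1]) (auto simp: integral_poly_def)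
next
  case (pCons a p)
  then obtain d :: int where d: "d > 0" "integral_poly (smult (of_int d) p)" by blast
  obtain n e where a: "a = of_int n / of_int e" "e > 0"
    by (metis quotient_of_div quotient_of_denom_pos surj_pair)
  have "coeff (smult (of_int (d * e)) (pCons a p)) i \<in> \<int>" for i
  proof (cases i)
    case 0
    have "of_int (d * e) * a = of_int (d * n)" using a by simp
    then show ?thesis using 0 by (metis Ints_of_int coeff_pCons_0 coeff_smult)
  next
    case (Suc j)
    have "of_int d * coeff p j \<in> \<int>" using d(2) unfolding integral_poly_def by simp
    then have "of_int e * (of_int d * coeff p j) \<in> \<int>" by (rule Ints_mult[OF Ints_of_int])
    then show ?thesis using Suc by (simp only: coeff_smult coeff_pCons_Suc of_int_mult mult_ac)
  qed
  then show ?case using d(1) a(2) by (intro exI[of _ "d * e"]) (auto simp: integral_poly_def)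
qed

lemma map_of_int_mult: "map_poly (of_int :: int \<Rightarrow> rat) (P * Q) = map_poly of_int P * map_poly of_int Q"
proof (rule poly_eqI)
  fix i show "coeff (map_poly (of_int :: int \<Rightarrow> rat) (P * Q)) i = coeff (map_poly of_int P * map_poly of_int Q) i"
    by (simp add: coeff_map_poly coeff_mult)
qed

lemma map_of_int_inject: "map_poly (of_int :: int \<Rightarrow> rat) P = map_poly of_int Q \<Longrightarrow> P = Q"
  by (rule poly_eqI) (metis coeff_map_poly of_int_0 of_int_eq_iff)

text \<open>Clear denominators to d a = A and e b = B over the integers. As a b is monic and
  integral its content is 1, so the contents of A and B multiply to d e. They also divide the
  leading coefficients d and e, hence content A = d, which cancels.\<close>

lemma gauss_monic:
  assumes "integral_poly (a * b)" "lead_coeff a = 1" "lead_coeff b = 1"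
  shows "integral_poly a"
proof -
  obtain d e :: int where de: "d > 0" "e > 0" "integral_poly (smult (of_int d) a)" "integral_poly (smult (of_int e) b)"
    using common_denominator by metis
  obtain A B G :: "int poly" where AB: "smult (of_int d) a = map_poly of_int A" "smult (of_int e) b = map_poly of_int B"
    "a * b = map_poly of_int G"
    using de assms unfolding integral_poly_iff by metis
  have "map_poly of_int (A * B) = smult (rat_of_int (d * e)) (a * b)"
    unfolding map_of_int_mult AB[symmetric] by (simp add: mult.commute)
  also have "\<dots> = map_poly of_int (smult (d * e) G)"
    unfolding AB(3) by (intro poly_eqI) (simp add: coeff_map_poly)
  finally have prod: "A * B = smult (d * e) G" by (rule map_of_int_inject)
  have dm: "degree (map_poly rat_of_int P) = degree P" for P by (rule degree_map_poly) simp
  have lc: "rat_of_int (lead_coeff P) = lead_coeff (map_poly rat_of_int P)" for P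
    unfolding dm by (simp add: coeff_map_poly)
  have lA: "lead_coeff A = d" and lB: "lead_coeff B = e"
    using lc[of A] lc[of B] assms(2,3) de(1,2) unfolding AB(1,2)[symmetric] by auto
  have lG: "lead_coeff G = 1"
    using lc[of G] assms(2,3) unfolding AB(3)[symmetric] lead_coeff_mult by simp
  have "Polynomial.content G dvd 1" using content_dvd_coeff[of G "degree G"] lG by simp
  then have cG: "Polynomial.content G = 1" by (simp only: is_unit_content_iff)
  have "Polynomial.content A * Polynomial.content B = d * e"
    using arg_cong[OF prod, of Polynomial.content] de(1,2) cG by (simp add: content_mult)
  moreover have "Polynomial.content A dvd d" "Polynomial.content B dvd e"
    using content_dvd_coeff[of A "degree A"] content_dvd_coeff[of B "degree B"] lA lB by auto
  moreover have "Polynomial.content A \<ge> 0" "Polynomial.content B \<ge> 0"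
    using normalize_content[of A] normalize_content[of B] by (metis abs_ge_zero normalize_int_def)+
  ultimately have "Polynomial.content A = d"
  proof -
    assume p: "Polynomial.content A * Polynomial.content B = d * e" and dv: "Polynomial.content A dvd d" "Polynomial.content B dvd e" and nn: "Polynomial.content A \<ge> 0" "Polynomial.content B \<ge> 0"
    have le: "Polynomial.content A \<le> d" "Polynomial.content B \<le> e" using dv de by (auto intro: zdvd_imp_le)
    show ?thesis
    proof (rule ccontr)
      assume "Polynomial.content A \<noteq> d"
      then have "Polynomial.content A < d" using le by simp
      then have "Polynomial.content A * e < d * e" using de by simp
      moreover have "Polynomial.content A * Polynomial.content B \<le> Polynomial.content A * e" using le nn by (intro mult_left_mono)
      ultimately show False using p by simp
    qed
  qed
  then have "A = smult d (primitive_part A)" by (metis content_times_primitive_part)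
  then have "smult (of_int d) a = smult (of_int d) (map_poly of_int (primitive_part A))"
    unfolding AB(1) by (metis (no_types, lifting) coeff_map_poly coeff_smult of_int_0 of_int_mult poly_eqI)
  then have "a = map_poly of_int (primitive_part A)" using de(1) by (metis less_irrefl of_int_eq_0_iff smult_cancel)
  then show ?thesis unfolding integral_poly_iff by blast
qed

text \<open>The minimal polynomial divides the monic integer polynomial that witnesses integrality,
  so \<open>gauss_monic\<close> applies to it.\<close>

lemma min_poly_rat_integral:
  assumes "algebraic_int (z :: complex)"
  shows "lead_coeff (min_poly_rat z) = 1" "irreducible (min_poly_rat z)" "rat_poly_at (min_poly_rat z) z = 0"
    "integral_poly (min_poly_rat z)"
proof -
  obtain P :: "int poly" where P: "poly (map_poly of_int P) z = 0" "lead_coeff P = 1"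
    using assms algebraic_int_altdef_ipoly by blast
  define q where "q = map_poly rat_of_int P"
  have "map_poly of_rat q = (map_poly of_int P :: complex poly)"
    unfolding q_def by (subst map_poly_map_poly) (auto simp: comp_def)
  then have qz: "rat_poly_at q z = 0" using P by (simp add: rat_poly_at_def)
  have dq: "degree q = degree P" unfolding q_def by (rule degree_map_poly) simp
  then have lq: "lead_coeff q = 1" using P by (simp add: q_def coeff_map_poly)
  then have "q \<noteq> 0" by auto
  note mp = min_poly_rat_root[OF this qz]
  then show "lead_coeff (min_poly_rat z) = 1" "irreducible (min_poly_rat z)" "rat_poly_at (min_poly_rat z) z = 0" by auto
  obtain r where r: "q = min_poly_rat z * r" using irreducible_dvd_common_root[OF mp(2,3) qz] by blast
  have "lead_coeff r = 1" using lq mp(1) unfolding r lead_coeff_mult by simp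
  moreover have "integral_poly (min_poly_rat z * r)" unfolding r[symmetric] integral_poly_iff q_def by blast
  ultimately show "integral_poly (min_poly_rat z)" using gauss_monic mp(1) by blast
qed

text \<open>Separability in characteristic 0: a common root with the derivative would make the
  irreducible polynomial divide a nonzero polynomial of smaller degree.\<close>

lemma irreducible_card_roots:
  assumes "irreducible p"
  shows "card {z :: complex. rat_poly_at p z = 0} = degree p" "finite {z :: complex. rat_poly_at p z = 0}"
proof -
  let ?P = "map_poly of_rat p :: complex poly"
  have p0: "p \<noteq> 0" using assms by auto
  then have P0: "?P \<noteq> 0" by (metis coeff_map_of_rat degree_map_of_rat leading_coeff_0_iff of_rat_eq_0_iff)
  then show "finite {z :: complex. rat_poly_at p z = 0}" unfolding rat_poly_at_def by (rule poly_roots_finite)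
  have degp: "degree p > 0" using assms p0 by (metis gr0I is_unit_iff_degree irreducible_not_unit)
  have "pderiv ?P = map_poly of_rat (pderiv p)"
    by (intro poly_eqI) (simp add: coeff_pderiv of_rat_mult of_rat_add)
  then have "\<not> (poly ?P a = 0 \<and> poly (pderiv ?P) a = 0)" for a
  proof (intro notI)
    assume "pderiv ?P = map_poly of_rat (pderiv p)" "poly ?P a = 0 \<and> poly (pderiv ?P) a = 0"
    then have "rat_poly_at p a = 0" "rat_poly_at (pderiv p) a = 0" by (auto simp: rat_poly_at_def)
    then have "p dvd pderiv p" using irreducible_dvd_common_root assms by blast
    moreover have "pderiv p \<noteq> 0" using degp by (simp add: pderiv_eq_0_iff)
    ultimately have "degree p \<le> degree (pderiv p)" by (rule dvd_imp_degree_le)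
    then show False using degp by (simp add: degree_pderiv)
  qed
  then have "rsquarefree ?P" unfolding rsquarefree_roots by blast
  then have "?P = smult (lead_coeff ?P) (\<Prod>z|poly ?P z = 0. [:- z, 1:])"
    by (rule complex_poly_decompose_rsquarefree[symmetric])
  then have "degree ?P = degree (\<Prod>z|poly ?P z = 0. [:- z, 1:])" using P0 by (metis degree_smult_eq leading_coeff_0_iff)
  also have "\<dots> = card {z. poly ?P z = 0}" by (subst degree_prod_sum_eq) auto
  finally show "card {z :: complex. rat_poly_at p z = 0} = degree p" by (simp add: rat_poly_at_def)
qed

section \<open>Salem numbers and their trace polynomials\<close>

text \<open>This is X^n g((X + 1)^2 / X), expanded so that no negative power of X occurs.\<close>

definition trace_lift :: "nat \<Rightarrow> rat poly \<Rightarrow> rat poly" where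
  "trace_lift n g = (\<Sum>j\<le>n. smult (coeff g j) ([:1, 1:] ^ (2 * j) * monom 1 (n - j)))"

text \<open>This is \<open>z + 1/z + 2\<close>.\<close>

definition trace_map :: "'a::field \<Rightarrow> 'a" where
  "trace_map z = (z + 1)\<^sup>2 / z"

lemma rat_poly_at_sum_coeff: "degree g \<le> n \<Longrightarrow> rat_poly_at g y = (\<Sum>j\<le>n. of_rat (coeff g j) * y ^ j)"
proof -
  assume n: "degree g \<le> n"
  have "rat_poly_at g y = (\<Sum>j\<le>degree g. of_rat (coeff g j) * y ^ j)"
    by (simp add: rat_poly_at_def poly_altdef)
  also have "\<dots> = (\<Sum>j\<le>n. of_rat (coeff g j) * y ^ j)"
    using n by (intro sum.mono_neutral_left) (auto simp: coeff_eq_0)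
  finally show ?thesis .
qed

lemma rat_poly_at_trace_lift:
  assumes "z \<noteq> 0" "degree g \<le> n"
  shows "rat_poly_at (trace_lift n g) z = z ^ n * rat_poly_at g (trace_map z)"
proof -
  have "rat_poly_at (trace_lift n g) z = (\<Sum>j\<le>n. z ^ n * (of_rat (coeff g j) * trace_map z ^ j))"
    unfolding trace_lift_def rat_poly_at_sum
  proof (rule sum.cong)
    fix j assume "j \<in> {..n}"
    then have "z ^ (n - j) = z ^ n / z ^ j" using assms(1) by (simp add: power_diff)
    then show "rat_poly_at (smult (coeff g j) ([:1, 1:] ^ (2 * j) * monom 1 (n - j))) z = z ^ n * (of_rat (coeff g j) * trace_map z ^ j)"
      by (simp add: trace_map_def power_divide power_mult add.commute)
  qed simp
  also have "\<dots> = z ^ n * rat_poly_at g (trace_map z)"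
    unfolding rat_poly_at_sum_coeff[OF assms(2)] by (simp add: sum_distrib_left)
  finally show ?thesis .
qed

lemma degree_trace_lift_term: "degree ([:1, 1 :: rat:] ^ (2 * j) * monom 1 (n - j)) = 2 * j + (n - j)"
  by (subst degree_mult_eq) (auto simp: degree_linear_power degree_monom_eq)

text \<open>The summand with index j has degree n + j, so only j = n reaches the top degree.\<close>

lemma trace_lift_monic:
  assumes "coeff g n = 1"
  shows "degree (trace_lift n g) = 2 * n" "lead_coeff (trace_lift n g) = 1"
proof -
  let ?t = "\<lambda>j. [:1, 1 :: rat:] ^ (2 * j) * monom 1 (n - j)"
  have le: "degree (trace_lift n g) \<le> 2 * n"
    unfolding trace_lift_def
  proof (rule degree_sum_le)
    fix j assume "j \<in> {..n}"
    then show "degree (smult (coeff g j) (?t j)) \<le> 2 * n"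
      using degree_smult_le[of "coeff g j" "?t j"] degree_trace_lift_term[of j n] by simp
  qed simp
  have "coeff (trace_lift n g) (2 * n) = (\<Sum>j\<le>n. coeff (smult (coeff g j) (?t j)) (2 * n))"
    unfolding trace_lift_def by (rule coeff_sum)
  also have "\<dots> = (\<Sum>j\<le>n. if j = n then 1 else 0)"
  proof (rule sum.cong)
    fix j assume j: "j \<in> {..n}"
    show "coeff (smult (coeff g j) (?t j)) (2 * n) = (if j = n then 1 else 0)"
    proof (cases "j = n")
      case True
      then show ?thesis using assms by (simp add: coeff_linear_power monom_0)
    next
      case False
      then have "degree (?t j) < 2 * n" using j degree_trace_lift_term[of j n] by auto
      then show ?thesis using False by (simp add: coeff_eq_0)
    qed
  qed simp
  finally have c: "coeff (trace_lift n g) (2 * n) = 1" by simp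
  then have "2 * n \<le> degree (trace_lift n g)" by (intro le_degree) simp
  then show "degree (trace_lift n g) = 2 * n" using le by simp
  then show "lead_coeff (trace_lift n g) = 1" using c by simp
qed

lemma integral_poly_simps:
  "integral_poly p \<Longrightarrow> integral_poly q \<Longrightarrow> integral_poly (p + q)"
  "integral_poly p \<Longrightarrow> integral_poly q \<Longrightarrow> integral_poly (p - q)"
  "integral_poly p \<Longrightarrow> integral_poly q \<Longrightarrow> integral_poly (p * q)"
  "a \<in> \<int> \<Longrightarrow> integral_poly p \<Longrightarrow> integral_poly (smult a p)"
  "a \<in> \<int> \<Longrightarrow> integral_poly (monom a n)"
  "integral_poly [:1, 1:]" "integral_poly 1"
  by (auto simp: integral_poly_def coeff_mult coeff_pCons split: nat.split)

lemma integral_poly_power: "integral_poly p \<Longrightarrow> integral_poly (p ^ n)"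
  by (induction n) (auto intro: integral_poly_simps)

lemma integral_poly_sum: "(\<And>i. i \<in> A \<Longrightarrow> integral_poly (f i)) \<Longrightarrow> integral_poly (sum f A)"
  by (induction A rule: infinite_finite_induct) (auto intro: integral_poly_simps simp: integral_poly_def[of 0])

lemma integral_trace_lift: "integral_poly g \<Longrightarrow> integral_poly (trace_lift n g)"
  unfolding trace_lift_def
  by (intro integral_poly_sum integral_poly_simps(3,4,5) integral_poly_power integral_poly_simps(6))
     (auto simp: integral_poly_def)

lemma trace_lift_Suc:
  assumes "degree g \<le> n"
  shows "trace_lift (Suc n) (g + monom a (Suc n)) = smult a ([:1, 1:] ^ (2 * Suc n)) + pCons 0 (trace_lift n g)"
proof -
  have "trace_lift (Suc n) (g + monom a (Suc n)) =
    (\<Sum>j\<le>n. smult (coeff g j) ([:1, 1:] ^ (2 * j) * monom 1 (Suc n - j))) + smult a ([:1, 1:] ^ (2 * Suc n))"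
    using assms unfolding trace_lift_def
    by (simp only: sum.atMost_Suc) (auto intro!: arg_cong2[where f = "(+)"] sum.cong simp: coeff_eq_0 monom_0)
  also have "(\<Sum>j\<le>n. smult (coeff g j) ([:1, 1:] ^ (2 * j) * monom 1 (Suc n - j))) = [:0, 1:] * trace_lift n g"
    unfolding trace_lift_def sum_distrib_left
  proof (rule sum.cong)
    fix j assume "j \<in> {..n}"
    then have "monom 1 (Suc n - j) = [:0, 1:] * monom (1 :: rat) (n - j)"
      by (simp add: Suc_diff_le monom_Suc)
    then show "smult (coeff g j) ([:1, 1:] ^ (2 * j) * monom 1 (Suc n - j)) =
      [:0, 1:] * smult (coeff g j) ([:1, 1:] ^ (2 * j) * monom 1 (n - j))"
      by (simp only: mult_smult_right mult.left_commute)
  qed simp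
  finally show ?thesis by simp
qed

text \<open>Subtract the top coefficient times (X + 1)^(2k), which is itself a palindrome. The
  difference loses its top and bottom coefficients, so it is X times a palindrome of degree at most
  2k - 2. Only integer multiples of integral polynomials are subtracted when \<open>Q\<close> is
  integral.\<close>

lemma palindrome_trace_lift:
  assumes "degree Q \<le> 2 * k" "\<And>i. i \<le> 2 * k \<Longrightarrow> coeff Q i = coeff Q (2 * k - i)"
  shows "\<exists>g. degree g \<le> k \<and> Q = trace_lift k g \<and> coeff g k = coeff Q (2 * k) \<and> (integral_poly Q \<longrightarrow> integral_poly g)"
  using assms
proof (induction k arbitrary: Q)
  case 0
  then obtain a where "Q = [:a:]" by (auto elim: degree_eq_zeroE)
  then show ?case by (intro exI[of _ Q]) (auto simp: trace_lift_def monom_0)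
next
  case (Suc k)
  define a where "a = coeff Q (2 * Suc k)"
  let ?B = "[:1, 1 :: rat:] ^ (2 * Suc k)"
  have B: "coeff ?B i = of_nat ((2 * Suc k) choose i)" if "i \<le> 2 * Suc k" for i
    using that by (subst coeff_linear_poly_power) auto
  define Q1 where "Q1 = Q - smult a ?B"
  have pal1: "coeff Q1 i = coeff Q1 (2 * Suc k - i)" if "i \<le> 2 * Suc k" for i
    using Suc.prems(2)[OF that] B[OF that] B[of "2 * Suc k - i"] binomial_symmetric[OF that] that
    unfolding Q1_def by simp
  have top: "coeff Q1 (2 * Suc k) = 0" using B[of "2 * Suc k"] by (simp add: Q1_def a_def)
  then have bot: "coeff Q1 0 = 0" using pal1[of 0] by simp
  have "degree (smult a ?B) \<le> 2 * Suc k"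
    using degree_smult_le[of a ?B] degree_linear_power[of 1 "2 * Suc k"] by metis
  then have "degree Q1 \<le> 2 * Suc k"
    unfolding Q1_def by (intro degree_diff_le Suc.prems(1))
  then have z: "coeff Q1 i = 0" if "i \<ge> 2 * Suc k" for i
    using that top by (cases "i = 2 * Suc k") (auto intro: coeff_eq_0)
  obtain Q2 where Q2: "Q1 = pCons 0 Q2" using bot by (metis coeff_pCons_0 pCons_cases)
  have cQ2: "coeff Q2 i = coeff Q1 (Suc i)" for i using Q2 by simp
  have dQ2: "degree Q2 \<le> 2 * k"
    by (rule degree_le) (use z cQ2 in auto)
  have palQ2: "coeff Q2 i = coeff Q2 (2 * k - i)" if "i \<le> 2 * k" for i
    unfolding cQ2 using pal1[of "Suc i"] that by (simp add: Suc_diff_le)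
  obtain g2 where g2: "degree g2 \<le> k" "Q2 = trace_lift k g2" "integral_poly Q2 \<longrightarrow> integral_poly g2"
    using Suc.IH[OF dQ2 palQ2] by blast
  define g where "g = g2 + monom a (Suc k)"
  have "Q = trace_lift (Suc k) g"
    unfolding g_def trace_lift_Suc[OF g2(1)] g2(2)[symmetric] Q2[symmetric] Q1_def by simp
  moreover have "degree g \<le> Suc k"
    unfolding g_def by (intro degree_add_le) (use g2(1) in \<open>auto intro: order_trans[OF degree_monom_le]\<close>)
  moreover have "coeff g (Suc k) = a" using g2(1) by (simp add: g_def coeff_eq_0)
  moreover have "integral_poly g" if "integral_poly Q"
  proof -
    have "a \<in> \<int>" using that by (auto simp: a_def integral_poly_def)
    then have "integral_poly Q1" unfolding Q1_def
      using that by (intro integral_poly_simps(2,4) integral_poly_power integral_poly_simps(6))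
    then have "integral_poly Q2" unfolding integral_poly_def cQ2 by blast
    then show ?thesis unfolding g_def using g2(3) \<open>a \<in> \<int>\<close> by (auto intro: integral_poly_simps)
  qed
  ultimately show ?case unfolding a_def by blast
qed

lemma rat_poly_at_reflect:
  fixes z :: "'a::field_char_0"
  assumes "z \<noteq> 0"
  shows "rat_poly_at (reflect_poly Q) z = z ^ degree Q * rat_poly_at Q (inverse z)"
proof -
  have "map_poly of_rat (reflect_poly Q) = reflect_poly (map_poly of_rat Q :: 'a poly)"
    by (intro poly_eqI) (simp add: coeff_reflect_poly)
  then show ?thesis using assms by (simp add: rat_poly_at_def poly_reflect_poly_nz)
qed

text \<open>On the unit circle the inverse of \<open>w\<close> is its conjugate, again a root, so
  \<open>Q\<close> divides its reversal and the reversal is c Q. The value at 1, nonzero since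
  \<open>Q\<close> has no rational root, forces c = 1; the value at -1 then forces an even
  degree.\<close>

lemma irreducible_unit_root_palindrome:
  assumes Q: "irreducible Q" "lead_coeff Q = 1" "degree Q \<ge> 2" and w: "rat_poly_at Q w = 0" "cmod w = 1"
  obtains k where "degree Q = 2 * k" "\<And>i. i \<le> 2 * k \<Longrightarrow> coeff Q i = coeff Q (2 * k - i)"
proof -
  have nr: "poly Q a \<noteq> 0" for a using irreducible_no_rational_root[OF Q(1,3)] .
  have Q0: "coeff Q 0 \<noteq> 0" using nr[of 0] by (simp add: poly_0_coeff_0)
  let ?R = "reflect_poly Q"
  have w0: "w \<noteq> 0" using w by auto
  have "inverse w = cnj w"
    using w(2) w0 by (metis complex_norm_square inverse_unique mult.commute of_real_1 one_power2)
  then have "rat_poly_at ?R w = 0" using rat_poly_at_reflect[OF w0, of Q] w(1) rat_poly_at_cnj[of Q w] by simp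
  then have "Q dvd ?R" using irreducible_dvd_common_root Q(1) w(1) by blast
  then obtain h where h: "?R = Q * h" by blast
  have nz: "?R \<noteq> 0" "Q \<noteq> 0" using Q by auto
  then have "h \<noteq> 0" using h by auto
  then have "degree h = 0" using h Q0 nz degree_reflect_poly_eq[OF Q0] by (metis add_cancel_left_right degree_mult_eq)
  then obtain c where c: "h = [:c:]" by (rule degree_eq_zeroE)
  then have R: "?R = smult c Q" using h by simp
  have "coeff ?R 0 = 1" using Q(2) by simp
  then have 1: "c * coeff Q 0 = 1" using R by simp
  have "coeff ?R (degree Q) = coeff Q 0" by (simp add: coeff_reflect_poly)
  then have "c = coeff Q 0" using R Q(2) by simp
  then have "c * c = 1" using 1 by simp
  have e1: "poly ?R 1 = poly Q 1" by (simp add: poly_reflect_poly_nz)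
  then have "c = 1" using R nr[of 1] by simp
  then have RQ: "?R = Q" using R by simp
  have "poly ?R (-1) = (-1) ^ degree Q * poly Q (-1)" by (simp add: poly_reflect_poly_nz)
  then have "(-1 :: rat) ^ degree Q = 1" using RQ nr[of "-1"] by simp
  then have "even (degree Q)" by (cases "even (degree Q)") auto
  then obtain k where k: "degree Q = 2 * k" by blast
  show ?thesis
  proof (rule that[OF k])
    fix i assume "i \<le> 2 * k"
    then have "coeff ?R i = coeff Q (2 * k - i)" using k by (simp add: coeff_reflect_poly)
    then show "coeff Q i = coeff Q (2 * k - i)" using RQ by simp
  qed
qed

section \<open>The map z + 1/z + 2 on the unit circle and beyond 1\<close>

lemma trace_map_eq_iff:
  fixes w z :: "'a::field"
  assumes "w \<noteq> 0" "z \<noteq> 0"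
  shows "trace_map w = trace_map z \<longleftrightarrow> w = z \<or> w = inverse z"
proof -
  have "trace_map w = trace_map z \<longleftrightarrow> (w + 1)\<^sup>2 * z - (z + 1)\<^sup>2 * w = 0"
    unfolding trace_map_def using assms by (simp add: frac_eq_eq)
  also have "(w + 1)\<^sup>2 * z - (z + 1)\<^sup>2 * w = (w - z) * (w * z - 1)"
    by (simp add: power2_eq_square algebra_simps)
  also have "(w - z) * (w * z - 1) = 0 \<longleftrightarrow> w = z \<or> w * z = 1" by simp
  also have "w * z = 1 \<longleftrightarrow> w = inverse z"
    using assms by (simp add: field_simps)
  finally show ?thesis .
qed

lemma trace_map_unit:
  assumes "cmod w = 1"
  shows "trace_map w = of_real ((cmod (w + 1))\<^sup>2)"
proof -
  have w0: "w \<noteq> 0" using assms by auto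
  have wc: "w * cnj w = 1" using assms by (metis complex_norm_square of_real_1 one_power2)
  have "of_real ((cmod (w + 1))\<^sup>2) = (w + 1) * (cnj w + 1)"
    by (simp only: complex_norm_square complex_cnj_add complex_cnj_one)
  then have "of_real ((cmod (w + 1))\<^sup>2) * w = (w + 1) * (w * cnj w + w)" by (simp add: algebra_simps)
  then have "of_real ((cmod (w + 1))\<^sup>2) * w = (w + 1)\<^sup>2" using wc by (simp add: power2_eq_square add.commute)
  then show ?thesis using w0 by (simp add: trace_map_def field_simps)
qed

lemma trace_map_unit_range:
  assumes "cmod w = 1" "w \<noteq> 1" "w \<noteq> -1"
  shows "(cmod (w + 1))\<^sup>2 \<in> {0<..<4}"
proof -
  have n: "(Re w)\<^sup>2 + (Im w)\<^sup>2 = 1" using assms(1) cmod_power2[of w] by simp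
  have "(cmod (w + 1))\<^sup>2 = (Re w + 1)\<^sup>2 + (Im w)\<^sup>2" by (simp add: cmod_power2)
  also have "\<dots> = 2 + 2 * Re w" using n by (simp add: power2_eq_square algebra_simps)
  finally have e: "(cmod (w + 1))\<^sup>2 = 2 + 2 * Re w" .
  have "\<bar>Re w\<bar> \<le> 1" using abs_Re_le_cmod[of w] assms(1) by simp
  moreover have "Re w \<noteq> 1" "Re w \<noteq> -1"
    using n assms(2,3) by (auto simp: complex_eq_iff)
  ultimately show ?thesis unfolding e by auto
qed

text \<open>\<open>w\<close> solves a real quadratic with constant term 1 and discriminant r (r - 4)
  < 0, so its roots are complex conjugates with product 1.\<close>

lemma trace_map_real_imp_unit:
  assumes "w \<noteq> 0" "trace_map w = complex_of_real r" "0 < r" "r < 4"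
  shows "cmod w = 1"
proof -
  have "(w + 1)\<^sup>2 = of_real r * w" using assms(1,2) by (simp add: trace_map_def field_simps)
  then have "w\<^sup>2 + (2 - of_real r) * w + 1 = 0" by (simp add: power2_eq_square algebra_simps)
  then have re: "(Re w)\<^sup>2 - (Im w)\<^sup>2 + (2 - r) * Re w + 1 = 0" and im: "Im w * (2 * Re w + 2 - r) = 0"
    by (auto simp: complex_eq_iff power2_eq_square algebra_simps)
  have "Im w \<noteq> 0"
  proof
    assume "Im w = 0"
    then have "(Re w)\<^sup>2 + (2 - r) * Re w + 1 = 0" using re by simp
    then have "(Re w + (2 - r) / 2)\<^sup>2 = r * (r - 4) / 4" by (simp add: power2_eq_square field_simps)
    moreover have "r * (r - 4) < 0" using assms(3,4) by (simp add: mult_less_0_iff)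
    ultimately show False by (metis divide_less_0_iff not_less zero_le_power2 zero_less_numeral)
  qed
  then have "2 - r = - 2 * Re w" using im by simp
  then have "(Re w)\<^sup>2 - (Im w)\<^sup>2 + (- 2 * Re w) * Re w + 1 = 0" using re by simp
  then have "(Re w)\<^sup>2 + (Im w)\<^sup>2 = 1" by (simp add: power2_eq_square algebra_simps)
  then show ?thesis by (simp add: cmod_def)
qed

lemma trace_map_gt_4:
  fixes a :: real
  assumes "a > 1"
  shows "trace_map a > 4"
proof -
  have "(a - 1)\<^sup>2 > 0" using assms by simp
  then have "4 * a < (a + 1)\<^sup>2" by (simp add: power2_eq_square algebra_simps)
  then show ?thesis using assms by (simp add: trace_map_def field_simps)
qed

lemma trace_map_less_iff:
  fixes a b :: real
  assumes "a > 1" "b > 1"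
  shows "trace_map a < trace_map b \<longleftrightarrow> a < b"
proof -
  have "trace_map b - trace_map a = (b - a) * (1 - 1 / (a * b))"
    using assms by (simp add: trace_map_def field_simps power2_eq_square)
  moreover have "1 - 1 / (a * b) > 0" using assms less_1_mult[of a b] by (simp add: field_simps)
  ultimately show ?thesis by (smt (verit) zero_less_mult_iff)
qed

lemma trace_map_surj:
  fixes r :: real
  assumes "r > 4"
  obtains a where "a > 1" "trace_map a = r"
proof -
  define s where "s = sqrt (r * (r - 4))"
  have s: "s > 0" "s\<^sup>2 = r * (r - 4)" using assms by (auto simp: s_def)
  define a where "a = (r - 2 + s) / 2"
  have "a > 1" using assms s by (simp add: a_def)
  moreover have "(a + 1)\<^sup>2 = r * a"
    using s(2) by (simp add: a_def power2_eq_square field_simps)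
  then have "trace_map a = r" using \<open>a > 1\<close> by (simp add: trace_map_def field_simps)
  ultimately show ?thesis using that by blast
qed

lemma trace_map_of_real: "trace_map (complex_of_real a) = complex_of_real (trace_map a)"
  by (simp add: trace_map_def)

section \<open>Passing between Salem numbers and their trace polynomials\<close>

lemma conjugates_eq: "conjugates z = {w. rat_poly_at (min_poly_rat z) w = 0}"
  by (simp add: conjugates_def rat_poly_at_def)

lemma finite_rat_poly_at_roots: "p \<noteq> 0 \<Longrightarrow> finite {z :: 'a::field_char_0. rat_poly_at p z = 0}"
  "p \<noteq> 0 \<Longrightarrow> card {z :: 'a::field_char_0. rat_poly_at p z = 0} \<le> degree p"
proof -
  assume "p \<noteq> 0"
  then have P0: "(map_poly of_rat p :: 'a poly) \<noteq> 0"
    by (metis coeff_map_of_rat degree_map_of_rat leading_coeff_0_iff of_rat_eq_0_iff)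
  show "finite {z :: 'a::field_char_0. rat_poly_at p z = 0}" unfolding rat_poly_at_def using P0 by (rule poly_roots_finite)
  show "card {z :: 'a::field_char_0. rat_poly_at p z = 0} \<le> degree p"
    using card_poly_roots_bound[OF P0] by (simp add: rat_poly_at_def)
qed

text \<open>The minimal polynomial is a palindrome and hence lifted from an integral
  \<open>g\<close>. Its 2(m + 1) distinct roots are mapped at most two-to-one by
  \<open>trace_map\<close>, so \<open>g\<close> receives at least m + 1 values; all but that of
  \<alpha> lie in (0,4), which exhausts the degree of \<open>g\<close>.\<close>

lemma salem_trace_poly:
  assumes "salem \<alpha>" "alg_degree \<alpha> = 2 * (m + 1)"
  obtains g where "integral_poly g" "degree g = Suc m" "lead_coeff g = 1" "rat_poly_at g (trace_map \<alpha>) = 0"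
    "\<And>T. T > trace_map \<alpha> \<Longrightarrow> salem_poly m T (map_poly of_rat g)"
proof -
  let ?a = "complex_of_real \<alpha>"
  define P where "P = min_poly_rat ?a"
  have a1: "\<alpha> > 1" using assms(1) by (simp add: salem_def)
  have "algebraic_int ?a" using assms(1) by (auto simp: salem_def)
  from min_poly_rat_integral[OF this]
  have P: "lead_coeff P = 1" "irreducible P" "rat_poly_at P ?a = 0" "integral_poly P" by (auto simp: P_def)
  have degP: "degree P = 2 * Suc m" using assms(2) by (simp add: alg_degree_def P_def)
  note sal = assms(1)[unfolded salem_def conjugates_eq P_def[symmetric], THEN conjunct2, THEN conjunct2]
  note sal1 = conjunct1[OF sal] and ex = conjunct2[OF sal]
  have conj: "cmod w \<le> 1" if "rat_poly_at P w = 0" "w \<noteq> ?a" for w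
    using sal1 that by simp
  obtain w where w: "rat_poly_at P w = 0" "cmod w = 1"
    using ex by auto
  have deg2: "degree P \<ge> 2" using degP by simp
  obtain k where k: "degree P = 2 * k" "\<And>i. i \<le> 2 * k \<Longrightarrow> coeff P i = coeff P (2 * k - i)"
    using irreducible_unit_root_palindrome[OF P(2,1) deg2 w] by blast
  then have km: "k = Suc m" using degP by simp
  from palindrome_trace_lift[OF eq_refl[OF degP] k(2)[unfolded km]] obtain g where "degree g \<le> Suc m \<and> P = trace_lift (Suc m) g \<and>
    coeff g (Suc m) = coeff P (2 * Suc m) \<and> (integral_poly P \<longrightarrow> integral_poly g)" ..
  with P(4) have g: "degree g \<le> Suc m" "P = trace_lift (Suc m) g" "coeff g (Suc m) = coeff P (2 * Suc m)" "integral_poly g"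
    by simp_all
  have cg: "coeff g (Suc m) = 1" using g(3) P(1) degP by simp
  then have "Suc m \<le> degree g" by (intro le_degree) simp
  then have dg: "degree g = Suc m" using g(1) by simp
  then have lg: "lead_coeff g = 1" using cg by simp
  define Z where "Z = {z :: complex. rat_poly_at P z = 0}"
  have Z: "card Z = 2 * Suc m" "finite Z" using irreducible_card_roots[OF P(2)] degP by (auto simp: Z_def)
  \<comment> \<open>Excluding 1 and -1 in particular keeps the traces of roots on the unit circle
    off the endpoints 4 and 0.\<close>
  have rat: "z \<noteq> of_rat q" if "z \<in> Z" for z q
    using that irreducible_no_rational_root[OF P(2) deg2, of q] rat_poly_at_of_rat[of P q, where 'a = complex] by (auto simp: Z_def)
  have Z0: "z \<noteq> 0" "z \<noteq> 1" "z \<noteq> -1" if "z \<in> Z" for z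
    using rat[OF that, of 0] rat[OF that, of 1] rat[OF that, of "-1"] by (auto simp: of_rat_minus)
  have tr: "rat_poly_at P z = z ^ Suc m * rat_poly_at g (trace_map z)" if "z \<noteq> 0" for z :: complex
    using rat_poly_at_trace_lift[OF that g(1)] g(2) by simp
  have gz: "rat_poly_at g (trace_map z) = 0" if "z \<in> Z" for z
    using tr[OF Z0(1)[OF that]] that Z0(1)[OF that] by (simp add: Z_def)
  have inv: "inverse z \<in> Z" if "z \<in> Z" for z
  proof -
    have "trace_map (inverse z) = trace_map z" using trace_map_eq_iff[of "inverse z" z] Z0[OF that] by simp
    then show ?thesis using tr[of "inverse z"] gz[OF that] Z0[OF that] by (simp add: Z_def)
  qed
  \<comment> \<open>The roots are closed under inversion. If neither \<open>z\<close> nor its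
    inverse is \<alpha>, both have modulus at most 1, hence exactly 1.\<close>
  have cl: "z = ?a \<or> z = inverse ?a \<or> cmod z = 1" if "z \<in> Z" for z
  proof (cases "z = ?a \<or> inverse z = ?a")
    case True
    then show ?thesis by (metis inverse_inverse_eq)
  next
    case False
    then have "cmod z \<le> 1" "cmod (inverse z) \<le> 1" using conj that inv[OF that] by (auto simp: Z_def)
    moreover have "cmod z > 0" using Z0[OF that] by simp
    ultimately have "cmod z = 1" by (simp add: norm_inverse inverse_le_1_iff)
    then show ?thesis by blast
  qed
  define R0 where "R0 = {r :: real. rat_poly_at g r = 0} \<inter> {0<..<4}"
  have g0: "g \<noteq> 0" using dg by auto
  have finR0: "finite R0" using finite_rat_poly_at_roots(1)[OF g0, where 'a = real] by (simp add: R0_def)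
  define V where "V = trace_map ` Z"
  have "V \<subseteq> insert (of_real (trace_map \<alpha>)) (of_real ` R0)"
  proof
    fix v assume "v \<in> V"
    then obtain z where z: "z \<in> Z" "v = trace_map z" by (auto simp: V_def)
    show "v \<in> insert (of_real (trace_map \<alpha>)) (of_real ` R0)"
    proof (cases "cmod z = 1")
      case True
      define r where "r = (cmod (z + 1))\<^sup>2"
      have "v = of_real r" using trace_map_unit[OF True] z by (simp add: r_def)
      moreover have "r \<in> {0<..<4}" unfolding r_def using trace_map_unit_range True Z0[OF z(1)] by blast
      moreover have "rat_poly_at g r = 0" using gz[OF z(1)] z(2) \<open>v = of_real r\<close> rat_poly_at_of_real[of g r] by simp
      ultimately show ?thesis by (auto simp: R0_def)
    next
      case False
      then have "trace_map z = trace_map ?a" using cl[OF z(1)] trace_map_eq_iff[of z ?a] Z0[OF z(1)] a1 by auto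
      then show ?thesis using z by (simp add: trace_map_of_real)
    qed
  qed
  then have "card V \<le> card (insert (complex_of_real (trace_map \<alpha>)) (of_real ` R0))"
    using finR0 by (intro card_mono) auto
  also have "\<dots> \<le> Suc (card (complex_of_real ` R0))" using finR0 by (simp add: card_insert_if)
  also have "\<dots> \<le> Suc (card R0)" using card_image_le[OF finR0] by simp
  finally have VR: "card V \<le> Suc (card R0)" .
  have "Z = (\<Union>v\<in>V. {z \<in> Z. trace_map z = v})" by (auto simp: V_def)
  then have "card Z \<le> (\<Sum>v\<in>V. card {z \<in> Z. trace_map z = v})"
    using card_UN_le[of V "\<lambda>v. {z \<in> Z. trace_map z = v}"] Z(2) by (simp add: V_def)
  also have "\<dots> \<le> (\<Sum>v\<in>V. 2)"
  proof (rule sum_mono)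
    fix v assume "v \<in> V"
    then obtain z where z: "z \<in> Z" "v = trace_map z" by (auto simp: V_def)
    have "{z' \<in> Z. trace_map z' = v} \<subseteq> {z, inverse z}"
      using trace_map_eq_iff Z0(1) z by blast
    then have "card {z' \<in> Z. trace_map z' = v} \<le> card {z, inverse z}" by (intro card_mono) auto
    also have "\<dots> \<le> 2" by (simp add: card_insert_if)
    finally show "card {z' \<in> Z. trace_map z' = v} \<le> 2" .
  qed
  finally have "Suc m \<le> card V" using Z(1) by simp
  then have "m \<le> card R0" using VR by simp
  then obtain R where R: "R \<subseteq> R0" "card R = m" "finite R"
    using finR0 by (metis obtain_subset_with_card_n finite_subset)
  have th4: "trace_map \<alpha> > 4" using a1 by (rule trace_map_gt_4)
  have "rat_poly_at g (complex_of_real (trace_map \<alpha>)) = 0" using gz[of ?a] P(3) by (simp add: Z_def trace_map_of_real)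
  then have gth: "rat_poly_at g (trace_map \<alpha>) = 0" by (simp add: rat_poly_at_of_real)
  have nin: "trace_map \<alpha> \<notin> R" using R(1) th4 by (auto simp: R0_def)
  have "map_poly of_rat g = rpoly (insert (trace_map \<alpha>) R)"
  proof (rule rpoly_eqI)
    show "degree (map_poly real_of_rat g) = Suc m" using dg by simp
    show "card (insert (trace_map \<alpha>) R) = Suc m" using nin R by simp
    show "lead_coeff (map_poly real_of_rat g) = 1" using lg by simp
    fix r assume "r \<in> insert (trace_map \<alpha>) R"
    then show "poly (map_poly real_of_rat g) r = 0" using gth R(1) by (auto simp: R0_def rat_poly_at_def)
  qed (use R in simp)
  then have "map_poly of_rat g = [:- trace_map \<alpha>, 1:] * rpoly R"
    using rpoly_insert[OF R(3) nin] by simp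
  moreover have "R \<subseteq> {0<..<4}" using R(1) by (auto simp: R0_def)
  ultimately have "salem_poly m T (map_poly of_rat g)" if "T > trace_map \<alpha>" for T
    unfolding salem_poly_def using R th4 that by blast
  then show ?thesis using that g(4) dg lg gth by blast
qed

text \<open>Choose \<alpha> with \<open>trace_map \<alpha>\<close> the large root. Its minimal
  polynomial \<open>Q\<close> divides the lift of \<open>g\<close>, so every root of
  \<open>Q\<close> is \<alpha>, its inverse, or of modulus 1. A root of modulus 1 exists, therefore
  \<open>Q\<close> is itself lifted from some \<open>g1\<close>, and irreducibility of
  \<open>g\<close> gives the full degree.\<close>

lemma trace_poly_salem:
  assumes g: "irreducible g" "integral_poly g" "degree g = Suc m" "lead_coeff g = 1" and m: "m \<ge> 1"
    and sp: "salem_poly m T (map_poly of_rat g)"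
  obtains \<alpha> where "salem \<alpha>" "alg_degree \<alpha> = 2 * (m + 1)" "trace_map \<alpha> < T" "rat_poly_at g (trace_map \<alpha>) = 0"
proof -
  obtain R th where R: "finite R" "card R = m" "R \<subseteq> {0<..<4}" "4 < th" "th < T"
    "map_poly real_of_rat g = [:- th, 1:] * rpoly R"
    using sp unfolding salem_poly_def by blast
  obtain \<alpha> where a: "\<alpha> > 1" "trace_map \<alpha> = th" using trace_map_surj[OF R(4)] by blast
  let ?a = "complex_of_real \<alpha>"
  have a0: "?a \<noteq> 0" using a by auto
  have g0: "g \<noteq> 0" using g by auto
  have groot: "rat_poly_at g r = 0" if "r \<in> insert th R" for r :: real
    using that R rpoly_roots[OF R(1), of r] unfolding rat_poly_at_def R(6) by auto
  have roots: "{v :: complex. rat_poly_at g v = 0} = of_real ` insert th R"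
  proof (rule card_subset_eq[symmetric])
    show sub: "complex_of_real ` insert th R \<subseteq> {v. rat_poly_at g v = 0}"
      using groot by (auto simp: rat_poly_at_of_real)
    have "th \<notin> R" using R by auto
    then have "card (complex_of_real ` insert th R) = Suc m"
      using R by (subst card_image) (auto simp: inj_on_def)
    then show "card (complex_of_real ` insert th R) = card {v :: complex. rat_poly_at g v = 0}"
      using finite_rat_poly_at_roots(2)[OF g0, where 'a = complex] card_mono[OF finite_rat_poly_at_roots(1)[OF g0] sub] g(3) by simp
    show "finite {v :: complex. rat_poly_at g v = 0}" by (rule finite_rat_poly_at_roots(1)[OF g0])
  qed
  define P where "P = trace_lift (Suc m) g"
  have cg: "coeff g (Suc m) = 1" using g(3,4) by simp
  have P: "degree P = 2 * Suc m" "lead_coeff P = 1" "integral_poly P"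
    using trace_lift_monic[OF cg] integral_trace_lift[OF g(2)] by (auto simp: P_def)
  have trP: "rat_poly_at P z = z ^ Suc m * rat_poly_at g (trace_map z)" if "z \<noteq> 0" for z :: "'a::field_char_0"
    unfolding P_def by (rule rat_poly_at_trace_lift) (use that g(3) in auto)
  have "rat_poly_at P \<alpha> = 0" using trP[of \<alpha>] a groot[of th] by simp
  have "algebraic_int \<alpha>"
  proof (rule algebraic_int.intros)
    show "lead_coeff (map_poly real_of_rat P) = 1" using P by simp
    show "\<forall>i. coeff (map_poly real_of_rat P) i \<in> \<int>"
      using P(3) by (auto simp: integral_poly_def elim!: Ints_cases) (metis Ints_cases Ints_of_int of_rat_of_int_eq)
    show "poly (map_poly real_of_rat P) \<alpha> = 0" using \<open>rat_poly_at P \<alpha> = 0\<close> by (simp add: rat_poly_at_def)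
  qed
  have Pa: "rat_poly_at P ?a = 0" using \<open>rat_poly_at P \<alpha> = 0\<close> by (simp add: rat_poly_at_of_real)
  have "P \<noteq> 0" using P by auto
  define Q where "Q = min_poly_rat ?a"
  have Q: "lead_coeff Q = 1" "irreducible Q" "rat_poly_at Q ?a = 0"
    using min_poly_rat_root[OF \<open>P \<noteq> 0\<close> Pa] by (auto simp: Q_def)
  have QP: "Q dvd P" using irreducible_dvd_common_root[OF Q(2,3) Pa] .
  have nz: "z \<noteq> 0" if "rat_poly_at Q z = 0" for z :: complex
  proof
    assume "z = 0"
    then have "Q dvd [:0, 1:]" using irreducible_dvd_common_root[OF Q(2) that, of "[:0, 1:]"] by simp
    then obtain h where "[:0, 1:] = Q * h" by blast
    then have "rat_poly_at [:0, 1:] ?a = 0" using Q(3) by simp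
    then show False using a0 by simp
  qed
  have cl: "z = ?a \<or> z = inverse ?a \<or> cmod z = 1" if "rat_poly_at Q z = 0" for z
  proof -
    obtain h where h: "P = Q * h" using QP by blast
    have "rat_poly_at P z = 0" unfolding h using that by simp
    then have "rat_poly_at g (trace_map z) = 0" using trP[OF nz[OF that]] nz[OF that] by simp
    then obtain r where r: "r \<in> insert th R" "trace_map z = of_real r" using roots by blast
    show ?thesis
    proof (cases "r = th")
      case True
      then have "trace_map z = trace_map ?a" using r a by (simp add: trace_map_of_real)
      then show ?thesis using trace_map_eq_iff[OF nz[OF that] a0] by blast
    next
      case False
      then have "0 < r" "r < 4" using r R by auto
      then show ?thesis using trace_map_real_imp_unit[OF nz[OF that] r(2)] by blast
    qed
  qed
  \<comment> \<open>This is where \<open>m \<ge> 1\<close> enters: \<open>g\<close> has degree at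
    least 2, so its roots are irrational.\<close>
  have irr: "th \<noteq> of_rat q" for q
    using groot[of th] irreducible_no_rational_root[OF g(1), of q] g(3) m rat_poly_at_of_rat[of g q, where 'a = real] by auto
  have cardQ: "card {z :: complex. rat_poly_at Q z = 0} = degree Q" "finite {z :: complex. rat_poly_at Q z = 0}"
    using irreducible_card_roots[OF Q(2)] by auto
  \<comment> \<open>Otherwise \<alpha> and its inverse would be the only possible roots, so
    \<open>Q\<close> would have degree 1 or 2, and either the root or the sum of the two roots would
    make \<open>th\<close> rational.\<close>
  have "\<exists>w. rat_poly_at Q w = 0 \<and> cmod w = 1"
  proof (rule ccontr)
    assume no: "\<not> (\<exists>w. rat_poly_at Q w = 0 \<and> cmod w = 1)"
    then have sub: "{z :: complex. rat_poly_at Q z = 0} \<subseteq> {?a, inverse ?a}" using cl by blast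
    have "?a \<noteq> inverse ?a"
    proof
      assume "?a = inverse ?a"
      then have "?a * ?a = 1" using a0 by (metis right_inverse)
      then have "\<alpha> * \<alpha> = 1" by (metis of_real_eq_1_iff of_real_mult)
      then show False using a(1) less_1_mult[of \<alpha> \<alpha>] by simp
    qed
    then have c2: "card {?a, inverse ?a} = 2" by simp
    then have "degree Q \<le> 2" using card_mono[OF _ sub] cardQ by simp
    moreover have "degree Q \<noteq> 0"
      using cardQ Q(3) by (metis (mono_tags, lifting) card_0_eq empty_iff mem_Collect_eq)
    ultimately consider "degree Q = 1" | "degree Q = 2" by linarith
    then show False
    proof cases
      case 1
      then obtain b c where "Q = [:c, b:]" by (rule degree1_coeffs)
      then have "Q = [:c, 1:]" using Q(1) 1 by auto
      then have "of_rat c + ?a = 0" using Q(3) by simp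
      then have "?a = of_rat (- c)" by (simp add: of_rat_minus eq_neg_iff_add_eq_0 add.commute)
      then have al: "\<alpha> = of_rat (- c)" unfolding of_rat_complex by (simp only: of_real_eq_iff)
      have "th = of_rat (trace_map (- c))" unfolding a(2)[symmetric] al trace_map_def
        by (simp only: of_rat_divide of_rat_power of_rat_add of_rat_1)
      then show False using irr by blast
    next
      case 2
      then have "{z :: complex. rat_poly_at Q z = 0} = {?a, inverse ?a}"
        using cardQ c2 by (intro card_subset_eq sub) auto
      then have i: "rat_poly_at Q (inverse ?a) = 0" by blast
      obtain b c d where "Q = [:d, c, b:]" using degree2_coeffs[OF 2] by blast
      moreover have "coeff Q 2 = 1" using Q(1) 2 by simp
      ultimately have Qe: "Q = [:d, c, 1:]" by (simp add: numeral_2_eq_2)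
      define x y where "x = ?a" and "y = inverse ?a"
      have xy: "of_rat d + x * (of_rat c + x) = 0" "of_rat d + y * (of_rat c + y) = 0" "x \<noteq> y" "x * y = 1"
        using Q(3) i \<open>?a \<noteq> inverse ?a\<close> a0 unfolding Qe x_def y_def by auto
      have "(x - y) * (of_rat c + x + y) = (of_rat d + x * (of_rat c + x)) - (of_rat d + y * (of_rat c + y))"
        by (simp add: algebra_simps)
      then have "(x - y) * (of_rat c + x + y) = 0" using xy by simp
      then have "of_rat c + x + y = 0" using xy(3) by simp
      then have s: "x + y = - of_rat c" by (simp add: algebra_simps eq_neg_iff_add_eq_0)
      have "trace_map x = x + y + 2"
        using a0 xy(4) unfolding trace_map_def x_def y_def by (simp add: field_simps power2_eq_square)
      then have "complex_of_real th = of_rat (2 - c)"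
        using s a(2) unfolding x_def by (simp add: trace_map_of_real of_rat_diff)
      then have "th = of_rat (2 - c)" unfolding of_rat_complex by (simp only: of_real_eq_iff)
      then show False using irr by blast
    qed
  qed
  then obtain w where w: "rat_poly_at Q w = 0" "cmod w = 1" by blast
  have "w \<noteq> ?a" using w(2) a by auto
  have "card {w, ?a} \<le> card {z :: complex. rat_poly_at Q z = 0}"
    using w Q(3) cardQ by (intro card_mono) auto
  then have degQ2: "degree Q \<ge> 2" using cardQ \<open>w \<noteq> ?a\<close> by simp
  obtain k where k: "degree Q = 2 * k" "\<And>i. i \<le> 2 * k \<Longrightarrow> coeff Q i = coeff Q (2 * k - i)"
    using irreducible_unit_root_palindrome[OF Q(2,1) degQ2 w] by blast
  from palindrome_trace_lift[OF eq_refl[OF k(1)] k(2)] obtain g1 where "degree g1 \<le> k \<and> Q = trace_lift k g1 \<and>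
    coeff g1 k = coeff Q (2 * k) \<and> (integral_poly Q \<longrightarrow> integral_poly g1)" ..
  then have g1: "degree g1 \<le> k" "Q = trace_lift k g1" "coeff g1 k = coeff Q (2 * k)"
    by simp_all
  have "coeff g1 k = 1" using g1(3) Q(1) k(1) by simp
  then have "g1 \<noteq> 0" by auto
  have "rat_poly_at g1 (trace_map ?a) = 0"
    using rat_poly_at_trace_lift[OF a0 g1(1)] Q(3) a0 unfolding g1(2)[symmetric] by simp
  moreover have "rat_poly_at g (trace_map ?a) = 0"
    using groot[of th] a(2) by (simp add: trace_map_of_real rat_poly_at_of_real)
  \<comment> \<open>Both have the root \<open>trace_map \<alpha>\<close>. The divisibility bounds
    the degree of \<open>Q\<close> from below, and \<open>Q dvd P\<close> bounds it from
    above.\<close>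
  ultimately have "g dvd g1" using irreducible_dvd_common_root[OF g(1)] by blast
  then have "Suc m \<le> k" using dvd_imp_degree_le[OF _ \<open>g1 \<noteq> 0\<close>] g(3) g1(1) by fastforce
  moreover have "2 * k \<le> 2 * Suc m" using dvd_imp_degree_le[OF QP \<open>P \<noteq> 0\<close>] k P by simp
  ultimately have degQ: "degree Q = 2 * (m + 1)" using k(1) by simp
  have "salem \<alpha>"
    unfolding salem_def conjugates_eq Q_def[symmetric]
  proof (intro conjI ballI impI)
    fix z assume z: "z \<in> {w. rat_poly_at Q w = 0}" "z \<noteq> ?a"
    then have "z = inverse ?a \<or> cmod z = 1" using cl[of z] by blast
    moreover have "cmod (inverse ?a) \<le> 1" using a by (simp add: norm_inverse inverse_le_1_iff)
    ultimately show "cmod z \<le> 1" by (elim disjE) simp_all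
  next
    show "\<exists>w\<in>{w. rat_poly_at Q w = 0}. cmod w = 1" using w by blast
  qed (use a \<open>algebraic_int \<alpha>\<close> in auto)
  moreover have "alg_degree \<alpha> = 2 * (m + 1)" using degQ by (simp add: alg_degree_def Q_def)
  moreover have "rat_poly_at g (trace_map \<alpha>) = 0" using groot[of th] a by simp
  ultimately show ?thesis using that R(5) a(2) by blast
qed

section \<open>Reducible polynomials and the asymptotic count\<close>

lemma map_of_rat_monic: "map_poly of_rat (monic n c) = (monic n (\<lambda>i. of_rat (c i)) :: 'a::field_char_0 poly)"
  by (induction n) (auto simp: map_poly_pCons)

lemma map_of_int_monic: "map_poly of_int (monic n c) = (monic n (\<lambda>i. of_int (c i)) :: rat poly)"
  by (induction n) (auto simp: map_poly_pCons)

definition point_poly :: "nat \<Rightarrow> (nat \<Rightarrow> int) \<Rightarrow> rat poly" where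
  "point_poly m p = monic (Suc m) (\<lambda>i. of_int (p i))"

lemma map_of_rat_point_poly: "map_poly of_rat (point_poly m p) = (monic (Suc m) (\<lambda>i. of_int (p i)) :: real poly)"
  unfolding point_poly_def map_of_rat_monic by simp

lemma point_poly_monic: "degree (point_poly m p) = Suc m" "lead_coeff (point_poly m p) = 1"
  unfolding point_poly_def by (auto simp del: monic.simps)

lemma integral_monic: "integral_poly (monic n (\<lambda>i. of_int (c i)))"
  unfolding integral_poly_iff using map_of_int_monic by metis

lemma integral_monic_coeffs:
  assumes "integral_poly g" "degree g = n" "lead_coeff g = 1"
  obtains p where "p \<in> int_vectors n" "g = monic n (\<lambda>i. of_int (p i))"
proof -
  obtain G where G: "g = map_poly rat_of_int G" using assms(1) unfolding integral_poly_iff by blast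
  have d: "degree G = n" using assms(2) unfolding G by (subst (asm) degree_map_poly) auto
  have "rat_of_int (lead_coeff G) = 1" using assms(2,3) d unfolding G by (simp add: coeff_map_poly)
  then have l: "lead_coeff G = 1" by simp
  define p where "p = (\<lambda>i\<in>{..<n}. coeff G (n - Suc i))"
  have "monic n p = monic n (\<lambda>i. coeff G (n - Suc i))" by (rule monic_cong) (simp add: p_def)
  also have "\<dots> = G" by (rule monic_surj[OF d l])
  finally have "g = monic n (\<lambda>i. of_int (p i))" using G map_of_int_monic by metis
  moreover have "p \<in> int_vectors n" by (simp add: p_def int_vectors_def)
  ultimately show ?thesis using that by blast
qed

lemma int_vectors_monic_inject:
  assumes "p \<in> int_vectors n" "q \<in> int_vectors n" "(monic n (\<lambda>i. of_int (p i)) :: rat poly) = monic n (\<lambda>i. of_int (q i))"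
  shows "p = q"
proof (rule PiE_ext)
  show "p \<in> PiE {..<n} (\<lambda>_. UNIV)" "q \<in> PiE {..<n} (\<lambda>_. UNIV)" using assms by (auto simp: int_vectors_def)
  fix i assume "i \<in> {..<n}"
  then show "p i = q i"
    using coeff_monic[of i n "\<lambda>i. rat_of_int (p i)"] coeff_monic[of i n "\<lambda>i. rat_of_int (q i)"] assms(3) by simp
qed

section \<open>Factorisations of polynomials with prescribed real roots\<close>

lemma coeff_rpoly_bound: "finite A \<Longrightarrow> \<bar>coeff (rpoly A) j\<bar> \<le> (\<Prod>r\<in>A. 1 + \<bar>r\<bar>)"
proof (induction A arbitrary: j rule: finite_induct)
  case empty
  then show ?case by (simp add: rpoly_def)
next
  case (insert r A)
  let ?c = "coeff (rpoly A)" and ?P = "\<Prod>r\<in>A. 1 + \<bar>r\<bar>"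
  have "?P \<ge> 0" by (intro prod_nonneg) auto
  then have 1: "\<bar>if j = 0 then 0 else ?c (j - 1)\<bar> \<le> ?P" using insert.IH by auto
  have 2: "\<bar>r * ?c j\<bar> \<le> \<bar>r\<bar> * ?P" unfolding abs_mult using insert.IH by (intro mult_left_mono) auto
  have "\<bar>coeff (rpoly (insert r A)) j\<bar> \<le> ?P + \<bar>r\<bar> * ?P"
    unfolding rpoly_insert[OF insert.hyps(1,2)] coeff_linear_mult using 1 2 by linarith
  then show ?case using insert.hyps by (simp add: algebra_simps)
qed

text \<open>The zeros of \<open>a\<close> and \<open>b\<close> in \<open>S\<close> cover
  \<open>S\<close>, and their numbers are bounded by degrees adding up to \<open>card S\<close>; so
  they are disjoint and exhaust both factors.\<close>

lemma rpoly_factor: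
  assumes S: "finite S" and ab: "a * b = rpoly S" "lead_coeff a = 1" "lead_coeff b = 1"
  obtains A where "A \<subseteq> S" "a = rpoly A" "b = rpoly (S - A)"
proof -
  define A B where "A = {r \<in> S. poly a r = 0}" and "B = {r \<in> S. poly b r = 0}"
  have nz: "a \<noteq> 0" "b \<noteq> 0" using ab by auto
  have fin: "finite A" "finite B" using S by (auto simp: A_def B_def)
  have un: "A \<union> B = S"
  proof -
    have "poly a r = 0 \<or> poly b r = 0" if "r \<in> S" for r
      using rpoly_roots[OF S, of r] that unfolding ab(1)[symmetric] by simp
    then show ?thesis by (auto simp: A_def B_def)
  qed
  have "card A \<le> card {r. poly a r = 0}" "card B \<le> card {r. poly b r = 0}"
    using nz by (auto intro!: card_mono poly_roots_finite simp: A_def B_def)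
  then have le: "card A \<le> degree a" "card B \<le> degree b"
    using card_poly_roots_bound[OF nz(1)] card_poly_roots_bound[OF nz(2)] by auto
  have "degree a + degree b = card S" using degree_mult_eq[OF nz] degree_rpoly[of S] ab(1) by metis
  moreover have "card S + card (A \<inter> B) = card A + card B" using card_Un_Int[OF fin] un by simp
  ultimately have c: "card A = degree a" "card B = degree b" "card (A \<inter> B) = 0" using le by linarith+
  then have "A \<inter> B = {}" using fin by simp
  then have B: "B = S - A" using un by auto
  have 1: "a = rpoly A" using ab c fin by (intro rpoly_eqI) (auto simp: A_def)
  have 2: "b = rpoly B" using ab c fin by (intro rpoly_eqI) (auto simp: B_def)
  show ?thesis by (rule that[OF _ 1 2[unfolded B]]) (auto simp: A_def)
qed

text \<open>A factorisation over the rationals is rescaled to monic factors, to which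
  \<open>gauss_monic\<close> applies.\<close>

lemma reducible_factor:
  fixes g :: "rat poly"
  assumes "integral_poly g" "lead_coeff g = 1" "degree g \<ge> 1" "\<not> irreducible g"
  obtains a b where "g = a * b" "lead_coeff a = 1" "lead_coeff b = 1" "degree a \<ge> 1" "degree b \<ge> 1"
    "integral_poly a" "integral_poly b"
proof -
  have g0: "g \<noteq> 0" using assms by auto
  have "\<not> g dvd 1" using assms(3) is_unit_iff_degree[OF g0] by simp
  then obtain a b where ab: "g = a * b" "\<not> a dvd 1" "\<not> b dvd 1"
    using assms(4) g0 unfolding irreducible_def by blast
  then have nz: "a \<noteq> 0" "b \<noteq> 0" using g0 by auto
  define a' b' where "a' = smult (1 / lead_coeff a) a" and "b' = smult (lead_coeff a) b"
  have l: "lead_coeff a * lead_coeff b = 1" using assms(2) ab(1) by (simp add: lead_coeff_mult)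
  have 1: "g = a' * b'" using ab(1) nz by (simp add: a'_def b'_def)
  have 2: "lead_coeff a' = 1" "lead_coeff b' = 1" using nz l by (auto simp: a'_def b'_def)
  have 3: "degree a' \<ge> 1" "degree b' \<ge> 1"
    using ab(2,3) nz is_unit_iff_degree[OF nz(1)] is_unit_iff_degree[OF nz(2)] by (auto simp: a'_def b'_def)
  have "integral_poly a'" using gauss_monic[of a' b'] assms(1) 1 2 by simp
  moreover have "integral_poly b'" using gauss_monic[of b' a'] assms(1) 1 2 by (simp add: mult.commute)
  ultimately show ?thesis using that 1 2 3 by blast
qed

definition reducible_points :: "nat \<Rightarrow> real \<Rightarrow> (nat \<Rightarrow> int) set" where
  "reducible_points m T = {p \<in> lattice_points m T. \<not> irreducible (point_poly m p)}"

text \<open>The factor called \<open>u\<close> is the one with the large root. Its coefficients are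
  at most the product of 1 + |r| over its roots, where the large root contributes at most 1 + T and
  each small one at most 5.\<close>

lemma reducible_point_factor:
  assumes T: "T > 4" and p: "p \<in> reducible_points m T"
  shows "\<exists>k\<in>{1..m}. \<exists>u\<in>{u \<in> int_vectors k. \<forall>i<k. \<bar>of_int (u i) - 0\<bar> \<le> (1 + T) * 5 ^ m}.
    \<exists>v\<in>{v \<in> int_vectors (Suc m - k). \<forall>i<Suc m - k. \<bar>of_int (v i) - 0\<bar> \<le> (5 :: real) ^ m}.
     point_poly m p = monic k (\<lambda>i. of_int (u i)) * monic (Suc m - k) (\<lambda>i. of_int (v i))"
proof -
  let ?g = "point_poly m p"
  have "salem_poly m T (map_poly of_rat ?g)"
    using p unfolding reducible_points_def lattice_points_def salem_region_def map_of_rat_point_poly by simp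
  then obtain R th where R: "finite R" "card R = m" "R \<subseteq> {0<..<4}" "4 < th" "th < T"
    "map_poly real_of_rat ?g = [:- th, 1:] * rpoly R"
    unfolding salem_poly_def by blast
  have nin: "th \<notin> R" using R by auto
  define S where "S = insert th R"
  have S: "finite S" "map_poly real_of_rat ?g = rpoly S"
    using R rpoly_insert[OF R(1) nin] by (auto simp: S_def)
  have "integral_poly ?g" unfolding point_poly_def by (rule integral_monic)
  moreover have "\<not> irreducible ?g" using p by (simp add: reducible_points_def)
  ultimately obtain a0 b0 where ab0: "?g = a0 * b0" "lead_coeff a0 = 1" "lead_coeff b0 = 1" "degree a0 \<ge> 1" "degree b0 \<ge> 1"
    "integral_poly a0" "integral_poly b0"
    using reducible_factor[of ?g] point_poly_monic[of m p] by auto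
  have mp: "map_poly real_of_rat (c * d) = map_poly real_of_rat c * map_poly real_of_rat d" for c d
    by (rule poly_eqI) (simp add: coeff_mult of_rat_sum of_rat_mult)
  have "\<exists>a b A. ?g = a * b \<and> lead_coeff a = 1 \<and> lead_coeff b = 1 \<and> degree a \<ge> 1 \<and> degree b \<ge> 1 \<and>
    integral_poly a \<and> integral_poly b \<and> A \<subseteq> S \<and> map_poly real_of_rat a = rpoly A \<and> map_poly real_of_rat b = rpoly (S - A) \<and> th \<in> A"
  proof -
    have "map_poly real_of_rat a0 * map_poly real_of_rat b0 = rpoly S" using S(2) ab0(1) mp by simp
    then obtain A where A: "A \<subseteq> S" "map_poly real_of_rat a0 = rpoly A" "map_poly real_of_rat b0 = rpoly (S - A)"
      by (rule rpoly_factor[OF S(1)]) (use ab0 in auto)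
    show ?thesis
    proof (cases "th \<in> A")
      case True
      then show ?thesis using ab0 A by blast
    next
      case False
      then have "th \<in> S - A" by (simp add: S_def)
      moreover have "S - (S - A) = A" using A(1) by auto
      moreover have "?g = b0 * a0" using ab0(1) by (simp add: mult.commute)
      ultimately show ?thesis using ab0 A by (intro exI[of _ b0] exI[of _ a0] exI[of _ "S - A"]) auto
    qed
  qed
  then obtain a b A where ab: "?g = a * b" "lead_coeff a = 1" "lead_coeff b = 1" "degree a \<ge> 1" "degree b \<ge> 1"
    "integral_poly a" "integral_poly b" and A: "A \<subseteq> S" "map_poly real_of_rat a = rpoly A"
    "map_poly real_of_rat b = rpoly (S - A)" "th \<in> A"
    by blast
  define k where "k = degree a"
  have "a \<noteq> 0" "b \<noteq> 0" using ab by auto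
  then have "k + degree b = Suc m" using degree_mult_eq[of a b] ab(1) point_poly_monic(1)[of m p] by (simp add: k_def)
  then have k: "k \<in> {1..m}" "degree b = Suc m - k" using ab(4,5) by (auto simp: k_def)
  obtain u where u: "u \<in> int_vectors k" "a = monic k (\<lambda>i. of_int (u i))"
    using integral_monic_coeffs[OF ab(6) k_def[symmetric] ab(2)] by blast
  obtain v where v: "v \<in> int_vectors (Suc m - k)" "b = monic (Suc m - k) (\<lambda>i. of_int (v i))"
    using integral_monic_coeffs[OF ab(7) k(2) ab(3)] by blast
  have bR: "(\<Prod>r\<in>B. 1 + \<bar>r\<bar>) \<le> 5 ^ m" if "B \<subseteq> R" for B
  proof -
    have "(\<Prod>r\<in>B. 1 + \<bar>r\<bar>) \<le> (\<Prod>r\<in>B. 5)" using that R(3) by (intro prod_mono) force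
    also have "\<dots> = 5 ^ card B" by simp
    also have "\<dots> \<le> (5 :: real) ^ m" using card_mono[OF R(1) that] R(2) by (intro power_increasing) auto
    finally show ?thesis .
  qed
  have finA: "finite A" using A(1) S(1) finite_subset by blast
  have bA: "\<bar>coeff (rpoly A) j\<bar> \<le> (1 + T) * 5 ^ m" for j
  proof -
    have "\<bar>coeff (rpoly A) j\<bar> \<le> (\<Prod>r\<in>A. 1 + \<bar>r\<bar>)" by (rule coeff_rpoly_bound[OF finA])
    also have "\<dots> = (1 + \<bar>th\<bar>) * (\<Prod>r\<in>A - {th}. 1 + \<bar>r\<bar>)" using A(4) finA by (subst prod.remove[of _ th]) auto
    also have "\<dots> \<le> (1 + T) * 5 ^ m"
      using R T A(1) by (intro mult_mono bR prod_nonneg) (auto simp: S_def)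
    finally show ?thesis .
  qed
  have bB: "\<bar>coeff (rpoly (S - A)) j\<bar> \<le> 5 ^ m" for j
  proof -
    have "S - A \<subseteq> R" using A(4) by (auto simp: S_def)
    then show ?thesis using coeff_rpoly_bound[of "S - A" j] S(1) bR[of "S - A"] by simp
  qed
  have "\<bar>of_int (u i) - 0\<bar> \<le> (1 + T) * 5 ^ m" if "i < k" for i
  proof -
    have "real_of_int (u i) = real_of_rat (coeff a (k - Suc i))"
      unfolding u(2) coeff_monic[OF that] by simp
    also have "\<dots> = coeff (rpoly A) (k - Suc i)" using A(2) coeff_map_of_rat[of a, where 'a = real] by metis
    finally show ?thesis using bA by simp
  qed
  moreover have "\<bar>of_int (v i) - 0\<bar> \<le> (5 :: real) ^ m" if "i < Suc m - k" for i
  proof -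
    have "real_of_int (v i) = real_of_rat (coeff b (Suc m - k - Suc i))"
      unfolding v(2) coeff_monic[OF that] by simp
    also have "\<dots> = coeff (rpoly (S - A)) (Suc m - k - Suc i)" using A(3) coeff_map_of_rat[of b, where 'a = real] by metis
    finally show ?thesis using bB by simp
  qed
  ultimately show ?thesis using k(1) u v ab(1) by blast
qed

text \<open>A first factor of degree \<open>k\<close> has \<open>k\<close> free coefficients of size
  O(T), and \<open>k \<le> m\<close>. \<open>Y\<close> bounds the number of second factors for all
  \<open>k\<close> at once, and \<open>m\<close> counts the degrees.\<close>

lemma card_reducible_points:
  "\<exists>C\<ge>0. \<forall>T>4. real (card (reducible_points m T)) \<le> C * T ^ m"
proof -
  define Y :: real where "Y = (2 * 5 ^ m + 1) ^ Suc m"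
  define C where "C = real m * ((4 * 5 ^ m) ^ m * Y)"
  have "real (card (reducible_points m T)) \<le> C * T ^ m" if T: "T > 4" for T
  proof -
    define U where "U k = {u \<in> int_vectors k. \<forall>i<k. \<bar>of_int (u i) - 0\<bar> \<le> (1 + T) * 5 ^ m}" for k
    define V where "V k = {v \<in> int_vectors k. \<forall>i<k. \<bar>of_int (v i) - 0\<bar> \<le> (5 :: real) ^ m}" for k
    define F where "F k = (\<lambda>(u, v). monic k (\<lambda>i. rat_of_int (u i)) * monic (Suc m - k) (\<lambda>i. of_int (v i))) ` (U k \<times> V (Suc m - k))" for k
    have U: "finite (U k)" "real (card (U k)) \<le> (2 * ((1 + T) * 5 ^ m) + 1) ^ k" for k
      unfolding U_def using card_int_box[of "(1 + T) * 5 ^ m" k "\<lambda>_. 0"] T by auto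
    have V: "finite (V k)" "real (card (V k)) \<le> (2 * 5 ^ m + 1) ^ k" for k
      unfolding V_def using card_int_box[of "5 ^ m" k "\<lambda>_. 0"] by auto
    have inj: "inj_on (point_poly m) (reducible_points m T)"
      by (rule inj_onI, rule int_vectors_monic_inject[of _ "Suc m"])
         (auto simp: reducible_points_def lattice_points_def point_poly_def simp del: monic.simps)
    have sub: "point_poly m ` reducible_points m T \<subseteq> (\<Union>k\<in>{1..m}. F k)"
    proof
      fix g assume "g \<in> point_poly m ` reducible_points m T"
      then obtain p where p: "p \<in> reducible_points m T" "g = point_poly m p" by blast
      obtain k u v where "k \<in> {1..m}" "u \<in> U k" "v \<in> V (Suc m - k)"
        "g = monic k (\<lambda>i. of_int (u i)) * monic (Suc m - k) (\<lambda>i. of_int (v i))"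
        using reducible_point_factor[OF T p(1)] p(2) unfolding U_def V_def by blast
      then show "g \<in> (\<Union>k\<in>{1..m}. F k)" unfolding F_def by (intro UN_I[of k]) auto
    qed
    have X: "2 * ((1 + T) * 5 ^ m) + 1 \<le> 4 * 5 ^ m * T"
    proof -
      have "(1 :: real) \<le> 5 ^ m" by simp
      moreover have "(5 :: real) ^ m * 4 \<le> 5 ^ m * T" using T by (intro mult_left_mono) auto
      moreover have "2 * ((1 + T) * 5 ^ m) + 1 = 2 * 5 ^ m + 2 * (5 ^ m * T) + 1" by (simp add: algebra_simps)
      ultimately show ?thesis by linarith
    qed
    have X1: "2 * ((1 + T) * 5 ^ m) + 1 \<ge> 1" using T by simp
    have cF: "real (card (F k)) \<le> (4 * 5 ^ m) ^ m * T ^ m * Y" if "k \<in> {1..m}" for k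
    proof -
      have "card (F k) \<le> card (U k \<times> V (Suc m - k))" unfolding F_def using U V by (intro card_image_le) auto
      then have "real (card (F k)) \<le> real (card (U k)) * real (card (V (Suc m - k)))"
        by (simp only: card_cartesian_product of_nat_mult[symmetric] of_nat_le_iff)
      also have "\<dots> \<le> (2 * ((1 + T) * 5 ^ m) + 1) ^ k * (2 * 5 ^ m + 1) ^ (Suc m - k)"
        using U V T by (intro mult_mono) auto
      also have "\<dots> \<le> (2 * ((1 + T) * 5 ^ m) + 1) ^ m * Y"
        unfolding Y_def using that X1 by (intro mult_mono power_increasing) auto
      also have "\<dots> \<le> (4 * 5 ^ m * T) ^ m * Y"
        using X X1 by (intro mult_right_mono power_mono) (auto simp: Y_def)
      finally show ?thesis by (simp add: power_mult_distrib)
    qed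
    have finF: "finite (F k)" for k unfolding F_def using U V by auto
    have "card (reducible_points m T) = card (point_poly m ` reducible_points m T)" using card_image[OF inj] by simp
    also have "\<dots> \<le> card (\<Union>k\<in>{1..m}. F k)" using finF by (intro card_mono[OF _ sub]) auto
    also have "\<dots> \<le> (\<Sum>k\<in>{1..m}. card (F k))" by (intro card_UN_le) auto
    finally have "real (card (reducible_points m T)) \<le> (\<Sum>k\<in>{1..m}. real (card (F k)))"
      by (simp only: of_nat_sum[symmetric] of_nat_le_iff)
    also have "\<dots> \<le> (\<Sum>k\<in>{1..m}. (4 * 5 ^ m) ^ m * T ^ m * Y)" using cF by (rule sum_mono)
    also have "\<dots> = C * T ^ m" by (simp add: C_def)
    finally show ?thesis .
  qed
  moreover have "C \<ge> 0" by (simp add: C_def Y_def)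
  ultimately show ?thesis by blast
qed

section \<open>Comparing Salem numbers with lattice points\<close>

lemma salem_poly_root_unique:
  assumes "salem_poly m T p" "poly p x = 0" "poly p y = 0" "x > 4" "y > 4"
  shows "x = y"
proof -
  obtain R z where R: "finite R" "R \<subseteq> {0<..<4}" "p = [:- z, 1:] * rpoly R"
    using assms(1) unfolding salem_poly_def by blast
  have "w = z" if "poly p w = 0" "w > 4" for w
    using that R(2) rpoly_roots[OF R(1), of w] unfolding R(3) by auto
  then show ?thesis using assms by blast
qed

lemma salem_set_upper:
  assumes "H > 1" "T > trace_map H"
  shows "finite (salem_set m H)" "card (salem_set m H) \<le> card (lattice_points m T)"
proof -
  have T: "T > 4" using trace_map_gt_4[OF assms(1)] assms(2) by simp
  have fin: "finite (lattice_points m T)" using lattice_points_bounds[of m] T by blast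
  have "\<exists>p. p \<in> lattice_points m T \<and> rat_poly_at (point_poly m p) (trace_map \<alpha>) = 0" if \<alpha>: "\<alpha> \<in> salem_set m H" for \<alpha>
  proof -
    have s: "salem \<alpha>" "alg_degree \<alpha> = 2 * (m + 1)" "\<alpha> \<le> H" using \<alpha> by (auto simp: salem_set_def)
    have "\<alpha> > 1" using s(1) by (simp add: salem_def)
    then have tr: "trace_map \<alpha> < T"
      using trace_map_less_iff[of \<alpha> H] s(3) assms by (cases "\<alpha> = H") auto
    obtain g where g: "integral_poly g" "degree g = Suc m" "lead_coeff g = 1" "rat_poly_at g (trace_map \<alpha>) = 0"
      "\<And>T. T > trace_map \<alpha> \<Longrightarrow> salem_poly m T (map_poly of_rat g)"
      using salem_trace_poly[OF s(1,2)] by blast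
    obtain p where p: "p \<in> int_vectors (Suc m)" "g = monic (Suc m) (\<lambda>i. of_int (p i))"
      using integral_monic_coeffs[OF g(1-3)] by blast
    then have gp: "g = point_poly m p" by (simp add: point_poly_def)
    have "p \<in> lattice_points m T"
      using p(1) g(5)[OF tr] unfolding lattice_points_def salem_region_def gp map_of_rat_point_poly by simp
    then show ?thesis using g(4) gp by blast
  qed
  then obtain f where f: "\<And>\<alpha>. \<alpha> \<in> salem_set m H \<Longrightarrow> f \<alpha> \<in> lattice_points m T \<and> rat_poly_at (point_poly m (f \<alpha>)) (trace_map \<alpha>) = 0"
    by metis
  have "inj_on f (salem_set m H)"
  proof (rule inj_onI)
    fix a b assume ab: "a \<in> salem_set m H" "b \<in> salem_set m H" "f a = f b"
    then have 1: "a > 1" "b > 1" by (auto simp: salem_set_def salem_def)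
    have "salem_poly m T (monic (Suc m) (\<lambda>i. of_int (f a i)))"
      using f[OF ab(1)] unfolding lattice_points_def salem_region_def by simp
    then have sp: "salem_poly m T (map_poly of_rat (point_poly m (f a)))" unfolding map_of_rat_point_poly .
    have "trace_map a = trace_map b"
      by (rule salem_poly_root_unique[OF sp]) (use f[OF ab(1)] f[OF ab(2)] ab(3) 1 trace_map_gt_4 in \<open>auto simp: rat_poly_at_def\<close>)
    then show "a = b" using trace_map_less_iff[OF 1] trace_map_less_iff[OF 1(2,1)] by linarith
  qed
  moreover have "f ` salem_set m H \<subseteq> lattice_points m T" using f by blast
  ultimately show "finite (salem_set m H)" "card (salem_set m H) \<le> card (lattice_points m T)"
    using fin inj_on_finite card_inj_on_le by blast+
qed

text \<open>Each irreducible lattice point yields a Salem number, and different points yield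
  different numbers, since monic irreducible polynomials with a common root coincide.\<close>

lemma salem_set_lower:
  assumes "m \<ge> 1" "H > 1"
  shows "card (lattice_points m (trace_map H)) \<le> card (salem_set m H) + card (reducible_points m (trace_map H))"
proof -
  let ?T = "trace_map H"
  let ?I = "{p \<in> lattice_points m ?T. irreducible (point_poly m p)}"
  have T: "?T > 4" using trace_map_gt_4[OF assms(2)] .
  have fin: "finite (lattice_points m ?T)" using lattice_points_bounds[of m] T by blast
  have "\<exists>\<alpha>. \<alpha> \<in> salem_set m H \<and> rat_poly_at (point_poly m p) (trace_map \<alpha>) = 0" if p: "p \<in> ?I" for p
  proof -
    have sp: "salem_poly m ?T (map_poly of_rat (point_poly m p))"
      using p unfolding lattice_points_def salem_region_def map_of_rat_point_poly by simp
    have irr: "irreducible (point_poly m p)" using p by simp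
    have int: "integral_poly (point_poly m p)" unfolding point_poly_def by (rule integral_monic)
    obtain \<alpha> where \<alpha>: "salem \<alpha>" "alg_degree \<alpha> = 2 * (m + 1)" "trace_map \<alpha> < ?T" "rat_poly_at (point_poly m p) (trace_map \<alpha>) = 0"
      using trace_poly_salem[OF irr int point_poly_monic assms(1) sp] by blast
    have "\<alpha> > 1" using \<alpha>(1) by (simp add: salem_def)
    then have "\<alpha> < H" using trace_map_less_iff assms(2) \<alpha>(3) by blast
    then show ?thesis using \<alpha> by (auto simp: salem_set_def)
  qed
  then obtain f where f: "\<And>p. p \<in> ?I \<Longrightarrow> f p \<in> salem_set m H \<and> rat_poly_at (point_poly m p) (trace_map (f p)) = 0"
    by metis
  have "inj_on f ?I"
  proof (rule inj_onI)
    fix p q assume pq: "p \<in> ?I" "q \<in> ?I" "f p = f q"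
    have irr: "irreducible (point_poly m p)" using pq by simp
    have "point_poly m p dvd point_poly m q"
      by (rule irreducible_dvd_common_root[OF irr, of "trace_map (f p)"]) (use f[OF pq(1)] f[OF pq(2)] pq(3) in auto)
    then have "point_poly m p = point_poly m q"
      by (rule monic_dvd_antisym) (simp add: point_poly_monic(1), rule point_poly_monic, rule point_poly_monic)
    then show "p = q" unfolding point_poly_def
      by (intro int_vectors_monic_inject[of p "Suc m" q]) (use pq in \<open>auto simp: lattice_points_def simp del: monic.simps\<close>)
  qed
  \<comment> \<open>The comparison needs \<open>salem_set m H\<close> to be finite, as an infinite
    set has \<open>card\<close> 0; any bound above \<open>trace_map H\<close> provides this, here
    \<open>?T + 1\<close>.\<close>
  then have "card ?I \<le> card (salem_set m H)"
    using f salem_set_upper(1)[OF assms(2), of "?T + 1" m] by (intro card_inj_on_le[of f]) auto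
  moreover have "lattice_points m ?T = ?I \<union> reducible_points m ?T" by (auto simp: reducible_points_def)
  then have "card (lattice_points m ?T) \<le> card ?I + card (reducible_points m ?T)" by (metis card_Un_le)
  ultimately show ?thesis by linarith
qed

lemma power_Suc_diff_le:
  fixes a b :: real
  assumes "0 \<le> b" "b \<le> a"
  shows "a ^ Suc n - b ^ Suc n \<le> real (Suc n) * (a - b) * a ^ n"
proof (induction n)
  case (Suc n)
  have "a ^ Suc (Suc n) - b ^ Suc (Suc n) = a * (a ^ Suc n - b ^ Suc n) + (a - b) * b ^ Suc n"
    by (simp add: algebra_simps)
  also have "\<dots> \<le> a * (real (Suc n) * (a - b) * a ^ n) + (a - b) * a ^ Suc n"
    using Suc assms by (intro add_mono mult_left_mono power_mono) auto
  also have "\<dots> = real (Suc (Suc n)) * (a - b) * a ^ Suc n" by (simp add: algebra_simps)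
  finally show ?case .
qed simp

theorem theorem1:
  fixes m :: nat
  assumes "m \<ge> 1"
  shows "(\<lambda>H. real (card (salem_set m H)) - omega m * H ^ (m + 1))
           \<in> O[at_top](\<lambda>H. H ^ m)"
proof -
  obtain C where C: "C \<ge> 0" "\<And>T. T > 4 \<Longrightarrow> omega m * (T - 4) ^ (m + 1) - C * T ^ m \<le> real (card (lattice_points m T))"
    "\<And>T. T > 4 \<Longrightarrow> real (card (lattice_points m T)) \<le> omega m * T ^ (m + 1) + C * T ^ m"
    using lattice_points_bounds[of m] by blast
  obtain D where D: "D \<ge> 0" "\<And>T. T > 4 \<Longrightarrow> real (card (reducible_points m T)) \<le> D * T ^ m"
    using card_reducible_points[of m] by blast
  \<comment> \<open>The summand with \<open>omega m\<close> pays for replacing powers of H + 4 and H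
    - 4 by powers of H; \<open>C\<close> is the boundary error and \<open>D\<close> the reducible
    points. The power of 5 comes from H + 4 \<le> 5 H.\<close>
  define K where "K = (4 * omega m * real (Suc m) + C + D) * 5 ^ m"
  have w: "omega m > 0" by (rule omega_pos)
  have "\<bar>real (card (salem_set m H)) - omega m * H ^ (m + 1)\<bar> \<le> K * H ^ m" if H: "H \<ge> 4" for H
  proof -
    define T where "T = trace_map H"
    have "T = H + 2 + 1 / H" using H by (simp add: T_def trace_map_def field_simps power2_eq_square)
    moreover have "0 < 1 / H" "1 / H \<le> 1" using H by (auto simp: field_simps)
    ultimately have TH: "H \<le> T" "T \<le> H + 3" by auto
    have H1: "H > 1" using H by simp
    have T4: "T > 4" unfolding T_def using trace_map_gt_4[OF H1] .
    have p5: "(H + 4) ^ m \<le> 5 ^ m * H ^ m"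
      unfolding power_mult_distrib[symmetric] using H by (intro power_mono) auto
    \<comment> \<open>\<open>T + 1\<close> meets the strict inequality of
      \<open>salem_set_upper\<close> and is still at most H + 4.\<close>
    have "real (card (salem_set m H)) \<le> real (card (lattice_points m (T + 1)))"
      using salem_set_upper(2)[OF H1, of "T + 1" m] by (simp add: T_def)
    also have "\<dots> \<le> omega m * (T + 1) ^ (m + 1) + C * (T + 1) ^ m" using C(3) T4 by simp
    also have "\<dots> \<le> omega m * (H + 4) ^ (m + 1) + C * (H + 4) ^ m"
    proof -
      have p: "(T + 1) ^ k \<le> (H + 4) ^ k" for k using TH(2) T4 by (intro power_mono) linarith+
      show ?thesis using w C(1) by (intro add_mono mult_left_mono p) auto
    qed
    also have "(H + 4) ^ (m + 1) \<le> H ^ (m + 1) + real (Suc m) * 4 * (H + 4) ^ m"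
      using power_Suc_diff_le[of H "H + 4" m] H by simp
    finally have "real (card (salem_set m H)) \<le> omega m * (H ^ (m + 1) + real (Suc m) * 4 * (H + 4) ^ m) + C * (H + 4) ^ m"
      using w by simp
    then have "real (card (salem_set m H)) - omega m * H ^ (m + 1) \<le> (4 * omega m * real (Suc m) + C) * (H + 4) ^ m"
      by (simp add: algebra_simps)
    also have "\<dots> \<le> (4 * omega m * real (Suc m) + C + D) * (5 ^ m * H ^ m)"
      using p5 w C(1) D(1) H by (intro mult_mono) auto
    finally have up: "real (card (salem_set m H)) - omega m * H ^ (m + 1) \<le> K * H ^ m" by (simp add: K_def)
    have "H ^ (m + 1) - (H - 4) ^ (m + 1) \<le> real (Suc m) * 4 * H ^ m"
      using power_Suc_diff_le[of "H - 4" H m] H by simp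
    then have "omega m * (H ^ (m + 1) - (H - 4) ^ (m + 1)) \<le> omega m * (real (Suc m) * 4 * H ^ m)"
      using w by (intro mult_left_mono) auto
    moreover have "omega m * (H - 4) ^ (m + 1) \<le> omega m * (T - 4) ^ (m + 1)"
      using TH H w by (intro mult_left_mono power_mono) auto
    moreover have "omega m * (T - 4) ^ (m + 1) \<le> real (card (salem_set m H)) + (C + D) * T ^ m"
    proof -
      have "real (card (lattice_points m T)) \<le> real (card (salem_set m H)) + real (card (reducible_points m T))"
        using salem_set_lower[OF assms H1] by (simp add: T_def flip: of_nat_add)
      then show ?thesis using C(2)[OF T4] D(2)[OF T4] by (simp add: algebra_simps)
    qed
    moreover have "(C + D) * T ^ m \<le> (C + D) * (H + 4) ^ m"
      using TH T4 C(1) D(1) by (intro mult_left_mono power_mono) auto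
    moreover have "omega m * (real (Suc m) * 4 * H ^ m) \<le> omega m * (real (Suc m) * 4 * (H + 4) ^ m)"
      using w H by (intro mult_left_mono power_mono) auto
    ultimately have "omega m * H ^ (m + 1) - real (card (salem_set m H)) \<le> (4 * omega m * real (Suc m) + C + D) * (H + 4) ^ m"
      by (simp add: algebra_simps)
    also have "\<dots> \<le> (4 * omega m * real (Suc m) + C + D) * (5 ^ m * H ^ m)"
      using p5 w C(1) D(1) H by (intro mult_left_mono) auto
    finally have "omega m * H ^ (m + 1) - real (card (salem_set m H)) \<le> K * H ^ m" by (simp add: K_def)
    then show ?thesis using up by linarith
  qed
  then show ?thesis
    by (intro bigoI[of _ K]) (auto simp: eventually_at_top_linorder intro!: exI[of _ 4])
qed

end
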